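(* In the setting of the context, assume that as $p \to +\infty$: $s \to +\infty$, $s = o(p)$, $n_1 = \omega(s)$ and $n_2 = \omega(s)$. Let $n_{\mathrm{ALG}} := 2 s\log(p-s) + s + 1$. (i) If there exists $\varepsilon>0$ such that $n < (1-\varepsilon) n_{\mathrm{ALG}}$, then for any sequence $\lambda_p > 0$ such that $\frac{n_1\sigma_1^2 + n_2\sigma_2^2}{\lambda_p^2 n^2}$ has a limit in $\mathbb{R}_{\ge 0}\cup\{+\infty\}$, we have $\mathbb{P}_{X,Z}(\mathcal{R}(X,\beta^\star,Z,\lambda_p)) \to 0$. (ii) If there exists $\varepsilon > 0$ such that $n > (1+\varepsilon) n_{\mathrm{ALG}}$, and $(\lambda_p)_{p\ge1} \to 0$ is chosen such that $$ \frac{n\lambda_p^2}{\sigma_{\mathrm{avg}}^2 \log(p-s)} \to +\infty \quad\text{and}\quad \frac{1}{\rho}\left[\lambda_p\sqrt{s} + \sqrt{\frac{\sigma_{\mathrm{avg}}^2 \log s}{n}}\right] \to 0, $$ then $\mathbb{P}_{X,Z}(\mathcal{R}(X,\beta^\star,Z,\lambda_p)) \to 1$.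
   Context: All quantities ($s, n_1, n_2, \sigma_1, \sigma_2, \rho, \beta^\star, \lambda_p$) may depend on $p$; limits are as $p\to+\infty$. $n = n_1 + n_2$. The design $X \in \mathbb{R}^{n\times p}$ has i.i.d. $\mathcal{N}(0,1)$ entries; $0<\sigma_1^2<\sigma_2^2$; $\Sigma = \begin{pmatrix} \sigma_1 I_{n_1} & 0 \\ 0 & \sigma_2 I_{n_2}\end{pmatrix}$; $W \sim \mathcal{N}(0,I_n)$ independent of $X$; $Z = \Sigma W$; $Y = X\beta^\star + Z$. The signal $\beta^\star \in \mathbb{R}^p$ is deterministic with exactly $s$ nonzero coordinates, each satisfying $|\beta^\star_i| \ge \rho$ for some $\rho > 0$. $\sigma_{\mathrm{avg}}^2 := (n_1\sigma_1^2 + n_2\sigma_2^2)/n$. The Lasso solution set is $\mathcal{B}_{\mathrm{Lasso}} := \arg\min_{\beta\in\mathbb{R}^p}\{ \frac{1}{2n}\|Y - X\beta\|_2^2 + \lambda_p\|\beta\|_1\}$. With $\operatorname{sign}(0)=0$, $\operatorname{sign}(x)=x/|x|$ for $x\neq 0$ applied coordinatewise, the recovery event is $\mathcal{R}(X,\beta^\star,Z,\lambda_p) := \{\exists\, \hat\beta\in\mathcal{B}_{\mathrm{Lasso}} : \operatorname{sign}(\hat\beta) = \operatorname{sign}(\beta^\star)\}$.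
   Formalization: In part (ii) the regularization parameters are assumed positive (λ_p > 0 for all p), as part (i) already states; for negative λ_p with n < p the Lasso objective is unbounded below, the solution set is empty, and the claim would fail. *)

theory Defs
  imports "HOL-Probability.Probability" "HOL-Library.Landau_Symbols"
begin

definition std_gauss_vec :: "'a set \<Rightarrow> ('a \<Rightarrow> real) measure" where
  "std_gauss_vec I = PiM I (\<lambda>_. density lborel std_normal_density)"

text \<open>Lasso objective: vectors in R^p are functions nat => real vanishing outside {..<p};
  the design X is an n x p matrix given as a function on index pairs.\<close>
definition lasso_obj ::
  "nat \<Rightarrow> nat \<Rightarrow> (nat \<times> nat \<Rightarrow> real) \<Rightarrow> (nat \<Rightarrow> real) \<Rightarrow> real \<Rightarrow> (nat \<Rightarrow> real) \<Rightarrow> real" where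
  "lasso_obj n p X Y lam \<beta> =
     (1 / (2 * real n)) * (\<Sum>i<n. (Y i - (\<Sum>j<p. X (i, j) * \<beta> j))\<^sup>2) + lam * (\<Sum>j<p. \<bar>\<beta> j\<bar>)"

definition is_vec :: "nat \<Rightarrow> (nat \<Rightarrow> real) \<Rightarrow> bool" where
  "is_vec p \<beta> \<longleftrightarrow> (\<forall>j\<ge>p. \<beta> j = 0)"

definition lasso_set ::
  "nat \<Rightarrow> nat \<Rightarrow> (nat \<times> nat \<Rightarrow> real) \<Rightarrow> (nat \<Rightarrow> real) \<Rightarrow> real \<Rightarrow> (nat \<Rightarrow> real) set" where
  "lasso_set n p X Y lam =
     {\<beta>. is_vec p \<beta> \<and> (\<forall>\<beta>'. is_vec p \<beta>' \<longrightarrow> lasso_obj n p X Y lam \<beta> \<le> lasso_obj n p X Y lam \<beta>')}"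

definition recovery ::
  "nat \<Rightarrow> nat \<Rightarrow> (nat \<times> nat \<Rightarrow> real) \<Rightarrow> (nat \<Rightarrow> real) \<Rightarrow> (nat \<Rightarrow> real) \<Rightarrow> real \<Rightarrow> bool" where
  "recovery n p X \<beta>s Z lam \<longleftrightarrow>
     (\<exists>\<beta>\<in>lasso_set n p X (\<lambda>i. (\<Sum>j<p. X (i, j) * \<beta>s j) + Z i) lam.
        \<forall>j<p. sgn (\<beta> j) = sgn (\<beta>s j))"

text \<open>P_{X,Z}(R): X has i.i.d. N(0,1) entries, W ~ N(0,I_n) independent, Z = Sigma W with
  Sigma = diag(sigma1 I_{n1}, sigma2 I_{n2}).\<close>
definition recovery_prob ::
  "nat \<Rightarrow> nat \<Rightarrow> nat \<Rightarrow> real \<Rightarrow> real \<Rightarrow> (nat \<Rightarrow> real) \<Rightarrow> real \<Rightarrow> real" where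
  "recovery_prob n1 n2 p \<sigma>1 \<sigma>2 \<beta>s lam =
     (let n = n1 + n2;
          M = std_gauss_vec ({..<n} \<times> {..<p}) \<Otimes>\<^sub>M std_gauss_vec {..<n}
      in measure M ({(X, W). recovery n p X \<beta>s (\<lambda>i. (if i < n1 then \<sigma>1 else \<sigma>2) * W i) lam}
                    \<inter> space M))"

end

theory Submission
  imports Defs "HOL-Real_Asymp.Real_Asymp"
begin

text \<open>
  A sign-recovering solution has a residual \<open>r\<close> determined by the support columns \<open>X\<^sub>S\<close> and the noise
  alone, with \<open>X\<^sub>S\<^sup>T r = n \<lambda> sign \<beta>\<^sup>*\<close>; the remaining columns are independent of \<open>r\<close>, and recovery
  requires \<open>\<bar>X\<^sub>j\<^sup>T r\<bar> \<le> n \<lambda>\<close> for all \<open>p - s\<close> of them. Hence everything is decided by comparing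
  \<open>2 \<parallel>r\<parallel>\<^sup>2 log (p - s)\<close> with \<open>(n \<lambda>)\<^sup>2\<close>.

  Below the threshold, testing \<open>r\<close> against \<open>X\<^sub>S sign \<beta>\<^sup>*\<close>, whose squared norm is about \<open>s n\<close>, gives
  \<open>\<parallel>r\<parallel>\<^sup>2 \<ge> (n \<lambda>)\<^sup>2 s / ((1 + \<eta>) n)\<close>, which is too large. Above it, a net argument shows that both row blocks
  of \<open>X\<^sub>S\<close> are nearly isometric up to scaling since \<open>n\<^sub>1\<close> and \<open>n\<^sub>2\<close> dominate \<open>s\<close>; this bounds \<open>\<parallel>r\<parallel>\<^sup>2\<close> from above,
  and, applied to each block separately, bounds the variance of every coordinate of the least squares
  fit of the noise by a multiple of \<open>\<sigma>\<^sub>a\<^sub>v\<^sub>g\<^sup>2 / n\<close> although \<open>\<sigma>\<^sub>2\<^sup>2\<close> may be much larger than \<open>\<sigma>\<^sub>a\<^sub>v\<^sub>g\<^sup>2\<close>.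
\<close>

subsection \<open>Gaussian vectors\<close>

text \<open>The comparison behind both halves: given \<open>r\<close>, the correlations of the other
  columns with \<open>r\<close> are \<open>p - s\<close> independent centred Gaussians of variance
  equal to the squared norm of \<open>r\<close>, and their maximum modulus is about that norm times
  \<open>sqrt (2 * ln (p - s))\<close>. The Lasso bias alone contributes about
  \<open>(n * lam)^2 * s / n\<close> to the squared norm, and inserting this value gives
  \<open>n = 2 * s * ln (p - s)\<close>. In the failure half the lower bound on the norm holds for
  every realisation of the noise, so \<open>lam\<close> and the variances cancel. In the success
  half the noise adds at most \<open>2 * \<Sigma>\<close>, where \<open>\<Sigma>\<close> is
  \<open>n\<close> times the average variance; the growth condition on \<open>lam\<close> makes this
  a small fraction of the budget. Since the constant 2 is sharp, the column tails need the exponent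
  1/2 up to an arbitrarily small loss in both directions. The noise in the support coordinates is
  compared with a quantity tending to 0, so crude constants suffice there. Conditioning runs in the
  order support columns, noise, remaining columns, because \<open>r\<close> is a function of the
  first two.\<close>

lemma prob_space_std_gauss_vec: "prob_space (std_gauss_vec I)"
  unfolding std_gauss_vec_def by (intro prob_space_PiM prob_space_normal_density) simp

lemma space_std_gauss_vec: "space (std_gauss_vec I) = extensional I"
  by (auto simp: std_gauss_vec_def space_PiM PiE_def)

lemma sets_std_gauss_vec [measurable_cong]: "sets (std_gauss_vec I) = sets (PiM I (\<lambda>_. borel))"
  unfolding std_gauss_vec_def by (intro sets_PiM_cong) auto

lemma std_gauss_vec_component_measurable:
  "j \<in> J \<Longrightarrow> (\<lambda>x. x j) \<in> borel_measurable (std_gauss_vec J)"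
  by measurable

lemma std_gauss_vec_linear_measurable:
  "K \<subseteq> J \<Longrightarrow> (\<lambda>x. \<Sum>j\<in>K. a j * x j) \<in> borel_measurable (std_gauss_vec J)"
  by (intro borel_measurable_sum borel_measurable_times borel_measurable_const
      std_gauss_vec_component_measurable) auto

lemma indep_vars_std_gauss_vec:
  "prob_space.indep_vars (std_gauss_vec J) (\<lambda>_. borel) (\<lambda>j x. x j) J"
\<comment> \<open>The characterisation of independence by the joint law is stated for nonempty index
  sets.\<close>
proof (cases "J = {}")
  interpret prob_space "std_gauss_vec J" by (rule prob_space_std_gauss_vec)
  case True
  show ?thesis unfolding indep_vars_def indep_sets_def using True by simp
next
  case False
  interpret prob_space "std_gauss_vec J" by (rule prob_space_std_gauss_vec)
  let ?D = "density lborel std_normal_density"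
  have comp: "distr (std_gauss_vec J) borel (\<lambda>x. x j) = ?D" if "j \<in> J" for j
  proof -
    have "distr (std_gauss_vec J) borel (\<lambda>x. x j) = distr (std_gauss_vec J) ?D (\<lambda>x. x j)"
      by (rule distr_cong) auto
    also have "\<dots> = ?D" unfolding std_gauss_vec_def
      using distr_PiM_component[of J "\<lambda>_. ?D" j] that prob_space_normal_density[of 1 0] by simp
    finally show ?thesis .
  qed
  have "distr (std_gauss_vec J) (PiM J (\<lambda>_. borel)) (\<lambda>x. \<lambda>i\<in>J. x i)
      = distr (std_gauss_vec J) (std_gauss_vec J) (\<lambda>x. x)"
    by (rule distr_cong) (auto simp: sets_std_gauss_vec space_std_gauss_vec extensional_restrict)
  also have "\<dots> = std_gauss_vec J" by (rule distr_id)
  also have "\<dots> = PiM J (\<lambda>j. distr (std_gauss_vec J) borel (\<lambda>x. x j))"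
    unfolding std_gauss_vec_def[of J] using comp
    by (intro PiM_cong) (auto simp: std_gauss_vec_def)
  finally show ?thesis
    by (subst indep_vars_iff_distr_eq_PiM') (auto simp: False)
qed

text \<open>Grouping independent coordinates into disjoint blocks preserves independence. With index
  pairs, the blocks are rows of the design in the chi-square bounds and columns in
  \<open>prob_columns_le\<close>.\<close>

lemma indep_vars_linear_std_gauss_vec:
  assumes K: "\<And>i. i \<in> R \<Longrightarrow> K i \<subseteq> J" and dis: "disjoint_family_on K R"
  shows "prob_space.indep_vars (std_gauss_vec J) (\<lambda>_. borel) (\<lambda>i x. \<Sum>j\<in>K i. a i j * x j) R"
proof -
  interpret prob_space "std_gauss_vec J" by (rule prob_space_std_gauss_vec)
  have "indep_vars (\<lambda>j. PiM (K j) (\<lambda>_. borel)) (\<lambda>j x. restrict (\<lambda>i. x i) (K j)) R"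
    by (rule indep_vars_restrict[OF indep_vars_std_gauss_vec K dis])
  then have "indep_vars (\<lambda>_. borel)
      (\<lambda>i x. (\<lambda>y. \<Sum>j\<in>K i. a i j * y j) (restrict (\<lambda>j. x j) (K i))) R"
    by (rule indep_vars_compose2[where Y = "\<lambda>i y. \<Sum>j\<in>K i. a i j * y j"]) 
       (intro borel_measurable_sum borel_measurable_times borel_measurable_const measurable_component_singleton)
  then show ?thesis by simp
qed

lemma distributed_linear_std_gauss_vec:
  assumes K: "K \<subseteq> J" "finite K" and pos: "(\<Sum>j\<in>K. (a j)\<^sup>2) > 0"
  shows "distributed (std_gauss_vec J) lborel (\<lambda>x. \<Sum>j\<in>K. a j * x j)
           (normal_density 0 (sqrt (\<Sum>j\<in>K. (a j)\<^sup>2)))"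
proof -
  interpret prob_space "std_gauss_vec J" by (rule prob_space_std_gauss_vec)
  \<comment> \<open>Zero coefficients are dropped because a summand must have positive deviation to
    have a normal density.\<close>
  define K' where "K' = {j\<in>K. a j \<noteq> 0}"
  have K': "finite K'" "K' \<subseteq> J" using K by (auto simp: K'_def)
  have sq: "(\<Sum>j\<in>K. (a j)\<^sup>2) = (\<Sum>j\<in>K'. \<bar>a j\<bar>\<^sup>2)"
    unfolding K'_def using K by (intro sum.mono_neutral_cong_right) auto
  have ne: "K' \<noteq> {}" using pos unfolding sq by auto
  have lin: "(\<lambda>x. \<Sum>j\<in>K. a j * x j) = (\<lambda>x::'a \<Rightarrow> real. \<Sum>j\<in>K'. a j * x j)"
    unfolding K'_def using K by (intro ext sum.mono_neutral_cong_right) auto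
  have coord: "distributed (std_gauss_vec J) lborel (\<lambda>x. a j * x j) (normal_density 0 \<bar>a j\<bar>)"
    if "j \<in> K'" for j
  proof -
    have jJ: "j \<in> J" using that K' by auto
    let ?D = "density lborel std_normal_density"
    have "distr (std_gauss_vec J) lborel (\<lambda>x. x j) = distr (std_gauss_vec J) ?D (\<lambda>x. x j)"
      by (rule distr_cong) auto
    also have "\<dots> = ?D" unfolding std_gauss_vec_def
      using distr_PiM_component[of J "\<lambda>_. ?D" j] jJ prob_space_normal_density[of 1 0] by simp
    finally have "distributed (std_gauss_vec J) lborel (\<lambda>x. x j) std_normal_density"
      using jJ unfolding distributed_def by simp
    from normal_density_affine[OF this, of "a j" 0] that show ?thesis by (simp add: K'_def)
  qed
  have dis: "disjoint_family_on (\<lambda>j. {j}) K'" by (auto simp: disjoint_family_on_def)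
  have sub: "\<And>i. i \<in> K' \<Longrightarrow> {i} \<subseteq> J" using K' by auto
  have "indep_vars (\<lambda>_. borel) (\<lambda>i x. \<Sum>j\<in>{i}. a j * x j) K'"
    by (rule indep_vars_linear_std_gauss_vec[OF sub dis, where a = "\<lambda>_. a"])
  then have "indep_vars (\<lambda>_. borel) (\<lambda>j x. a j * x j) K'" by simp
  from sum_indep_normal[OF K'(1) ne this _ coord]
  show ?thesis unfolding sq lin by (simp add: K'_def)
qed

section \<open>Moment generating functions of squares and Gaussian tails\<close>

text \<open>The tilted density is again Gaussian: with \<open>c^2 = 1 - 2 * t * \<sigma>^2\<close>
  it equals \<open>1 / c\<close> times the density of deviation \<open>\<sigma> / c\<close>, whose
  integral is 1. Negative \<open>t\<close> is allowed and gives the lower chi-square tail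
  later.\<close>

lemma normal_square_mgf:
  fixes t \<sigma> :: real
  assumes \<sigma>: "\<sigma> > 0" and t: "2 * t * \<sigma>\<^sup>2 < 1"
  shows "(\<integral>\<^sup>+x. ennreal (normal_density 0 \<sigma> x) * ennreal (exp (t * x\<^sup>2)) \<partial>lborel)
           = ennreal (1 / sqrt (1 - 2 * t * \<sigma>\<^sup>2))"
proof -
  define c where "c = sqrt (1 - 2 * t * \<sigma>\<^sup>2)"
  have c: "c > 0" "c\<^sup>2 = 1 - 2 * t * \<sigma>\<^sup>2" using t by (auto simp: c_def)
  have eq: "normal_density 0 \<sigma> x * exp (t * x\<^sup>2) = (1 / c) * normal_density 0 (\<sigma> / c) x" for x
  proof -
    have "exp (- x\<^sup>2 / (2 * \<sigma>\<^sup>2)) * exp (t * x\<^sup>2) = exp (- x\<^sup>2 / (2 * (\<sigma> / c)\<^sup>2))"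
    proof -
      have "- x\<^sup>2 / (2 * (\<sigma> / c)\<^sup>2) = - x\<^sup>2 * c\<^sup>2 / (2 * \<sigma>\<^sup>2)"
        using c \<sigma> by (simp add: power_divide)
      also have "\<dots> = - x\<^sup>2 / (2 * \<sigma>\<^sup>2) + t * x\<^sup>2"
        unfolding c(2) using \<sigma> by (simp add: field_simps)
      finally show ?thesis by (simp add: exp_add[symmetric])
    qed
    moreover have "1 / sqrt (2 * pi * \<sigma>\<^sup>2) = (1 / c) * (1 / sqrt (2 * pi * (\<sigma> / c)\<^sup>2))"
      using \<sigma> c(1) by (simp add: power_divide real_sqrt_mult real_sqrt_divide)
    ultimately show ?thesis unfolding normal_density_def
      by (simp only: diff_zero mult.assoc)
  qed
  have "(\<integral>\<^sup>+x. ennreal (normal_density 0 \<sigma> x) * ennreal (exp (t * x\<^sup>2)) \<partial>lborel)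
     = (\<integral>\<^sup>+x. ennreal (1 / c) * ennreal (normal_density 0 (\<sigma> / c) x) \<partial>lborel)"
    using c by (intro nn_integral_cong) (auto simp: eq ennreal_mult[symmetric])
  also have "\<dots> = ennreal (1 / c) * (\<integral>\<^sup>+x. ennreal (normal_density 0 (\<sigma> / c) x) \<partial>lborel)"
    by (rule nn_integral_cmult) auto
  also have "(\<integral>\<^sup>+x. ennreal (normal_density 0 (\<sigma> / c) x) \<partial>lborel) = 1"
    using \<sigma> c by (subst nn_integral_eq_integral) auto
  finally show ?thesis by (simp add: c_def)
qed

lemma std_gauss_vec_square_mgf:
  assumes K: "K \<subseteq> J" "finite K" and t: "2 * t * (\<Sum>j\<in>K. (a j)\<^sup>2) < 1"
  shows "(\<integral>\<^sup>+x. ennreal (exp (t * (\<Sum>j\<in>K. a j * x j)\<^sup>2)) \<partial>std_gauss_vec J)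
           = ennreal (1 / sqrt (1 - 2 * t * (\<Sum>j\<in>K. (a j)\<^sup>2)))"
\<comment> \<open>The zero form has no density; there both sides are 1.\<close>
proof (cases "(\<Sum>j\<in>K. (a j)\<^sup>2) > 0")
  case True
  let ?\<sigma> = "sqrt (\<Sum>j\<in>K. (a j)\<^sup>2)"
  have "(\<integral>\<^sup>+x. ennreal (exp (t * (\<Sum>j\<in>K. a j * x j)\<^sup>2)) \<partial>std_gauss_vec J)
     = (\<integral>\<^sup>+x. ennreal (normal_density 0 ?\<sigma> x) * ennreal (exp (t * x\<^sup>2)) \<partial>lborel)"
    using distributed_nn_integral[OF distributed_linear_std_gauss_vec[OF K True],
        of "\<lambda>x. ennreal (exp (t * x\<^sup>2))"] by simp
  also have "\<dots> = ennreal (1 / sqrt (1 - 2 * t * ?\<sigma>\<^sup>2))"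
    using True t by (intro normal_square_mgf) auto
  also have "?\<sigma>\<^sup>2 = (\<Sum>j\<in>K. (a j)\<^sup>2)" using True by simp
  finally show ?thesis .
next
  case False
  interpret prob_space "std_gauss_vec J" by (rule prob_space_std_gauss_vec)
  from False have 0: "(\<Sum>j\<in>K. (a j)\<^sup>2) = 0" by (simp add: antisym sum_nonneg)
  then have "\<And>j. j \<in> K \<Longrightarrow> a j = 0" using K(2) by (simp add: sum_nonneg_eq_0_iff)
  then show ?thesis using 0 emeasure_space_1 by simp
qed

text \<open>Exponential Markov inequality: the indicator of the event is at most
  \<open>exp (f x - c)\<close>.\<close>

lemma (in prob_space) prob_ge_le_exp:
  fixes f :: "'a \<Rightarrow> real"
  assumes f [measurable]: "f \<in> borel_measurable M" and B: "0 \<le> B"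
    and mgf: "(\<integral>\<^sup>+x. ennreal (exp (f x)) \<partial>M) \<le> ennreal B"
  shows "prob {x \<in> space M. c \<le> f x} \<le> exp (- c) * B"
proof -
  let ?E = "{x \<in> space M. c \<le> f x}"
  have "emeasure M ?E = (\<integral>\<^sup>+x. indicator ?E x \<partial>M)"
    by (rule nn_integral_indicator[symmetric]) measurable
  also have "\<dots> \<le> (\<integral>\<^sup>+x. ennreal (exp (- c)) * ennreal (exp (f x)) \<partial>M)"
  proof (rule nn_integral_mono)
    fix x
    show "indicator ?E x \<le> ennreal (exp (- c)) * ennreal (exp (f x))"
    proof (cases "x \<in> ?E")
      case True
      then have "1 \<le> exp (- c) * exp (f x)" unfolding exp_add[symmetric] by simp
      then have "ennreal 1 \<le> ennreal (exp (- c) * exp (f x))" by (rule ennreal_leI)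
      then show ?thesis using True by (simp add: ennreal_mult)
    qed simp
  qed
  also have "\<dots> = ennreal (exp (- c)) * (\<integral>\<^sup>+x. ennreal (exp (f x)) \<partial>M)"
    by (rule nn_integral_cmult) measurable
  also have "\<dots> \<le> ennreal (exp (- c)) * ennreal B" by (rule mult_left_mono[OF mgf]) simp
  finally show ?thesis using B by (simp add: emeasure_eq_measure ennreal_mult[symmetric])
qed

text \<open>Markov is applied to the exponential of the square of the form, with
  \<open>t = \<theta> / (2 * V)\<close>. As \<open>\<theta>\<close> approaches 1 the exponent
  becomes the exact Gaussian one, at the price of the fixed factor
  \<open>1 / sqrt (1 - \<theta>)\<close>; this keeps the threshold constant sharp.\<close>

lemma prob_linear_ge_le:
  assumes K: "K \<subseteq> J" "finite K" and V: "V > 0" "(\<Sum>j\<in>K. (a j)\<^sup>2) \<le> V"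
    and \<theta>: "0 < \<theta>" "\<theta> < 1" and y: "y \<ge> 0"
  shows "measure (std_gauss_vec J) {x \<in> space (std_gauss_vec J). y \<le> \<bar>\<Sum>j\<in>K. a j * x j\<bar>}
           \<le> exp (- \<theta> * y\<^sup>2 / (2 * V)) / sqrt (1 - \<theta>)"
proof -
  interpret prob_space "std_gauss_vec J" by (rule prob_space_std_gauss_vec)
  define t where "t = \<theta> / (2 * V)"
  have t: "t > 0" using V \<theta> by (simp add: t_def)
  have tV: "2 * t * (\<Sum>j\<in>K. (a j)\<^sup>2) \<le> \<theta>"
    using mult_left_mono[OF V(2), of "2 * t"] t V by (simp add: t_def)
  define l where "l = (\<lambda>x. \<Sum>j\<in>K. a j * x j)"
  have meas [measurable]: "l \<in> borel_measurable (std_gauss_vec J)"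
    unfolding l_def by (rule std_gauss_vec_linear_measurable[OF K(1)])
  have "(\<integral>\<^sup>+x. ennreal (exp (t * (l x)\<^sup>2)) \<partial>std_gauss_vec J)
      = ennreal (1 / sqrt (1 - 2 * t * (\<Sum>j\<in>K. (a j)\<^sup>2)))"
    unfolding l_def using tV \<theta> by (intro std_gauss_vec_square_mgf K) auto
  also have "\<dots> \<le> ennreal (1 / sqrt (1 - \<theta>))"
    using tV \<theta> by (intro ennreal_leI divide_left_mono mult_pos_pos) auto
  finally have "prob {x \<in> space (std_gauss_vec J). t * y\<^sup>2 \<le> t * (l x)\<^sup>2}
      \<le> exp (- (t * y\<^sup>2)) * (1 / sqrt (1 - \<theta>))"
    using \<theta> by (intro prob_ge_le_exp) auto
  also have "{x \<in> space (std_gauss_vec J). t * y\<^sup>2 \<le> t * (l x)\<^sup>2}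
      = {x \<in> space (std_gauss_vec J). y \<le> \<bar>l x\<bar>}"
    using t y by (auto simp: abs_le_square_iff[symmetric])
  finally show ?thesis by (simp add: t_def l_def)
qed

text \<open>The mass just beyond \<open>y\<close> is bounded below by integrating the density over
  one interval whose length is one standard deviation. The only loss is the \<open>+ 1\<close>
  inside the square, of lower order than the square itself when \<open>y / sqrt V\<close> is
  large.\<close>

lemma prob_linear_le_le:
  assumes K: "K \<subseteq> J" "finite K" and V: "V > 0" "V \<le> (\<Sum>j\<in>K. (a j)\<^sup>2)" and y: "y \<ge> 0"
  shows "measure (std_gauss_vec J) {x \<in> space (std_gauss_vec J). \<bar>\<Sum>j\<in>K. a j * x j\<bar> \<le> y}
           \<le> 1 - exp (- (y / sqrt V + 1)\<^sup>2 / 2) / sqrt (2 * pi)"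
proof -
  interpret prob_space "std_gauss_vec J" by (rule prob_space_std_gauss_vec)
  define \<sigma> where "\<sigma> = sqrt (\<Sum>j\<in>K. (a j)\<^sup>2)"
  have \<sigma>: "\<sigma> > 0" "sqrt V \<le> \<sigma>" using V by (auto simp: \<sigma>_def)
  define l where "l = (\<lambda>x. \<Sum>j\<in>K. a j * x j)"
  have D: "distributed (std_gauss_vec J) lborel l (normal_density 0 \<sigma>)"
    unfolding \<sigma>_def l_def using K V by (intro distributed_linear_std_gauss_vec) auto
  have [measurable]: "l \<in> borel_measurable (std_gauss_vec J)"
    unfolding l_def by (rule std_gauss_vec_linear_measurable[OF K(1)])
  let ?E = "l -` {y<..y+\<sigma>} \<inter> space (std_gauss_vec J)"
  let ?q = "exp (- (y / \<sigma> + 1)\<^sup>2 / 2) / sqrt (2 * pi)"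
  have "ennreal ?q = (\<integral>\<^sup>+x. ennreal (?q / \<sigma>) * indicator {y<..y+\<sigma>} x \<partial>lborel)"
    using \<sigma> by (simp add: nn_integral_cmult_indicator ennreal_mult[symmetric])
  also have "\<dots> \<le> (\<integral>\<^sup>+x. ennreal (normal_density 0 \<sigma> x) * indicator {y<..y+\<sigma>} x \<partial>lborel)"
  proof (rule nn_integral_mono)
    fix x
    have "?q / \<sigma> \<le> normal_density 0 \<sigma> x" if x: "y < x" "x \<le> y + \<sigma>"
    proof -
      have "x / \<sigma> \<le> y / \<sigma> + 1" using x \<sigma> by (simp add: field_simps)
      then have "(x / \<sigma>)\<^sup>2 \<le> (y / \<sigma> + 1)\<^sup>2" using x y \<sigma> by (intro power_mono) auto
      then have "- (y / \<sigma> + 1)\<^sup>2 / 2 \<le> - x\<^sup>2 / (2 * \<sigma>\<^sup>2)" by (simp add: power_divide)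
      then have "exp (- (y / \<sigma> + 1)\<^sup>2 / 2) \<le> exp (- x\<^sup>2 / (2 * \<sigma>\<^sup>2))" by simp
      then have "exp (- (y / \<sigma> + 1)\<^sup>2 / 2) / (sqrt (2 * pi) * \<sigma>) \<le> exp (- x\<^sup>2 / (2 * \<sigma>\<^sup>2)) / (sqrt (2 * pi) * \<sigma>)"
        using \<sigma> by (intro divide_right_mono) auto
      then show ?thesis using \<sigma> by (simp add: normal_density_def real_sqrt_mult)
    qed
    then show "ennreal (?q / \<sigma>) * indicator {y<..y+\<sigma>} x
        \<le> ennreal (normal_density 0 \<sigma> x) * indicator {y<..y+\<sigma>} x"
      by (auto simp: indicator_def intro!: ennreal_leI)
  qed
  also have "\<dots> = emeasure (std_gauss_vec J) ?E"
    using distributed_emeasure[OF D, of "{y<..y+\<sigma>}"] by simp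
  finally have q: "?q \<le> prob ?E" by (simp add: emeasure_eq_measure)
  let ?F = "{x \<in> space (std_gauss_vec J). \<bar>l x\<bar> \<le> y}"
  have "prob ?F + prob ?E = prob (?F \<union> ?E)"
  proof (rule finite_measure_Union[symmetric])
    show "?F \<in> sets (std_gauss_vec J)" "?E \<in> sets (std_gauss_vec J)" by measurable
    show "?F \<inter> ?E = {}" by auto
  qed
  also have "\<dots> \<le> 1" by simp
  finally have "prob ?F \<le> 1 - ?q" using q by linarith
  also have "\<dots> \<le> 1 - exp (- (y / sqrt V + 1)\<^sup>2 / 2) / sqrt (2 * pi)"
  proof -
    have "y / \<sigma> \<le> y / sqrt V" using \<sigma> V y by (intro divide_left_mono) auto
    then have "(y / \<sigma> + 1)\<^sup>2 \<le> (y / sqrt V + 1)\<^sup>2" using y \<sigma> by (intro power_mono) auto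
    then show ?thesis by (intro diff_left_mono divide_right_mono) auto
  qed
  finally show ?thesis by (simp add: l_def)
qed

text \<open>The forms live on disjoint blocks, so the expectation of the product of exponentials
  factorises.\<close>

lemma sum_squares_mgf:
  assumes R: "finite R" and K: "\<And>i. i \<in> R \<Longrightarrow> K i \<subseteq> J" "\<And>i. i \<in> R \<Longrightarrow> finite (K i)"
    and dis: "disjoint_family_on K R"
    and A: "\<And>i. i \<in> R \<Longrightarrow> (\<Sum>j\<in>K i. (a i j)\<^sup>2) = A" and t: "2 * t * A < 1"
  shows "(\<integral>\<^sup>+x. ennreal (exp (t * (\<Sum>i\<in>R. (\<Sum>j\<in>K i. a i j * x j)\<^sup>2))) \<partial>std_gauss_vec J)
           = ennreal ((1 / sqrt (1 - 2 * t * A)) ^ card R)"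
proof -
  interpret prob_space "std_gauss_vec J" by (rule prob_space_std_gauss_vec)
  let ?l = "\<lambda>i x. \<Sum>j\<in>K i. a i j * x j"
  have ind: "indep_vars (\<lambda>_. borel) (\<lambda>i x. ennreal (exp (t * (?l i x)\<^sup>2))) R"
    by (rule indep_vars_compose2[OF indep_vars_linear_std_gauss_vec[OF K(1) dis],
          where Y = "\<lambda>_ y. ennreal (exp (t * y\<^sup>2))"]) auto
  have "(\<integral>\<^sup>+x. ennreal (exp (t * (\<Sum>i\<in>R. (?l i x)\<^sup>2))) \<partial>std_gauss_vec J)
      = (\<integral>\<^sup>+x. (\<Prod>i\<in>R. ennreal (exp (t * (?l i x)\<^sup>2))) \<partial>std_gauss_vec J)"
    by (intro nn_integral_cong) (simp add: sum_distrib_left exp_sum[OF R] prod_ennreal)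
  also have "\<dots> = (\<Prod>i\<in>R. \<integral>\<^sup>+x. ennreal (exp (t * (?l i x)\<^sup>2)) \<partial>std_gauss_vec J)"
    by (rule indep_vars_nn_integral[OF R ind]) simp
  also have "\<dots> = (\<Prod>i\<in>R. ennreal (1 / sqrt (1 - 2 * t * A)))"
  proof (rule prod.cong)
    fix i assume i: "i \<in> R"
    show "(\<integral>\<^sup>+x. ennreal (exp (t * (?l i x)\<^sup>2)) \<partial>std_gauss_vec J)
        = ennreal (1 / sqrt (1 - 2 * t * A))"
      using std_gauss_vec_square_mgf[OF K(1)[OF i] K(2)[OF i], of t "a i"] A[OF i] t by simp
  qed simp
  also have "\<dots> = ennreal ((1 / sqrt (1 - 2 * t * A)) ^ card R)"
    using t by (simp only: prod_constant) (subst ennreal_power, auto)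
  finally show ?thesis .
qed

lemma chi_square_tails:
  assumes R: "finite R" and K: "\<And>i. i \<in> R \<Longrightarrow> K i \<subseteq> J" "\<And>i. i \<in> R \<Longrightarrow> finite (K i)"
    and dis: "disjoint_family_on K R"
    and A: "\<And>i. i \<in> R \<Longrightarrow> (\<Sum>j\<in>K i. (a i j)\<^sup>2) = A" "A > 0" and \<eta>: "0 < \<eta>" "\<eta> \<le> 1"
  defines "q \<equiv> \<lambda>x. \<Sum>i\<in>R. (\<Sum>j\<in>K i. a i j * x j)\<^sup>2"
  shows "q \<in> borel_measurable (std_gauss_vec J)"
    and "measure (std_gauss_vec J) {x \<in> space (std_gauss_vec J). (1 + \<eta>) * A * real (card R) \<le> q x}
           \<le> exp (- \<eta>\<^sup>2 * real (card R) / 16)"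
    and "measure (std_gauss_vec J) {x \<in> space (std_gauss_vec J). q x \<le> (1 - \<eta>) * A * real (card R)}
           \<le> exp (- \<eta>\<^sup>2 * real (card R) / 16)"
proof -
  interpret prob_space "std_gauss_vec J" by (rule prob_space_std_gauss_vec)
  show q [measurable]: "q \<in> borel_measurable (std_gauss_vec J)"
    unfolding q_def
    by (intro borel_measurable_sum borel_measurable_power std_gauss_vec_linear_measurable K)
  \<comment> \<open>This makes \<open>2 * t * A = \<eta> / 4\<close>, small enough for a
    second-order bound on the logarithm. In both tails the first-order terms cancel, and
    \<open>- \<eta>^2 / 8 + \<eta>^2 / 16\<close> is the exponent left per summand.\<close>
  define t where "t = \<eta> / (8 * A)"
  have tA: "t * A = \<eta> / 8" "t > 0" using A \<eta> by (auto simp: t_def)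
  then have tA2: "1 - 2 * t * A = 1 - \<eta> / 4" and tA3: "1 - 2 * (- t) * A = 1 - (- (\<eta> / 4))"
    by (auto simp: mult.assoc)
  have bound: "1 / sqrt (1 - x) \<le> exp (x / 2 + x\<^sup>2)" if "- x - 2 * x\<^sup>2 \<le> ln (1 - x)" "x < 1" for x :: real
  proof -
    have "exp (- x - 2 * x\<^sup>2) \<le> 1 - x" using that by (simp add: ln_ge_iff)
    then have "sqrt (exp (- x - 2 * x\<^sup>2)) \<le> sqrt (1 - x)" by simp
    moreover have "sqrt (exp (- x - 2 * x\<^sup>2)) = exp (- (x / 2 + x\<^sup>2))"
      by (rule real_sqrt_unique) (simp_all add: power2_eq_square exp_add[symmetric])
    ultimately show ?thesis using that by (simp add: exp_minus field_simps)
  qed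
  have ex: "(1 / sqrt (1 - x)) ^ card R \<le> exp (real (card R) * (x / 2 + x\<^sup>2))"
    if "- x - 2 * x\<^sup>2 \<le> ln (1 - x)" "x < 1" for x :: real
    using power_mono[OF bound[OF that], of "card R"] that by (simp add: exp_of_nat_mult)
  show "measure (std_gauss_vec J) {x \<in> space (std_gauss_vec J). (1 + \<eta>) * A * real (card R) \<le> q x}
           \<le> exp (- \<eta>\<^sup>2 * real (card R) / 16)"
  proof -
    have "(\<integral>\<^sup>+x. ennreal (exp (t * q x)) \<partial>std_gauss_vec J)
        = ennreal ((1 / sqrt (1 - 2 * t * A)) ^ card R)"
      unfolding q_def using tA \<eta> by (intro sum_squares_mgf R K dis A) auto
    also have "\<dots> \<le> ennreal (exp (real (card R) * ((\<eta> / 4) / 2 + (\<eta> / 4)\<^sup>2)))"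
      unfolding tA2 using ex[of "\<eta> / 4"] \<eta> ln_one_minus_pos_lower_bound[of "\<eta> / 4"]
      by (intro ennreal_leI) simp
    finally have "prob {x \<in> space (std_gauss_vec J). t * ((1 + \<eta>) * A * real (card R)) \<le> t * q x}
        \<le> exp (- (t * ((1 + \<eta>) * A * real (card R)))) * exp (real (card R) * ((\<eta> / 4) / 2 + (\<eta> / 4)\<^sup>2))"
      by (intro prob_ge_le_exp) auto
    also have "exp (- (t * ((1 + \<eta>) * A * real (card R)))) * exp (real (card R) * ((\<eta> / 4) / 2 + (\<eta> / 4)\<^sup>2))
        = exp (- \<eta>\<^sup>2 * real (card R) / 16)"
    proof -
      have "t * ((1 + \<eta>) * A * real (card R)) = (\<eta> / 8) * (1 + \<eta>) * real (card R)"
        unfolding tA(1)[symmetric] by simp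
      then show ?thesis unfolding exp_add[symmetric] by (simp add: field_simps power2_eq_square)
    qed
    finally show ?thesis using tA(2) by (simp add: mult.assoc)
  qed
  show "measure (std_gauss_vec J) {x \<in> space (std_gauss_vec J). q x \<le> (1 - \<eta>) * A * real (card R)}
           \<le> exp (- \<eta>\<^sup>2 * real (card R) / 16)"
  proof -
    have "(\<integral>\<^sup>+x. ennreal (exp ((- t) * q x)) \<partial>std_gauss_vec J)
        = ennreal ((1 / sqrt (1 - 2 * (- t) * A)) ^ card R)"
      unfolding q_def using tA \<eta> by (intro sum_squares_mgf R K dis A) auto
    also have "\<dots> \<le> ennreal (exp (real (card R) * ((- (\<eta> / 4)) / 2 + (- (\<eta> / 4))\<^sup>2)))"
    proof -
      have "\<eta> / 4 - (\<eta> / 4)\<^sup>2 \<le> ln (1 + \<eta> / 4)"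
        using \<eta> by (intro ln_one_plus_pos_lower_bound) auto
      moreover have "0 \<le> (\<eta> / 4)\<^sup>2" by simp
      ultimately have "\<eta> / 4 - 2 * (\<eta> / 4)\<^sup>2 \<le> ln (1 + \<eta> / 4)" by linarith
      then show ?thesis
        unfolding tA3 using ex[of "- (\<eta> / 4)"] \<eta> by (intro ennreal_leI) simp
    qed
    finally have "prob {x \<in> space (std_gauss_vec J). - (t * ((1 - \<eta>) * A * real (card R))) \<le> (- t) * q x}
        \<le> exp (- (- (t * ((1 - \<eta>) * A * real (card R))))) * exp (real (card R) * ((- (\<eta> / 4)) / 2 + (- (\<eta> / 4))\<^sup>2))"
      by (intro prob_ge_le_exp) auto
    also have "exp (- (- (t * ((1 - \<eta>) * A * real (card R))))) * exp (real (card R) * ((- (\<eta> / 4)) / 2 + (- (\<eta> / 4))\<^sup>2))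
        = exp (- \<eta>\<^sup>2 * real (card R) / 16)"
    proof -
      have "t * ((1 - \<eta>) * A * real (card R)) = (\<eta> / 8) * (1 - \<eta>) * real (card R)"
        unfolding tA(1)[symmetric] by simp
      then show ?thesis unfolding exp_add[symmetric] by (simp add: field_simps power2_eq_square)
    qed
    finally show ?thesis using tA(2) by (simp add: mult.assoc)
  qed
qed

subsection \<open>Optimality conditions of the Lasso\<close>

text \<open>Block elimination by induction on the index set. The induction hypothesis is used for
  two right-hand sides, \<open>h\<close> and the column of the new index \<open>a\<close>; combining
  the two solutions leaves one scalar equation whose coefficient is the Schur complement
  \<open>d\<close>.\<close>

lemma positive_definite_solvable:
  fixes Q :: "'a \<Rightarrow> 'a \<Rightarrow> real"
  assumes "finite S"
    and "\<And>w. \<exists>j\<in>S. w j \<noteq> 0 \<Longrightarrow> (\<Sum>i\<in>S. \<Sum>j\<in>S. w i * Q i j * w j) > 0"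
  shows "\<exists>v. \<forall>i\<in>S. (\<Sum>j\<in>S. Q i j * v j) = h i"
  using assms
proof (induction S arbitrary: h rule: finite_induct)
  case empty
  then show ?case by simp
next
  case (insert a S)
  have pos: "(\<Sum>i\<in>S. \<Sum>j\<in>S. w i * Q i j * w j) > 0" if "\<exists>j\<in>S. w j \<noteq> 0" for w
  proof -
    \<comment> \<open>Extending by 0 at \<open>a\<close> transfers positivity from
      \<open>insert a S\<close> to \<open>S\<close>.\<close>
    let ?w = "w(a := 0)"
    have eq: "?w j = w j" if "j \<in> S" for j using that insert.hyps by auto
    have "(\<Sum>i\<in>insert a S. \<Sum>j\<in>insert a S. ?w i * Q i j * ?w j) > 0"
      using that eq by (intro insert.prems) auto
    then show ?thesis using insert.hyps eq by (simp cong: sum.cong)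
  qed
  obtain y where y: "\<And>i. i \<in> S \<Longrightarrow> (\<Sum>j\<in>S. Q i j * y j) = h i"
    using insert.IH[OF pos, of h] by blast
  obtain z where z: "\<And>i. i \<in> S \<Longrightarrow> (\<Sum>j\<in>S. Q i j * z j) = Q i a"
    using insert.IH[OF pos, of "\<lambda>i. Q i a"] by blast
  define d where "d = Q a a - (\<Sum>j\<in>S. Q a j * z j)"
  have d: "d > 0"
  proof -
    \<comment> \<open>The quadratic form at this vector is exactly \<open>d\<close>: the rows in
      \<open>S\<close> contribute 0 by the choice of \<open>z\<close>.\<close>
    let ?w = "\<lambda>j. if j = a then 1 else - z j"
    have eq: "?w j = - z j" if "j \<in> S" for j using that insert.hyps by auto
    have "0 < (\<Sum>i\<in>insert a S. \<Sum>j\<in>insert a S. ?w i * Q i j * ?w j)"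
      by (intro insert.prems) auto
    also have "\<dots> = (Q a a + (\<Sum>j\<in>S. Q a j * (- z j)))
        + (\<Sum>i\<in>S. (- z i) * Q i a + (\<Sum>j\<in>S. (- z i) * Q i j * (- z j)))"
      using insert.hyps eq by (simp cong: sum.cong)
    also have "(\<Sum>i\<in>S. (- z i) * Q i a + (\<Sum>j\<in>S. (- z i) * Q i j * (- z j)))
        = (\<Sum>i\<in>S. z i * ((\<Sum>j\<in>S. Q i j * z j) - Q i a))"
      by (intro sum.cong) (auto simp: sum_distrib_left algebra_simps)
    also have "\<dots> = 0" using z by simp
    finally show ?thesis by (simp add: d_def sum_negf)
  qed
  define t where "t = (h a - (\<Sum>j\<in>S. Q a j * y j)) / d"
  let ?v = "\<lambda>j. if j = a then t else y j - t * z j"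
  have eq: "?v j = y j - t * z j" if "j \<in> S" for j using that insert.hyps by auto
  have row: "(\<Sum>j\<in>insert a S. Q i j * ?v j)
      = Q i a * t + ((\<Sum>j\<in>S. Q i j * y j) - t * (\<Sum>j\<in>S. Q i j * z j))" for i
  proof -
    have "(\<Sum>j\<in>S. Q i j * ?v j) = (\<Sum>j\<in>S. Q i j * (y j - t * z j))"
      using eq by (intro sum.cong) auto
    also have "\<dots> = (\<Sum>j\<in>S. Q i j * y j) - t * (\<Sum>j\<in>S. Q i j * z j)"
      by (simp add: sum_subtractf sum_distrib_left algebra_simps)
    finally show ?thesis using insert.hyps by simp
  qed
  have "\<forall>i\<in>insert a S. (\<Sum>j\<in>insert a S. Q i j * ?v j) = h i"
  proof
    fix i assume "i \<in> insert a S"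
    then consider "i = a" | "i \<in> S" by auto
    then show "(\<Sum>j\<in>insert a S. Q i j * ?v j) = h i"
    proof cases
      case 1
      have "(\<Sum>j\<in>insert a S. Q a j * ?v j) = t * d + (\<Sum>j\<in>S. Q a j * y j)"
        unfolding row d_def by (simp add: algebra_simps)
      also have "\<dots> = h a" using d by (simp add: t_def)
      finally show ?thesis using 1 by simp
    next
      case 2
      then show ?thesis unfolding row y[OF 2] z[OF 2] by simp
    qed
  qed
  then show ?case by (rule exI[of _ ?v])
qed

text \<open>The polynomial has a local minimum at 0, and \<open>a\<close> is its derivative
  there.\<close>

lemma linear_coeff_eq_0:
  fixes a q d :: real
  assumes "d > 0" and "\<And>t. \<bar>t\<bar> < d \<Longrightarrow> 0 \<le> t * a + t\<^sup>2 * q"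
  shows "a = 0"
proof -
  have "((\<lambda>t. t * a + t\<^sup>2 * q) has_real_derivative a) (at 0)"
    by (auto intro!: derivative_eq_intros)
  from DERIV_local_min[OF this assms(1)] assms(2) show ?thesis by simp
qed

text \<open>The subgradient conditions of the Lasso multiplied by \<open>n\<close>, with the signs
  of \<open>\<beta>s\<close> in place of those of the candidate. The two agree when signs are
  recovered, and in this form the candidate enters only through its residual
  \<open>r\<close>.\<close>

definition kkt ::
  "nat \<Rightarrow> nat \<Rightarrow> (nat \<times> nat \<Rightarrow> real) \<Rightarrow> (nat \<Rightarrow> real) \<Rightarrow> (nat \<Rightarrow> real) \<Rightarrow> real \<Rightarrow> bool" where
  "kkt n p X \<beta>s r lam \<longleftrightarrow>
     (\<forall>j<p. if \<beta>s j = 0 then \<bar>\<Sum>i<n. X (i, j) * r i\<bar> \<le> real n * lam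
            else (\<Sum>i<n. X (i, j) * r i) = real n * lam * sgn (\<beta>s j))"

text \<open>The objective has an exact second-order expansion. The conditions make every coordinate
  term of it nonnegative by the subgradient inequality for the absolute value; conversely,
  perturbing a single coordinate of a minimiser yields each condition.\<close>

lemma recovery_iff_kkt:
  fixes lam :: real
  assumes n: "n > 0" and lam: "lam > 0"
  shows "recovery n p X \<beta>s Z lam \<longleftrightarrow>
    (\<exists>\<beta>. is_vec p \<beta> \<and> (\<forall>j<p. sgn (\<beta> j) = sgn (\<beta>s j)) \<and>
       kkt n p X \<beta>s (\<lambda>i. (\<Sum>j<p. X (i, j) * (\<beta>s j - \<beta> j)) + Z i) lam)"
proof -
  define Y where "Y = (\<lambda>i. (\<Sum>j<p. X (i, j) * \<beta>s j) + Z i)"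
  define r where "r = (\<lambda>\<beta> i. (\<Sum>j<p. X (i, j) * (\<beta>s j - \<beta> j)) + Z i)"
  define c where "c = (\<lambda>\<beta> j. \<Sum>i<n. X (i, j) * r \<beta> i)"
  have resid: "Y i - (\<Sum>j<p. X (i, j) * \<beta> j) = r \<beta> i" for \<beta> i
    by (simp add: Y_def r_def sum_subtractf algebra_simps)
  have obj: "lasso_obj n p X Y lam \<beta>
      = (1 / (2 * real n)) * (\<Sum>i<n. (r \<beta> i)\<^sup>2) + lam * (\<Sum>j<p. \<bar>\<beta> j\<bar>)" for \<beta>
    unfolding lasso_obj_def resid ..
  have expand: "2 * real n * (lasso_obj n p X Y lam (\<lambda>j. \<beta> j + h j) - lasso_obj n p X Y lam \<beta>)
      = (\<Sum>i<n. (\<Sum>j<p. X (i, j) * h j)\<^sup>2)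
        + 2 * (\<Sum>j<p. real n * lam * (\<bar>\<beta> j + h j\<bar> - \<bar>\<beta> j\<bar>) - c \<beta> j * h j)" for \<beta> h
  proof -
    let ?X = "\<lambda>i. \<Sum>j<p. X (i, j) * h j"
    have rr: "r (\<lambda>j. \<beta> j + h j) i = r \<beta> i - ?X i" for i
      by (simp add: r_def sum_subtractf sum.distrib algebra_simps)
    have "(\<Sum>i<n. r \<beta> i * ?X i) = (\<Sum>j<p. c \<beta> j * h j)"
      unfolding c_def sum_distrib_left sum_distrib_right
      by (subst sum.swap) (simp add: algebra_simps)
    then have "(\<Sum>i<n. (r (\<lambda>j. \<beta> j + h j) i)\<^sup>2)
        = (\<Sum>i<n. (r \<beta> i)\<^sup>2) - 2 * (\<Sum>j<p. c \<beta> j * h j) + (\<Sum>i<n. (?X i)\<^sup>2)"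
      unfolding rr by (simp add: power2_diff sum.distrib sum_subtractf sum_distrib_left[symmetric] mult.assoc)
    moreover have "2 * real n * (lasso_obj n p X Y lam (\<lambda>j. \<beta> j + h j) - lasso_obj n p X Y lam \<beta>)
        = (\<Sum>i<n. (r (\<lambda>j. \<beta> j + h j) i)\<^sup>2) - (\<Sum>i<n. (r \<beta> i)\<^sup>2)
          + 2 * (real n * lam * ((\<Sum>j<p. \<bar>\<beta> j + h j\<bar>) - (\<Sum>j<p. \<bar>\<beta> j\<bar>)))"
      unfolding obj using n by (simp add: field_simps)
    moreover have "(\<Sum>j<p. real n * lam * (\<bar>\<beta> j + h j\<bar> - \<bar>\<beta> j\<bar>) - c \<beta> j * h j)
        = real n * lam * ((\<Sum>j<p. \<bar>\<beta> j + h j\<bar>) - (\<Sum>j<p. \<bar>\<beta> j\<bar>)) - (\<Sum>j<p. c \<beta> j * h j)"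
      by (simp add: sum_subtractf sum_distrib_left[symmetric])
    ultimately show ?thesis by simp
  qed
  have opt: "\<beta> \<in> lasso_set n p X Y lam \<longleftrightarrow> kkt n p X \<beta>s (r \<beta>) lam"
    if vec: "is_vec p \<beta>" and sg: "\<forall>j<p. sgn (\<beta> j) = sgn (\<beta>s j)" for \<beta>
  proof
    assume K: "kkt n p X \<beta>s (r \<beta>) lam"
    have "lasso_obj n p X Y lam \<beta> \<le> lasso_obj n p X Y lam \<beta>'" for \<beta>'
    proof -
      define h where "h = (\<lambda>j. \<beta>' j - \<beta> j)"
      have "0 \<le> real n * lam * (\<bar>\<beta> j + h j\<bar> - \<bar>\<beta> j\<bar>) - c \<beta> j * h j" if j: "j < p" for j
      proof (cases "\<beta>s j = 0")
        case True
        then have b: "\<beta> j = 0" using sg j by (metis sgn_0_0)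
        have "\<bar>c \<beta> j\<bar> \<le> real n * lam" using K j True by (auto simp: kkt_def c_def)
        then have "\<bar>c \<beta> j\<bar> * \<bar>h j\<bar> \<le> real n * lam * \<bar>h j\<bar>" by (rule mult_right_mono) simp
        then have "c \<beta> j * h j \<le> real n * lam * \<bar>h j\<bar>"
          by (metis abs_ge_self abs_mult order_trans)
        then show ?thesis using b by simp
      next
        case False
        then have "c \<beta> j = real n * lam * sgn (\<beta> j)" using K j sg by (auto simp: kkt_def c_def)
        moreover have "sgn (\<beta> j) * h j \<le> \<bar>\<beta> j + h j\<bar> - \<bar>\<beta> j\<bar>"
          by (auto simp: sgn_if abs_if)
        then have "real n * lam * (sgn (\<beta> j) * h j) \<le> real n * lam * (\<bar>\<beta> j + h j\<bar> - \<bar>\<beta> j\<bar>)"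
          using n lam by (intro mult_left_mono) auto
        ultimately show ?thesis by (simp add: mult.assoc)
      qed
      then have "0 \<le> (\<Sum>i<n. (\<Sum>j<p. X (i, j) * h j)\<^sup>2)
          + 2 * (\<Sum>j<p. real n * lam * (\<bar>\<beta> j + h j\<bar> - \<bar>\<beta> j\<bar>) - c \<beta> j * h j)"
        by (intro add_nonneg_nonneg mult_nonneg_nonneg sum_nonneg) auto
      then have "0 \<le> 2 * real n * (lasso_obj n p X Y lam \<beta>' - lasso_obj n p X Y lam \<beta>)"
        unfolding expand[symmetric] by (simp add: h_def)
      then show ?thesis using n by (simp add: zero_le_mult_iff)
    qed
    then show "\<beta> \<in> lasso_set n p X Y lam" using vec by (auto simp: lasso_set_def)
  next
    assume L: "\<beta> \<in> lasso_set n p X Y lam"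
    have step: "0 \<le> t\<^sup>2 * (\<Sum>i<n. (X (i, j))\<^sup>2)
        + 2 * (real n * lam * (\<bar>\<beta> j + t\<bar> - \<bar>\<beta> j\<bar>) - c \<beta> j * t)" if j: "j < p" for j t
    proof -
      let ?h = "\<lambda>k. if k = j then t else 0"
      have "is_vec p (\<lambda>k. \<beta> k + ?h k)" using vec j by (auto simp: is_vec_def)
      then have "0 \<le> 2 * real n * (lasso_obj n p X Y lam (\<lambda>k. \<beta> k + ?h k) - lasso_obj n p X Y lam \<beta>)"
        using L n by (auto simp: lasso_set_def zero_le_mult_iff)
      also have "\<dots> = (\<Sum>i<n. (X (i, j) * t)\<^sup>2)
          + 2 * (real n * lam * (\<bar>\<beta> j + t\<bar> - \<bar>\<beta> j\<bar>) - c \<beta> j * t)"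
      proof -
        have "(\<Sum>k<p. X (i, k) * ?h k) = X (i, j) * t" for i
          using j by (simp add: if_distrib cong: if_cong)
        moreover have "(\<Sum>k<p. real n * lam * (\<bar>\<beta> k + ?h k\<bar> - \<bar>\<beta> k\<bar>) - c \<beta> k * ?h k)
            = (\<Sum>k<p. if k = j then real n * lam * (\<bar>\<beta> j + t\<bar> - \<bar>\<beta> j\<bar>) - c \<beta> j * t else 0)"
          by (intro sum.cong) auto
        ultimately show ?thesis unfolding expand using j by simp
      qed
      also have "(\<Sum>i<n. (X (i, j) * t)\<^sup>2) = t\<^sup>2 * (\<Sum>i<n. (X (i, j))\<^sup>2)"
        by (simp add: power_mult_distrib sum_distrib_left mult.commute)
      finally show ?thesis .
    qed
    show "kkt n p X \<beta>s (r \<beta>) lam" unfolding kkt_def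
    proof (intro allI impI)
      fix j assume j: "j < p"
      define q where "q = (\<Sum>i<n. (X (i, j))\<^sup>2)"
      have q: "q \<ge> 0" by (simp add: q_def sum_nonneg)
      show "if \<beta>s j = 0 then \<bar>\<Sum>i<n. X (i, j) * r \<beta> i\<bar> \<le> real n * lam
            else (\<Sum>i<n. X (i, j) * r \<beta> i) = real n * lam * sgn (\<beta>s j)"
      proof (cases "\<beta>s j = 0")
        case True
        then have b: "\<beta> j = 0" using sg j by (metis sgn_0_0)
        have "\<bar>c \<beta> j\<bar> \<le> real n * lam"
        proof (rule ccontr)
          assume "\<not> ?thesis"
          moreover define e where "e = \<bar>c \<beta> j\<bar> - real n * lam"
          ultimately have e: "e > 0" by simp
          have "real n * lam > 0" using n lam by simp
          then have nz: "c \<beta> j \<noteq> 0" using e by (auto simp: e_def)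
          \<comment> \<open>Step length against a violation of size \<open>e\<close>: moving in the
            direction of the sign of \<open>c \<beta> j\<close> gains \<open>2 * t * e\<close> and
            costs \<open>t^2 * q\<close>, which is below \<open>t * e\<close> because
            \<open>t * q < e\<close>.\<close>
          define t where "t = e / (q + 1)"
          have t: "t > 0" "t * q < e"
            using e q by (auto simp: t_def field_simps)
          have "0 \<le> (sgn (c \<beta> j) * t)\<^sup>2 * q
              + 2 * (real n * lam * \<bar>sgn (c \<beta> j) * t\<bar> - c \<beta> j * (sgn (c \<beta> j) * t))"
            using step[OF j, of "sgn (c \<beta> j) * t"] b by (simp add: q_def)
          also have "\<dots> = t\<^sup>2 * q - 2 * (t * e)"
          proof -
            have "\<bar>sgn (c \<beta> j) * t\<bar> = t" "(sgn (c \<beta> j) * t)\<^sup>2 = t\<^sup>2"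
              "c \<beta> j * (sgn (c \<beta> j) * t) = \<bar>c \<beta> j\<bar> * t"
              using nz t by (auto simp: sgn_if abs_if)
            then show ?thesis by (simp only:) (simp add: algebra_simps e_def)
          qed
          also have "\<dots> = t * (t * q - 2 * e)" by (simp add: power2_eq_square algebra_simps)
          finally have "t * q - 2 * e \<ge> 0" using t by (simp add: zero_le_mult_iff)
          then show False using t e by linarith
        qed
        then show ?thesis using True by (simp add: c_def)
      next
        case False
        then have b: "\<beta> j \<noteq> 0" using sg j by (metis sgn_0_0)
        have "2 * (real n * lam * sgn (\<beta> j) - c \<beta> j) = 0"
        \<comment> \<open>Closer to \<open>\<beta> j\<close> than
          \<open>\<bar>\<beta> j\<bar>\<close> no sign change occurs, so the absolute value is
          affine and the increment is a pure quadratic in \<open>t\<close>.\<close>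
        proof (rule linear_coeff_eq_0[where d = "\<bar>\<beta> j\<bar>" and q = q])
          fix t assume "\<bar>t\<bar> < \<bar>\<beta> j\<bar>"
          then have *: "\<bar>\<beta> j + t\<bar> - \<bar>\<beta> j\<bar> = sgn (\<beta> j) * t" by (auto simp: sgn_if abs_if)
          show "0 \<le> t * (2 * (real n * lam * sgn (\<beta> j) - c \<beta> j)) + t\<^sup>2 * q"
            using step[OF j, of t] unfolding * q_def by (simp add: algebra_simps)
        qed (use b in simp)
        then show ?thesis using False sg j by (simp add: c_def)
      qed
    qed
  qed
  show ?thesis unfolding recovery_def
    using opt by (auto simp: Y_def r_def lasso_set_def)
qed

subsection \<open>Measurability and sections\<close>

text \<open>A nonnegative continuous function on a compact set has a zero exactly when its infimum
  is 0, and the infimum may be taken over a countable dense subset. This replaces the uncountable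
  existential by countable set operations.\<close>

lemma sets_ex_zero_compact:
  fixes K :: "'b :: {metric_space, second_countable_topology} set"
  assumes K: "compact K"
    and cont: "\<And>w. w \<in> space M \<Longrightarrow> continuous_on K (F w)"
    and meas: "\<And>b. b \<in> K \<Longrightarrow> (\<lambda>w. F w b) \<in> borel_measurable M"
    and nonneg: "\<And>w b. 0 \<le> F w b"
  shows "{w \<in> space M. \<exists>b\<in>K. F w b = (0::real)} \<in> sets M"
proof -
  obtain D where D: "countable D" "D \<subseteq> K" "K \<subseteq> closure D" by (rule separable)
  have "{w \<in> space M. \<exists>b\<in>K. F w b = 0}
      = (\<Inter>k::nat. \<Union>b\<in>D. {w \<in> space M. F w b < 1 / real (Suc k)})" (is "?L = ?R")
  proof (intro equalityI subsetI)
    fix w assume "w \<in> ?L"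
    then obtain b where w: "w \<in> space M" and b: "b \<in> K" "F w b = 0" by auto
    have "\<exists>b'\<in>D. F w b' < 1 / real (Suc k)" for k
    proof -
      from cont[OF w] b obtain d where d: "d > 0"
        "\<And>b'. b' \<in> K \<Longrightarrow> dist b' b < d \<Longrightarrow> dist (F w b') (F w b) < 1 / real (Suc k)"
        unfolding continuous_on_iff by (metis of_nat_0_less_iff zero_less_Suc zero_less_divide_1_iff)
      from b D(3) have "b \<in> closure D" by auto
      with d(1) obtain b' where b': "b' \<in> D" "dist b' b < d" unfolding closure_approachable by blast
      then show ?thesis using d(2)[of b'] D(2) b by (auto intro!: bexI[of _ b'])
    qed
    then show "w \<in> ?R" using w by auto
  next
    fix w assume R: "w \<in> ?R"
    then have w: "w \<in> space M" by auto
    have small: "\<exists>b\<in>K. F w b < 1 / real (Suc k)" for k using R D(2) by blast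
    then have ne: "K \<noteq> {}" by auto
    obtain b where b: "b \<in> K" "\<And>b'. b' \<in> K \<Longrightarrow> F w b \<le> F w b'"
      using continuous_attains_inf[OF K ne cont[OF w]] by auto
    have "F w b = 0"
    proof (rule ccontr)
      assume "F w b \<noteq> 0"
      then have "F w b > 0" using nonneg[of w b] by linarith
      then obtain k where k: "1 / real (Suc k) < F w b"
        using reals_Archimedean[of "F w b"] by (auto simp: inverse_eq_divide)
      from small[of k] obtain b' where "b' \<in> K" "F w b' < 1 / real (Suc k)" by auto
      with b(2)[of b'] k show False by linarith
    qed
    then show "w \<in> ?L" using w b by auto
  qed
  also have "\<dots> \<in> sets M"
  proof -
    have "{w \<in> space M. F w b < 1 / real (Suc k)} \<in> sets M" if "b \<in> D" for k b
    proof -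
      have [measurable]: "(\<lambda>w. F w b) \<in> borel_measurable M" using D(2) meas that by auto
      show ?thesis by measurable
    qed
    then have "(\<Union>b\<in>D. {w \<in> space M. F w b < 1 / real (Suc k)}) \<in> sets M" for k
      using D(1) by (intro sets.countable_UN') auto
    then show ?thesis by (intro sets.countable_INT) auto
  qed
  finally show ?thesis .
qed

text \<open>Tychonoff in the product topology on functions. In the application the coordinates from
  \<open>p\<close> on have \<open>l = u = 0\<close>, so vectors of varying length need no type of
  their own.\<close>

lemma compact_box_fun:
  fixes l u :: "'a \<Rightarrow> real"
  shows "compact {b. \<forall>j. l j \<le> b j \<and> b j \<le> u j}"
proof -
  have eq: "{b. \<forall>j. l j \<le> b j \<and> b j \<le> u j} = PiE UNIV (\<lambda>j. {l j..u j})"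
    by (auto simp: PiE_UNIV_domain)
  have "compactin (product_topology (\<lambda>_. euclidean) UNIV) (PiE UNIV (\<lambda>j. {l j..u j}))"
    unfolding compactin_PiE by auto
  then show ?thesis unfolding eq euclidean_product_topology by simp
qed

section \<open>Conditioning in product measures\<close>

text \<open>Integrate the section probabilities over the good set \<open>G\<close> only.\<close>

lemma measure_pair_ge:
  assumes M: "prob_space M" and N: "prob_space N"
    and A: "A \<in> sets (M \<Otimes>\<^sub>M N)" and G: "G \<in> sets M" and c: "0 \<le> c"
    and sec: "\<And>x. x \<in> G \<Longrightarrow> c \<le> measure N (Pair x -` A)"
  shows "c * measure M G \<le> measure (M \<Otimes>\<^sub>M N) A"
proof -
  interpret M: prob_space M by (rule M)
  interpret N: prob_space N by (rule N)
  interpret P: pair_prob_space M N ..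
  have "ennreal (c * measure M G) = (\<integral>\<^sup>+x. ennreal c * indicator G x \<partial>M)"
    using G c by (simp add: nn_integral_cmult_indicator M.emeasure_eq_measure ennreal_mult)
  also have "\<dots> \<le> (\<integral>\<^sup>+x. emeasure N (Pair x -` A) \<partial>M)"
    using sec by (intro nn_integral_mono) (auto simp: indicator_def N.emeasure_eq_measure intro!: ennreal_leI)
  also have "\<dots> = emeasure (M \<Otimes>\<^sub>M N) A" by (rule N.emeasure_pair_measure_alt[OF A, symmetric])
  finally show ?thesis by (simp add: P.emeasure_eq_measure)
qed

text \<open>Sections over \<open>G\<close> contribute at most \<open>c\<close>; outside
  \<open>G\<close> each section is bounded by 1.\<close>

lemma measure_pair_le:
  assumes M: "prob_space M" and N: "prob_space N"
    and A: "A \<in> sets (M \<Otimes>\<^sub>M N)" and G: "G \<in> sets M" and c: "0 \<le> c"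
    and sec: "\<And>x. x \<in> G \<Longrightarrow> measure N (Pair x -` A) \<le> c"
  shows "measure (M \<Otimes>\<^sub>M N) A \<le> c + measure M (space M - G)"
proof -
  interpret M: prob_space M by (rule M)
  interpret N: prob_space N by (rule N)
  interpret P: pair_prob_space M N ..
  have "emeasure (M \<Otimes>\<^sub>M N) A = (\<integral>\<^sup>+x. emeasure N (Pair x -` A) \<partial>M)"
    by (rule N.emeasure_pair_measure_alt[OF A])
  also have "\<dots> \<le> (\<integral>\<^sup>+x. ennreal c + indicator (space M - G) x \<partial>M)"
  proof (rule nn_integral_mono)
    fix x assume x: "x \<in> space M"
    show "emeasure N (Pair x -` A) \<le> ennreal c + indicator (space M - G) x"
    proof (cases "x \<in> G")
      case True
      then show ?thesis using sec[OF True] by (auto simp: N.emeasure_eq_measure intro!: ennreal_leI)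
    next
      case False
      have "emeasure N (Pair x -` A) \<le> 1" by (rule N.emeasure_le_1)
      then show ?thesis using False x by (simp add: add_increasing)
    qed
  qed
  also have "\<dots> = ennreal c + emeasure M (space M - G)"
    using G by (subst nn_integral_add) (auto simp: M.emeasure_space_1)
  also have "\<dots> = ennreal (c + measure M (space M - G))"
    using c by (simp add: M.emeasure_eq_measure)
  finally show ?thesis using c by (simp add: P.emeasure_eq_measure del: ennreal_plus)
qed

text \<open>Splitting the design leaves the noise as the last factor, while it must be fixed before
  the off-support columns; the swap restores the order of conditioning.\<close>

lemma measure_pair_swap:
  assumes M: "prob_space M" and N: "prob_space N" and A: "A \<in> sets (M \<Otimes>\<^sub>M N)"
  shows "measure (M \<Otimes>\<^sub>M N) A = measure (N \<Otimes>\<^sub>M M) ((\<lambda>(x, y). (y, x)) -` A \<inter> space (N \<Otimes>\<^sub>M M))"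
proof -
  interpret M: prob_space M by (rule M)
  interpret N: prob_space N by (rule N)
  interpret P: pair_prob_space M N ..
  show ?thesis
    by (subst P.distr_pair_swap) (rule measure_distr[OF _ A], rule measurable_pair_swap')
qed

text \<open>Isolates the coordinates in \<open>I\<close> as the outermost factor. It is used with
  \<open>I\<close> the support columns and \<open>J\<close> the others, so that conditioning on the
  support columns is taking sections.\<close>

lemma measure_merge_pair:
  assumes I: "finite I" "finite J" "I \<inter> J = {}" and N: "prob_space N"
    and A: "A \<in> sets (std_gauss_vec (I \<union> J) \<Otimes>\<^sub>M N)"
  defines "f \<equiv> \<lambda>(x, y, w). (merge I J (x, y), w)"
  shows "measure (std_gauss_vec (I \<union> J) \<Otimes>\<^sub>M N) A
    = measure (std_gauss_vec I \<Otimes>\<^sub>M (std_gauss_vec J \<Otimes>\<^sub>M N))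
        (f -` A \<inter> space (std_gauss_vec I \<Otimes>\<^sub>M (std_gauss_vec J \<Otimes>\<^sub>M N)))"
    and "f \<in> std_gauss_vec I \<Otimes>\<^sub>M (std_gauss_vec J \<Otimes>\<^sub>M N) \<rightarrow>\<^sub>M std_gauss_vec (I \<union> J) \<Otimes>\<^sub>M N"
proof -
  let ?D = "density lborel std_normal_density"
  interpret N: prob_space N by (rule N)
  interpret D: prob_space ?D by (rule prob_space_normal_density) simp
  interpret prod: product_sigma_finite "\<lambda>_. ?D" by standard
  interpret I: prob_space "std_gauss_vec I"
    unfolding std_gauss_vec_def by (intro prob_space_PiM D.prob_space_axioms)
  interpret J: prob_space "std_gauss_vec J"
    unfolding std_gauss_vec_def by (intro prob_space_PiM D.prob_space_axioms)
  interpret IJ: prob_space "std_gauss_vec (I \<union> J)"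
    unfolding std_gauss_vec_def by (intro prob_space_PiM D.prob_space_axioms)
  interpret JN: pair_prob_space "std_gauss_vec J" N ..
  interpret PIJ: pair_prob_space "std_gauss_vec I" "std_gauss_vec J" ..
  interpret P: pair_prob_space "std_gauss_vec (I \<union> J)" N ..
  interpret Q: pair_prob_space "std_gauss_vec I" "std_gauss_vec J \<Otimes>\<^sub>M N" ..
  have merge [measurable]: "merge I J \<in> std_gauss_vec I \<Otimes>\<^sub>M std_gauss_vec J \<rightarrow>\<^sub>M std_gauss_vec (I \<union> J)"
    unfolding std_gauss_vec_def by (rule measurable_merge)
  show f: "f \<in> std_gauss_vec I \<Otimes>\<^sub>M (std_gauss_vec J \<Otimes>\<^sub>M N) \<rightarrow>\<^sub>M std_gauss_vec (I \<union> J) \<Otimes>\<^sub>M N"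
    unfolding f_def split_beta' by measurable
  let ?m = "\<lambda>x. emeasure N (Pair x -` A)"
  have m [measurable]: "?m \<in> borel_measurable (std_gauss_vec (I \<union> J))"
    by (rule N.measurable_emeasure_Pair[OF A])
  let ?B = "f -` A \<inter> space (std_gauss_vec I \<Otimes>\<^sub>M (std_gauss_vec J \<Otimes>\<^sub>M N))"
  have B: "?B \<in> sets (std_gauss_vec I \<Otimes>\<^sub>M (std_gauss_vec J \<Otimes>\<^sub>M N))"
    using f A by (rule measurable_sets)
  have "emeasure (std_gauss_vec (I \<union> J) \<Otimes>\<^sub>M N) A = (\<integral>\<^sup>+x. ?m x \<partial>std_gauss_vec (I \<union> J))"
    by (rule N.emeasure_pair_measure_alt[OF A])
  also have "\<dots> = (\<integral>\<^sup>+x. ?m x \<partial>distr (std_gauss_vec I \<Otimes>\<^sub>M std_gauss_vec J) (std_gauss_vec (I \<union> J)) (merge I J))"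
    unfolding std_gauss_vec_def prod.distr_merge[OF I(3,1,2)] ..
  also have "\<dots> = (\<integral>\<^sup>+z. ?m (merge I J z) \<partial>(std_gauss_vec I \<Otimes>\<^sub>M std_gauss_vec J))"
    by (rule nn_integral_distr) measurable
  also have "\<dots> = (\<integral>\<^sup>+x. \<integral>\<^sup>+y. ?m (merge I J (x, y)) \<partial>std_gauss_vec J \<partial>std_gauss_vec I)"
    by (rule J.nn_integral_fst[symmetric]) measurable
  also have "\<dots> = (\<integral>\<^sup>+x. emeasure (std_gauss_vec J \<Otimes>\<^sub>M N) (Pair x -` ?B) \<partial>std_gauss_vec I)"
  proof (rule nn_integral_cong)
    fix x assume x: "x \<in> space (std_gauss_vec I)"
    have C: "Pair x -` ?B \<in> sets (std_gauss_vec J \<Otimes>\<^sub>M N)" by (rule sets_Pair1[OF B])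
    have "emeasure (std_gauss_vec J \<Otimes>\<^sub>M N) (Pair x -` ?B)
        = (\<integral>\<^sup>+y. emeasure N (Pair y -` (Pair x -` ?B)) \<partial>std_gauss_vec J)"
      by (rule N.emeasure_pair_measure_alt[OF C])
    also have "\<dots> = (\<integral>\<^sup>+y. ?m (merge I J (x, y)) \<partial>std_gauss_vec J)"
    proof (rule nn_integral_cong)
      fix y assume y: "y \<in> space (std_gauss_vec J)"
      have "Pair y -` (Pair x -` ?B) = Pair (merge I J (x, y)) -` A"
        using x y sets.sets_into_space[OF A] by (auto simp: f_def space_pair_measure)
      then show "emeasure N (Pair y -` (Pair x -` ?B)) = ?m (merge I J (x, y))" by simp
    qed
    finally show "(\<integral>\<^sup>+y. ?m (merge I J (x, y)) \<partial>std_gauss_vec J)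
        = emeasure (std_gauss_vec J \<Otimes>\<^sub>M N) (Pair x -` ?B)" ..
  qed
  also have "\<dots> = emeasure (std_gauss_vec I \<Otimes>\<^sub>M (std_gauss_vec J \<Otimes>\<^sub>M N)) ?B"
    by (rule JN.emeasure_pair_measure_alt[OF B, symmetric])
  finally show "measure (std_gauss_vec (I \<union> J) \<Otimes>\<^sub>M N) A
    = measure (std_gauss_vec I \<Otimes>\<^sub>M (std_gauss_vec J \<Otimes>\<^sub>M N)) ?B"
    by (simp add: measure_def)
qed

subsection \<open>Singular values of tall Gaussian matrices\<close>

text \<open>The negative term carries the induction: passing from \<open>m\<close> to
  \<open>m + 1\<close> adds two summands, exactly the decrease of
  \<open>2 * (1 / 2) ^ m\<close>.\<close>

lemma sum_half_power_abs: "(\<Sum>i\<in>{- int m..int m}. (1 / 2 :: real) ^ nat \<bar>i\<bar>) \<le> 3 - 2 * (1 / 2) ^ m"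
proof (induction m)
  case (Suc m)
  have "{- int (Suc m)..int (Suc m)} = insert (- int (Suc m)) (insert (int (Suc m)) {- int m..int m})"
    by auto
  then have "(\<Sum>i\<in>{- int (Suc m)..int (Suc m)}. (1 / 2 :: real) ^ nat \<bar>i\<bar>)
      = 2 * (1 / 2) ^ Suc m + (\<Sum>i\<in>{- int m..int m}. (1 / 2 :: real) ^ nat \<bar>i\<bar>)"
    by (simp add: nat_add_distrib)
  also have "\<dots> \<le> 2 * (1 / 2) ^ Suc m + (3 - 2 * (1 / 2) ^ m)" using Suc by simp
  finally show ?case by simp
qed simp

lemma sum_exp_neg_squares: "(\<Sum>i\<in>{- int m..int m}. exp (- (real_of_int i)\<^sup>2)) \<le> 3"
proof -
  have "exp (- (real_of_int i)\<^sup>2) \<le> (1 / 2) ^ nat \<bar>i\<bar>" for i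
  proof -
    have "\<bar>i\<bar> \<le> i\<^sup>2"
      using mult_left_mono[of 1 "\<bar>i\<bar>" "\<bar>i\<bar>"] by (cases "i = 0") (auto simp: power2_eq_square)
    then have "real (nat \<bar>i\<bar>) \<le> (real_of_int i)\<^sup>2"
      by (metis abs_ge_zero int_nat_eq of_int_le_iff of_int_of_nat_eq of_int_power)
    then have "exp (- (real_of_int i)\<^sup>2) \<le> exp (- real (nat \<bar>i\<bar>))" by simp
    also have "\<dots> = (exp (- 1)) ^ nat \<bar>i\<bar>" by (simp add: exp_of_nat_mult[symmetric])
    also have "\<dots> \<le> (1 / 2) ^ nat \<bar>i\<bar>"
    proof (rule power_mono)
      show "exp (- 1) \<le> (1 / 2 :: real)" using exp_ge_add_one_self[of 1] by (simp add: exp_minus field_simps)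
    qed simp
    finally show ?thesis .
  qed
  then have "(\<Sum>i\<in>{- int m..int m}. exp (- (real_of_int i)\<^sup>2))
      \<le> (\<Sum>i\<in>{- int m..int m}. (1 / 2 :: real) ^ nat \<bar>i\<bar>)" by (rule sum_mono)
  also have "\<dots> \<le> 3 - 2 * (1 / 2) ^ m" by (rule sum_half_power_abs)
  also have "\<dots> \<le> 3" by simp
  finally show ?thesis .
qed

text \<open>Exponential counting: a lattice point in the ball satisfies
  \<open>1 \<le> exp (R - norm^2)\<close>, and the sum of these weights over the whole grid
  factorises into one-dimensional sums of value at most 3. Hence the count is exponential in the
  dimension.\<close>

lemma card_lattice_ball_le:
  assumes S: "finite S" and R: "R \<ge> 0"
  shows "real (card {k \<in> PiE S (\<lambda>_. {- int m..int m}). (\<Sum>j\<in>S. (real_of_int (k j))\<^sup>2) \<le> R})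
           \<le> exp R * 3 ^ card S" (is "real (card ?L) \<le> _")
proof -
  let ?P = "PiE S (\<lambda>_. {- int m..int m})"
  have fin: "finite ?P" using S by (intro finite_PiE) auto
  have "real (card ?L) = (\<Sum>k\<in>?L. 1)" by simp
  also have "\<dots> \<le> (\<Sum>k\<in>?L. exp R * (\<Prod>j\<in>S. exp (- (real_of_int (k j))\<^sup>2)))"
  proof (rule sum_mono)
    fix k assume "k \<in> ?L"
    then have "1 \<le> exp (R + (\<Sum>j\<in>S. - (real_of_int (k j))\<^sup>2))" by (simp add: sum_negf)
    then show "1 \<le> exp R * (\<Prod>j\<in>S. exp (- (real_of_int (k j))\<^sup>2))"
      by (simp add: exp_add exp_sum[OF S])
  qed
  also have "\<dots> \<le> (\<Sum>k\<in>?P. exp R * (\<Prod>j\<in>S. exp (- (real_of_int (k j))\<^sup>2)))"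
    using fin by (intro sum_mono2) (auto intro!: mult_nonneg_nonneg prod_nonneg)
  also have "\<dots> = exp R * (\<Prod>j\<in>S. \<Sum>i\<in>{- int m..int m}. exp (- (real_of_int i)\<^sup>2))"
    using S by (subst prod_sum_PiE) (auto simp: sum_distrib_left)
  also have "\<dots> \<le> exp R * (\<Prod>j\<in>S. 3)"
    by (intro mult_left_mono prod_mono conjI sum_exp_neg_squares sum_nonneg) auto
  finally show ?thesis by simp
qed

text \<open>The net consists of the points of the lattice \<open>(\<eta> / sqrt (card S)) \<int>\<^sup>S\<close> in the unit ball;
  rounding towards zero keeps points inside the ball.\<close>

lemma ball_net:
  fixes S :: "'a set" and \<eta> :: real
  assumes S: "finite S" "S \<noteq> {}" and \<eta>: "0 < \<eta>"
  obtains N :: "('a \<Rightarrow> real) set" where "finite N" "real (card N) \<le> (3 * exp (1 / \<eta>\<^sup>2)) ^ card S"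
    "\<And>v. L2_set v S \<le> 1 \<Longrightarrow> \<exists>u\<in>N. L2_set u S \<le> 1 \<and> L2_set (\<lambda>j. v j - u j) S \<le> \<eta>"
proof -
  define s where "s = real (card S)"
  have s: "s > 0" using S by (simp add: s_def card_gt_0_iff)
  \<comment> \<open>The inverse mesh: rounding errors of at most \<open>1 / a\<close> in each of
    \<open>s\<close> coordinates have squares adding up to at most
    \<open>s / a^2 = \<eta>^2\<close>, and the unit ball corresponds to integer vectors of squared
    norm at most \<open>s / \<eta>^2\<close>.\<close>
  define a where "a = sqrt s / \<eta>"
  have a: "a > 0" "a\<^sup>2 = s / \<eta>\<^sup>2" using s \<eta> by (auto simp: a_def power_divide)
  define m where "m = nat \<lceil>a\<rceil>"
  define L where "L = {k \<in> PiE S (\<lambda>_. {- int m..int m}). (\<Sum>j\<in>S. (real_of_int (k j))\<^sup>2) \<le> s / \<eta>\<^sup>2}"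
  define N where "N = (\<lambda>k j. real_of_int (k j) / a) ` L"
  have "finite (PiE S (\<lambda>_. {- int m..int m}))" using S by (intro finite_PiE) auto
  then have finL: "finite L" by (simp add: L_def)
  have "real (card N) \<le> real (card L)" unfolding N_def using card_image_le[OF finL] by simp
  also have "\<dots> \<le> exp (s / \<eta>\<^sup>2) * 3 ^ card S"
    unfolding L_def using S s by (intro card_lattice_ball_le) auto
  also have "exp (s / \<eta>\<^sup>2) = exp (1 / \<eta>\<^sup>2) ^ card S"
    by (simp add: exp_of_nat_mult[symmetric] s_def)
  finally have card: "real (card N) \<le> (3 * exp (1 / \<eta>\<^sup>2)) ^ card S"
    by (simp add: power_mult_distrib mult.commute)
  have net: "\<exists>u\<in>N. L2_set u S \<le> 1 \<and> L2_set (\<lambda>j. v j - u j) S \<le> \<eta>" if v: "L2_set v S \<le> 1" for v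
  proof -
    define rd where "rd = (\<lambda>x::real. if x \<ge> 0 then \<lfloor>x\<rfloor> else - \<lfloor>- x\<rfloor>)"
    have rd1: "\<bar>real_of_int (rd x)\<bar> \<le> \<bar>x\<bar>" for x
    proof (cases "x \<ge> 0")
      case True
      then show ?thesis by (simp add: rd_def)
    next
      case False
      then have "0 \<le> real_of_int \<lfloor>- x\<rfloor>" by simp
      then show ?thesis using False of_int_floor_le[of "- x"] by (simp add: rd_def)
    qed
    have rd2: "\<bar>x - real_of_int (rd x)\<bar> \<le> 1" for x
    proof (cases "x \<ge> 0")
      case True
      then show ?thesis using of_int_floor_le[of x] floor_correct[of x] by (simp add: rd_def abs_le_iff) linarith
    next
      case False
      then show ?thesis using of_int_floor_le[of "- x"] floor_correct[of "- x"] by (simp add: rd_def abs_le_iff) linarith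
    qed
    define k where "k = (\<lambda>j\<in>S. rd (a * v j))"
    define u where "u = (\<lambda>j. real_of_int (k j) / a)"
    have v1: "(\<Sum>j\<in>S. (v j)\<^sup>2) \<le> 1" using v by (simp add: L2_set_def)
    have kv: "\<bar>real_of_int (k j)\<bar> \<le> a * \<bar>v j\<bar>" if "j \<in> S" for j
      using rd1[of "a * v j"] that a by (simp add: k_def abs_mult)
    have uv: "\<bar>u j\<bar> \<le> \<bar>v j\<bar>" if "j \<in> S" for j
      using kv[OF that] a by (simp add: u_def field_simps)
    have usq: "(\<Sum>j\<in>S. (u j)\<^sup>2) \<le> 1"
    proof -
      have "(\<Sum>j\<in>S. (u j)\<^sup>2) \<le> (\<Sum>j\<in>S. (v j)\<^sup>2)" using uv by (intro sum_mono) (simp add: abs_le_square_iff)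
      then show ?thesis using v1 by linarith
    qed
    have "k \<in> L"
    proof -
      have "k j \<in> {- int m..int m}" if "j \<in> S" for j
      proof -
        have "(v j)\<^sup>2 \<le> (\<Sum>j\<in>S. (v j)\<^sup>2)" using S that by (intro member_le_sum) auto
        then have "\<bar>v j\<bar> \<le> 1" using v1 abs_square_le_1 by fastforce
        then have "a * \<bar>v j\<bar> \<le> a * 1" using a by (intro mult_left_mono) auto
        then have "\<bar>real_of_int (k j)\<bar> \<le> a" using kv[OF that] by linarith
        also have "\<dots> \<le> real m" using a by (simp add: m_def)
        finally show ?thesis by (simp add: abs_le_iff)
      qed
      moreover have "(\<Sum>j\<in>S. (real_of_int (k j))\<^sup>2) \<le> s / \<eta>\<^sup>2"
      proof -
        have "(\<Sum>j\<in>S. (real_of_int (k j))\<^sup>2) = a\<^sup>2 * (\<Sum>j\<in>S. (u j)\<^sup>2)"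
          using a(1) by (simp add: u_def power_divide sum_distrib_left)
        also have "\<dots> \<le> a\<^sup>2 * 1" using usq by (intro mult_left_mono) auto
        finally show ?thesis using a by simp
      qed
      ultimately show ?thesis by (auto simp: L_def k_def)
    qed
    then have uN: "u \<in> N" by (auto simp: N_def u_def)
    have "(\<Sum>j\<in>S. (v j - u j)\<^sup>2) \<le> (\<Sum>j\<in>S. 1 / a\<^sup>2)"
    proof (rule sum_mono)
      fix j assume j: "j \<in> S"
      have "v j - u j = (a * v j - real_of_int (rd (a * v j))) / a"
        using a j by (simp add: u_def k_def field_simps)
      then have "(v j - u j)\<^sup>2 = (a * v j - real_of_int (rd (a * v j)))\<^sup>2 / a\<^sup>2"
        by (simp add: power_divide)
      also have "\<dots> \<le> 1 / a\<^sup>2"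
        using rd2[of "a * v j"] by (intro divide_right_mono) (auto simp: abs_square_le_1)
      finally show "(v j - u j)\<^sup>2 \<le> 1 / a\<^sup>2" .
    qed
    also have "\<dots> = s / a\<^sup>2" by (simp add: s_def)
    also have "\<dots> = \<eta>\<^sup>2" using a s \<eta> by simp
    finally have "L2_set (\<lambda>j. v j - u j) S \<le> \<eta>" unfolding L2_set_def using \<eta>
      by (metis real_sqrt_le_mono real_sqrt_abs abs_of_pos)
    then show ?thesis using uN usq by (intro bexI[of _ u]) (auto simp: L2_set_def)
  qed
  show ?thesis by (rule that[OF _ card net]) (simp add: N_def finL)
qed

text \<open>Bootstrapping: the supremum \<open>\<Lambda>\<close> of \<open>f\<close> over the unit
  ball satisfies \<open>\<Lambda> \<le> (1 + \<eta>) * b + \<eta> * \<Lambda>\<close>, since each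
  point is within \<open>\<eta>\<close> of the net. The constant \<open>C\<close> makes
  \<open>\<Lambda>\<close> finite and makes \<open>f\<close> vanish on vectors of norm 0; its size
  does not enter the bounds. The lower bound then subtracts the error
  \<open>\<eta> * \<Lambda>\<close>.\<close>

lemma seminorm_bounds_from_net:
  fixes f :: "('a \<Rightarrow> real) \<Rightarrow> real"
  assumes tri: "\<And>u v. f (\<lambda>j. u j + v j) \<le> f u + f v"
    and hom: "\<And>c v. f (\<lambda>j. c * v j) = \<bar>c\<bar> * f v"
    and bd: "\<And>v. f v \<le> C * L2_set v S" and nonneg: "\<And>v. 0 \<le> f v"
    and b: "0 \<le> b" and \<eta>: "0 < \<eta>" "\<eta> \<le> 1 / 4"
    and net: "\<And>v. L2_set v S \<le> 1 \<Longrightarrow> \<exists>u\<in>N. L2_set u S \<le> 1 \<and> L2_set (\<lambda>j. v j - u j) S \<le> \<eta>"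
    and lower: "\<And>u. u \<in> N \<Longrightarrow> (1 - \<eta>) * b * L2_set u S \<le> f u"
    and upper: "\<And>u. u \<in> N \<Longrightarrow> f u \<le> (1 + \<eta>) * b * L2_set u S"
  shows "(1 - 4 * \<eta>) * b * L2_set v S \<le> f v" and "f v \<le> 2 * b * L2_set v S"
proof -
  have nn: "0 \<le> L2_set v S" for v :: "'a \<Rightarrow> real" by (simp add: L2_set_nonneg)
  have sc: "L2_set (\<lambda>j. c * v j) S = \<bar>c\<bar> * L2_set v S" for c :: real and v
    by (simp add: L2_set_def power_mult_distrib sum_distrib_left[symmetric] real_sqrt_mult)
  have zero: "f v = 0" if "L2_set v S = 0" for v using bd[of v] nonneg[of v] that by simp
  define U where "U = {f v |v. L2_set v S \<le> 1}"
  define \<Lambda> where "\<Lambda> = Sup U"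
  have bdd: "bdd_above U"
  proof (rule bdd_aboveI)
    fix y assume "y \<in> U"
    then obtain v where v: "y = f v" "L2_set v S \<le> 1" by (auto simp: U_def)
    have "f v \<le> \<bar>C\<bar> * L2_set v S" using bd[of v] nn[of v] mult_right_mono[OF abs_ge_self[of C] nn[of v]] by linarith
    also have "\<dots> \<le> \<bar>C\<bar>" using v nn[of v] by (simp add: mult_left_le)
    finally show "y \<le> \<bar>C\<bar>" using v by simp
  qed
  have ne: "U \<noteq> {}"
  proof -
    have "L2_set (\<lambda>_::'a. 0::real) S \<le> 1" by (simp add: L2_set_def)
    then show ?thesis by (auto simp: U_def)
  qed
  have \<Lambda>: "f v \<le> \<Lambda> * L2_set v S" for v
  proof (cases "L2_set v S = 0")
    case False
    then have pos: "L2_set v S > 0" using nn[of v] by linarith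
    define w where "w = (\<lambda>j. (1 / L2_set v S) * v j)"
    have "L2_set w S = 1" using pos unfolding w_def sc by simp
    then have "f w \<in> U" by (auto simp: U_def)
    then have "f w \<le> \<Lambda>" unfolding \<Lambda>_def using bdd by (intro cSup_upper)
    moreover have "f w = f v / L2_set v S" using pos unfolding w_def hom by simp
    ultimately show ?thesis using pos by (simp add: field_simps)
  qed (use zero in simp)
  have \<Lambda>0: "\<Lambda> \<ge> 0"
  proof -
    obtain y where y: "y \<in> U" using ne by auto
    then have "0 \<le> y" using nonneg by (auto simp: U_def)
    also have "y \<le> \<Lambda>" unfolding \<Lambda>_def using y bdd by (intro cSup_upper)
    finally show ?thesis .
  qed
  \<comment> \<open>The middle conjunct says that the net point loses at most \<open>\<eta>\<close>
    of the norm of \<open>v\<close>. The lower bound needs it, since the lower estimate on the net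
    scales with the norm of the net point.\<close>
  have sub: "\<exists>u\<in>N. L2_set u S \<le> 1 \<and> 1 - \<eta> \<le> L2_set u S + (1 - L2_set v S) \<and> f (\<lambda>j. v j - u j) \<le> \<eta> * \<Lambda>"
    if "L2_set v S \<le> 1" for v
  proof -
    from net[OF that] obtain u where u: "u \<in> N" "L2_set u S \<le> 1" "L2_set (\<lambda>j. v j - u j) S \<le> \<eta>" by auto
    have "L2_set v S \<le> L2_set u S + L2_set (\<lambda>j. v j - u j) S"
      using L2_set_triangle_ineq[of u "\<lambda>j. v j - u j" S] by simp
    moreover have "f (\<lambda>j. v j - u j) \<le> \<Lambda> * \<eta>"
      using \<Lambda>[of "\<lambda>j. v j - u j"] mult_left_mono[OF u(3) \<Lambda>0] by linarith
    ultimately show ?thesis using u by (intro bexI[of _ u]) (auto simp: mult.commute)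
  qed
  have "\<Lambda> \<le> (1 + \<eta>) * b + \<eta> * \<Lambda>" unfolding \<Lambda>_def
  proof (rule cSup_least[OF ne], unfold \<Lambda>_def[symmetric])
    fix y assume "y \<in> U"
    then obtain v where v: "y = f v" "L2_set v S \<le> 1" by (auto simp: U_def)
    from sub[OF v(2)] obtain u where u: "u \<in> N" "L2_set u S \<le> 1" "f (\<lambda>j. v j - u j) \<le> \<eta> * \<Lambda>" by auto
    have "f v \<le> f u + f (\<lambda>j. v j - u j)" using tri[of u "\<lambda>j. v j - u j"] by simp
    moreover have "(1 + \<eta>) * b * L2_set u S \<le> (1 + \<eta>) * b * 1"
      using u(2) b \<eta> by (intro mult_left_mono) auto
    then have "f u \<le> (1 + \<eta>) * b" using upper[OF u(1)] by simp
    ultimately show "y \<le> (1 + \<eta>) * b + \<eta> * \<Lambda>" using u v by linarith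
  qed
  then have \<Lambda>2: "\<Lambda> \<le> 2 * b"
  proof -
    assume "\<Lambda> \<le> (1 + \<eta>) * b + \<eta> * \<Lambda>"
    moreover have "\<eta> * \<Lambda> \<le> \<Lambda> / 4" "\<eta> * b \<le> b / 4" using \<eta> \<Lambda>0 b mult_right_mono[of \<eta> "1/4"] by auto
    ultimately show ?thesis using b by (simp add: algebra_simps)
  qed
  show "f v \<le> 2 * b * L2_set v S"
    using \<Lambda>[of v] mult_right_mono[OF \<Lambda>2 nn[of v]] by linarith
  show "(1 - 4 * \<eta>) * b * L2_set v S \<le> f v"
  proof (cases "L2_set v S = 0")
    case True
    then show ?thesis using nonneg by simp
  next
    case False
    then have pos: "L2_set v S > 0" using nn[of v] by linarith
    define w where "w = (\<lambda>j. (1 / L2_set v S) * v j)"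
    have w1: "L2_set w S = 1" using pos unfolding w_def sc by simp
    obtain u where u: "u \<in> N" "1 - \<eta> \<le> L2_set u S" "f (\<lambda>j. w j - u j) \<le> \<eta> * \<Lambda>"
      using sub[of w] w1 by auto
    have "f u \<le> f w + f (\<lambda>j. w j - u j)"
      using tri[of w "\<lambda>j. - 1 * (w j - u j)"] hom[of "- 1" "\<lambda>j. w j - u j"] by simp
    moreover have "(1 - \<eta>) * b * (1 - \<eta>) \<le> f u"
    proof -
      have "(1 - \<eta>) * b * (1 - \<eta>) \<le> (1 - \<eta>) * b * L2_set u S"
        using u(2) \<eta> b by (intro mult_left_mono) auto
      then show ?thesis using lower[OF u(1)] by linarith
    qed
    moreover have "\<eta> * \<Lambda> \<le> \<eta> * (2 * b)" using \<Lambda>2 \<eta> by simp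
    ultimately have "(1 - \<eta>) * b * (1 - \<eta>) - \<eta> * (2 * b) \<le> f w" using u(3) by linarith
    \<comment> \<open>The difference of the two sides is \<open>\<eta>^2 * b\<close>.\<close>
    moreover have "(1 - 4 * \<eta>) * b \<le> (1 - \<eta>) * b * (1 - \<eta>) - \<eta> * (2 * b)"
      using b \<eta> by (simp add: algebra_simps)
    ultimately have "(1 - 4 * \<eta>) * b \<le> f w" by linarith
    moreover have "f w = f v / L2_set v S" using pos unfolding w_def hom by simp
    ultimately show ?thesis using pos by (simp add: field_simps)
  qed
qed

section \<open>From net points to all directions of a Gaussian matrix\<close>

lemma matrix_chi_square_tails:
  fixes u :: "'b \<Rightarrow> real"
  assumes R: "finite R" and S: "finite S" and J: "R \<times> S \<subseteq> J"
    and A: "(\<Sum>j\<in>S. (u j)\<^sup>2) > 0" and \<eta>: "0 < \<eta>" "\<eta> \<le> 1"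
  defines "q \<equiv> \<lambda>x. \<Sum>i\<in>R. (\<Sum>j\<in>S. x (i, j) * u j)\<^sup>2"
  shows "q \<in> borel_measurable (std_gauss_vec J)"
    and "measure (std_gauss_vec J)
           {x \<in> space (std_gauss_vec J). (1 + \<eta>) * (\<Sum>j\<in>S. (u j)\<^sup>2) * real (card R) \<le> q x}
           \<le> exp (- \<eta>\<^sup>2 * real (card R) / 16)"
    and "measure (std_gauss_vec J)
           {x \<in> space (std_gauss_vec J). q x \<le> (1 - \<eta>) * (\<Sum>j\<in>S. (u j)\<^sup>2) * real (card R)}
           \<le> exp (- \<eta>\<^sup>2 * real (card R) / 16)"
proof -
  have row: "(\<Sum>z\<in>{i} \<times> S. h z) = (\<Sum>j\<in>S. h (i, j))" for i :: 'a and h :: "'a \<times> 'b \<Rightarrow> real"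
    using sum.cartesian_product[of "\<lambda>i j. h (i, j)" S "{i}"] by simp
  have q: "q = (\<lambda>x. \<Sum>i\<in>R. (\<Sum>z\<in>{i} \<times> S. u (snd z) * x z)\<^sup>2)"
    unfolding q_def row by (simp add: mult.commute)
  have K: "\<And>i. i \<in> R \<Longrightarrow> {i} \<times> S \<subseteq> J" "\<And>i. i \<in> R \<Longrightarrow> finite ({i} \<times> S)"
    "disjoint_family_on (\<lambda>i. {i} \<times> S) R"
    using J S by (auto simp: disjoint_family_on_def)
  have A': "\<And>i. i \<in> R \<Longrightarrow> (\<Sum>z\<in>{i} \<times> S. (u (snd z))\<^sup>2) = (\<Sum>j\<in>S. (u j)\<^sup>2)"
    unfolding row by simp
  note tails = chi_square_tails[where a = "\<lambda>_ z. u (snd z)", OF R K A' A \<eta>]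
  show "q \<in> borel_measurable (std_gauss_vec J)"
    "measure (std_gauss_vec J)
       {x \<in> space (std_gauss_vec J). (1 + \<eta>) * (\<Sum>j\<in>S. (u j)\<^sup>2) * real (card R) \<le> q x}
       \<le> exp (- \<eta>\<^sup>2 * real (card R) / 16)"
    "measure (std_gauss_vec J)
       {x \<in> space (std_gauss_vec J). q x \<le> (1 - \<eta>) * (\<Sum>j\<in>S. (u j)\<^sup>2) * real (card R)}
       \<le> exp (- \<eta>\<^sup>2 * real (card R) / 16)"
    unfolding q using tails by auto
qed

text \<open>Union bound for the chi-square tails over the net, extended to all vectors by
  \<open>seminorm_bounds_from_net\<close>. One event \<open>G\<close> serves all \<open>v\<close> at
  once, as required for vectors computed from the matrix itself. The failure bound is small when
  \<open>card R\<close> dominates \<open>card S\<close>.\<close>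

lemma gauss_matrix_singular_values:
  fixes S :: "'b set" and R :: "'a set" and \<eta> :: real
  assumes R: "finite R" and S: "finite S" "S \<noteq> {}" and J: "R \<times> S \<subseteq> J"
    and \<eta>: "0 < \<eta>" "\<eta> \<le> 1 / 4"
  obtains G where "G \<in> sets (std_gauss_vec J)"
    "measure (std_gauss_vec J) (space (std_gauss_vec J) - G)
       \<le> 2 * (3 * exp (1 / \<eta>\<^sup>2)) ^ card S * exp (- \<eta>\<^sup>2 * real (card R) / 16)"
    "\<And>x v. x \<in> G \<Longrightarrow> (1 - 8 * \<eta>) * real (card R) * (\<Sum>j\<in>S. (v j)\<^sup>2) \<le> (\<Sum>i\<in>R. (\<Sum>j\<in>S. x (i, j) * v j)\<^sup>2)"
    "\<And>x v. x \<in> G \<Longrightarrow> (\<Sum>i\<in>R. (\<Sum>j\<in>S. x (i, j) * v j)\<^sup>2) \<le> 4 * real (card R) * (\<Sum>j\<in>S. (v j)\<^sup>2)"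
proof -
  interpret prob_space "std_gauss_vec J" by (rule prob_space_std_gauss_vec)
  let ?M = "std_gauss_vec J"
  obtain N :: "('b \<Rightarrow> real) set" where N: "finite N" "real (card N) \<le> (3 * exp (1 / \<eta>\<^sup>2)) ^ card S"
    "\<And>v. L2_set v S \<le> 1 \<Longrightarrow> \<exists>u\<in>N. L2_set u S \<le> 1 \<and> L2_set (\<lambda>j. v j - u j) S \<le> \<eta>"
    using ball_net[OF S \<eta>(1)] by blast
  define m where "m = real (card R)"
  define q where "q = (\<lambda>u (x :: 'a \<times> 'b \<Rightarrow> real). \<Sum>i\<in>R. (\<Sum>j\<in>S. x (i, j) * u j)\<^sup>2)"
  define A where "A = (\<lambda>u::'b \<Rightarrow> real. \<Sum>j\<in>S. (u j)\<^sup>2)"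
  \<comment> \<open>Net points that vanish on \<open>S\<close> have no chi-square tail; for them
    both bounds are trivial.\<close>
  define N' where "N' = {u \<in> N. A u > 0}"
  define E1 where "E1 = (\<lambda>u. {x \<in> space ?M. (1 + \<eta>) * A u * m \<le> q u x})"
  define E2 where "E2 = (\<lambda>u. {x \<in> space ?M. q u x \<le> (1 - \<eta>) * A u * m})"
  define B where "B = (\<Union>u\<in>N'. E1 u \<union> E2 u)"
  have fin': "finite N'" using N by (simp add: N'_def)
  have E: "E1 u \<in> events" "E2 u \<in> events" "prob (E1 u) \<le> exp (- \<eta>\<^sup>2 * m / 16)" "prob (E2 u) \<le> exp (- \<eta>\<^sup>2 * m / 16)"
    if "u \<in> N'" for u
  proof -
    have "(\<Sum>j\<in>S. (u j)\<^sup>2) > 0" using that by (simp add: N'_def A_def)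
    note t = matrix_chi_square_tails[OF R S(1) J this \<eta>(1)]
    have [measurable]: "q u \<in> borel_measurable ?M" unfolding q_def by (rule t(1)) (use \<eta> in simp)
    show "E1 u \<in> events" "E2 u \<in> events" unfolding E1_def E2_def by measurable
    show "prob (E1 u) \<le> exp (- \<eta>\<^sup>2 * m / 16)" "prob (E2 u) \<le> exp (- \<eta>\<^sup>2 * m / 16)"
      unfolding E1_def E2_def q_def A_def m_def using t(2,3) \<eta> by auto
  qed
  have B: "B \<in> events" unfolding B_def using E fin' by (intro sets.finite_UN) auto
  have "prob B \<le> (\<Sum>u\<in>N'. prob (E1 u \<union> E2 u))"
    unfolding B_def using E fin' by (intro finite_measure_subadditive_finite) auto
  also have "\<dots> \<le> (\<Sum>u\<in>N'. 2 * exp (- \<eta>\<^sup>2 * m / 16))"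
  proof (rule sum_mono)
    fix u assume u: "u \<in> N'"
    have "prob (E1 u \<union> E2 u) \<le> prob (E1 u) + prob (E2 u)"
      using E[OF u] by (intro measure_Un_le)
    then show "prob (E1 u \<union> E2 u) \<le> 2 * exp (- \<eta>\<^sup>2 * m / 16)" using E(3,4)[OF u] by linarith
  qed
  also have "\<dots> = real (card N') * (2 * exp (- \<eta>\<^sup>2 * m / 16))" by simp
  also have "\<dots> \<le> (3 * exp (1 / \<eta>\<^sup>2)) ^ card S * (2 * exp (- \<eta>\<^sup>2 * m / 16))"
  proof (rule mult_right_mono)
    have "card N' \<le> card N" unfolding N'_def using N(1) by (intro card_mono) auto
    then show "real (card N') \<le> (3 * exp (1 / \<eta>\<^sup>2)) ^ card S" using N(2) by linarith
  qed simp
  finally have PB: "prob B \<le> 2 * (3 * exp (1 / \<eta>\<^sup>2)) ^ card S * exp (- \<eta>\<^sup>2 * m / 16)" by simp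
  have main: "(1 - 4 * \<eta>) * sqrt m * L2_set v S \<le> L2_set (\<lambda>i. \<Sum>j\<in>S. x (i, j) * v j) R"
    "L2_set (\<lambda>i. \<Sum>j\<in>S. x (i, j) * v j) R \<le> 2 * sqrt m * L2_set v S"
    if x: "x \<in> space ?M - B" for x v
  proof -
    define f where "f = (\<lambda>v. L2_set (\<lambda>i. \<Sum>j\<in>S. x (i, j) * v j) R)"
    have fq: "f u = sqrt (q u x)" for u by (simp add: f_def q_def L2_set_def)
    have tri: "f (\<lambda>j. u j + v j) \<le> f u + f v" for u v
      using L2_set_triangle_ineq[of "\<lambda>i. \<Sum>j\<in>S. x (i, j) * u j" "\<lambda>i. \<Sum>j\<in>S. x (i, j) * v j" R]
      by (simp add: f_def sum.distrib[symmetric] distrib_left)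
    have hom: "f (\<lambda>j. c * v j) = \<bar>c\<bar> * f v" for c v
    proof -
      have "(\<Sum>j\<in>S. x (i, j) * (c * v j)) = c * (\<Sum>j\<in>S. x (i, j) * v j)" for i
        by (simp add: sum_distrib_left mult_ac)
      then show ?thesis
        by (simp add: f_def L2_set_def power_mult_distrib sum_distrib_left[symmetric] real_sqrt_mult)
    qed
    have bd: "f v \<le> (\<Sum>i\<in>R. L2_set (\<lambda>j. x (i, j)) S) * L2_set v S" for v
    proof -
      have "f v \<le> (\<Sum>i\<in>R. \<bar>\<Sum>j\<in>S. x (i, j) * v j\<bar>)" unfolding f_def by (rule L2_set_le_sum_abs)
      also have "\<dots> \<le> (\<Sum>i\<in>R. L2_set (\<lambda>j. x (i, j)) S * L2_set v S)"
      proof (rule sum_mono)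
        fix i
        have "\<bar>\<Sum>j\<in>S. x (i, j) * v j\<bar> \<le> (\<Sum>j\<in>S. \<bar>x (i, j)\<bar> * \<bar>v j\<bar>)"
          by (rule order_trans[OF sum_abs]) (simp add: abs_mult)
        also have "\<dots> \<le> L2_set (\<lambda>j. x (i, j)) S * L2_set v S" by (rule L2_set_mult_ineq)
        finally show "\<bar>\<Sum>j\<in>S. x (i, j) * v j\<bar> \<le> L2_set (\<lambda>j. x (i, j)) S * L2_set v S" .
      qed
      finally show ?thesis by (simp add: sum_distrib_right)
    qed
    have nonneg: "0 \<le> f v" for v by (simp add: f_def)
    \<comment> \<open>The tails control squares. Since
      \<open>1 + \<eta> \<le> (1 + \<eta>)^2\<close> and
      \<open>(1 - \<eta>)^2 \<le> 1 - \<eta>\<close>, the same \<open>\<eta>\<close> works for the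
      norms.\<close>
    have lu: "(1 - \<eta>) * sqrt m * L2_set u S \<le> f u \<and> f u \<le> (1 + \<eta>) * sqrt m * L2_set u S" if u: "u \<in> N" for u
    proof (cases "u \<in> N'")
      case True
      then have Apos: "A u > 0" by (simp add: N'_def)
      have "x \<notin> E1 u" "x \<notin> E2 u" using x True by (auto simp: B_def)
      then have b: "(1 - \<eta>) * A u * m \<le> q u x" "q u x \<le> (1 + \<eta>) * A u * m"
        using x by (auto simp: E1_def E2_def)
      have m0: "m \<ge> 0" by (simp add: m_def)
      have L: "((1 + c) * sqrt m * L2_set u S)\<^sup>2 = (1 + c)\<^sup>2 * A u * m" for c
        using Apos m0 by (simp add: power_mult_distrib L2_set_def A_def)
      have "f u \<le> (1 + \<eta>) * sqrt m * L2_set u S"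
        unfolding fq
      proof (rule real_le_lsqrt)
        have "q u x \<le> (1 + \<eta>) * (A u * m)" using b by (simp add: mult.assoc)
        also have "\<dots> \<le> (1 + \<eta>)\<^sup>2 * (A u * m)"
          using \<eta> Apos m0 by (intro mult_right_mono self_le_power) auto
        finally show "q u x \<le> ((1 + \<eta>) * sqrt m * L2_set u S)\<^sup>2" unfolding L by (simp add: mult.assoc)
      qed (use \<eta> m0 in simp)
      moreover have "(1 - \<eta>) * sqrt m * L2_set u S \<le> f u"
        unfolding fq
      proof (rule real_le_rsqrt)
        have "(1 - \<eta>)\<^sup>2 * (A u * m) \<le> (1 - \<eta>) * (A u * m)"
          using \<eta> Apos m0 by (intro mult_right_mono power_le_one_iff[THEN iffD2] ) (auto simp: power2_eq_square intro: mult_left_le)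
        also have "\<dots> \<le> q u x" using b by (simp add: mult.assoc)
        finally show "((1 - \<eta>) * sqrt m * L2_set u S)\<^sup>2 \<le> q u x"
          using L[of "- \<eta>"] by (simp add: mult.assoc)
      qed
      ultimately show ?thesis by simp
    next
      case False
      then have "A u = 0" using u by (auto simp: N'_def A_def less_le sum_nonneg)
      then have "L2_set u S = 0" by (simp add: L2_set_def A_def)
      then show ?thesis using bd[of u] nonneg[of u] by simp
    qed
    note bounds = seminorm_bounds_from_net[where f = f and S = S and N = N and b = "sqrt m" and \<eta> = \<eta>,
        OF tri hom bd nonneg _ \<eta> N(3)]
    show "(1 - 4 * \<eta>) * sqrt m * L2_set v S \<le> L2_set (\<lambda>i. \<Sum>j\<in>S. x (i, j) * v j) R"
      using bounds(1)[of v] lu by (simp add: f_def m_def)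
    show "L2_set (\<lambda>i. \<Sum>j\<in>S. x (i, j) * v j) R \<le> 2 * sqrt m * L2_set v S"
      using bounds(2)[of v] lu by (simp add: f_def m_def)
  qed
  have sq: "(L2_set h T)\<^sup>2 = (\<Sum>i\<in>T. (h i)\<^sup>2)" for h :: "'c \<Rightarrow> real" and T
    by (simp add: L2_set_def sum_nonneg)
  show ?thesis
  proof (rule that[of "space ?M - B"])
    show "space ?M - B \<in> events" using B by auto
    have "space ?M - (space ?M - B) = B" using sets.sets_into_space[OF B] by auto
    then show "prob (space ?M - (space ?M - B))
        \<le> 2 * (3 * exp (1 / \<eta>\<^sup>2)) ^ card S * exp (- \<eta>\<^sup>2 * real (card R) / 16)"
      using PB by (simp add: m_def)
  next
    fix x v assume x: "x \<in> space ?M - B"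
    have m0: "m \<ge> 0" by (simp add: m_def)
    have Av: "0 \<le> (\<Sum>j\<in>S. (v j)\<^sup>2)" for v :: "'b \<Rightarrow> real" by (simp add: sum_nonneg)
    have "(L2_set (\<lambda>i. \<Sum>j\<in>S. x (i, j) * v j) R)\<^sup>2 \<le> (2 * sqrt m * L2_set v S)\<^sup>2"
      by (intro power_mono main(2)[OF x]) simp
    then show "(\<Sum>i\<in>R. (\<Sum>j\<in>S. x (i, j) * v j)\<^sup>2) \<le> 4 * real (card R) * (\<Sum>j\<in>S. (v j)\<^sup>2)"
      using m0 by (simp add: sq power_mult_distrib m_def)
    show "(1 - 8 * \<eta>) * real (card R) * (\<Sum>j\<in>S. (v j)\<^sup>2) \<le> (\<Sum>i\<in>R. (\<Sum>j\<in>S. x (i, j) * v j)\<^sup>2)"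
    proof -
      have "(1 - 8 * \<eta>) * (m * (\<Sum>j\<in>S. (v j)\<^sup>2)) \<le> (1 - 4 * \<eta>)\<^sup>2 * (m * (\<Sum>j\<in>S. (v j)\<^sup>2))"
        using m0 Av by (intro mult_right_mono) (auto simp: power2_eq_square algebra_simps)
      also have "\<dots> = ((1 - 4 * \<eta>) * sqrt m * L2_set v S)\<^sup>2"
        using m0 by (simp add: power_mult_distrib sq)
      also have "\<dots> \<le> (L2_set (\<lambda>i. \<Sum>j\<in>S. x (i, j) * v j) R)\<^sup>2"
        using \<eta> m0 by (intro power_mono main(1)[OF x]) auto
      finally show ?thesis by (simp add: sq m_def mult.assoc)
    qed
  qed
qed

subsection \<open>Deterministic success and failure\<close>

text \<open>Since \<^const>\<open>measure\<close> vanishes on non-measurable sets, a lower bound on the recovery probability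
  needs measurability of the event, which is a countable union of projections along compact boxes
  exhausting the open orthant of \<open>\<beta>\<^sup>*\<close>.\<close>

lemma recovery_event_measurable:
  fixes c :: "nat \<Rightarrow> real" and n p :: nat
  assumes n: "n > 0" and lam: "lam > 0"
  defines "M \<equiv> std_gauss_vec ({..<n} \<times> {..<p}) \<Otimes>\<^sub>M std_gauss_vec {..<n}"
  shows "{w \<in> space M. recovery n p (fst w) \<beta>s (\<lambda>i. c i * snd w i) lam} \<in> sets M"
proof -
  define cf where "cf = (\<lambda>(w :: (nat \<times> nat \<Rightarrow> real) \<times> (nat \<Rightarrow> real)) b j.
    \<Sum>i<n. fst w (i, j) * ((\<Sum>k<p. fst w (i, k) * (\<beta>s k - b k)) + c i * snd w i))"
  \<comment> \<open>A nonnegative penalty, continuous in \<open>b\<close>, that is 0 exactly when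
    condition \<open>j\<close> holds. Summing turns all conditions into the single equation
    \<open>F w b = 0\<close>.\<close>
  define g where "g = (\<lambda>w b j. if \<beta>s j = 0 then max 0 (\<bar>cf w b j\<bar> - real n * lam)
    else \<bar>cf w b j - real n * lam * sgn (\<beta>s j)\<bar>)"
  define F where "F = (\<lambda>w b. \<Sum>j<p. g w b j)"
  have g0: "0 \<le> g w b j" for w b j by (simp add: g_def)
  have F_kkt: "F w b = 0 \<longleftrightarrow>
      kkt n p (fst w) \<beta>s (\<lambda>i. (\<Sum>j<p. fst w (i, j) * (\<beta>s j - b j)) + c i * snd w i) lam" for w b
  proof -
    have "F w b = 0 \<longleftrightarrow> (\<forall>j<p. g w b j = 0)"
      unfolding F_def using g0 by (subst sum_nonneg_eq_0_iff) auto
    also have "\<dots> \<longleftrightarrow> kkt n p (fst w) \<beta>s (\<lambda>i. (\<Sum>j<p. fst w (i, j) * (\<beta>s j - b j)) + c i * snd w i) lam"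
      unfolding kkt_def cf_def[symmetric] g_def by (intro all_cong1 imp_cong) (auto simp: cf_def max_def)
    finally show ?thesis .
  qed
  \<comment> \<open>Box \<open>m\<close> has
    \<open>1 / (m + 1) \<le> \<bar>b j\<bar> \<le> m + 1\<close> with the sign of
    \<open>\<beta>s j\<close> on the support, and the single value 0 elsewhere.\<close>
  define l where "l = (\<lambda>(m::nat) j. if j < p \<and> \<beta>s j > 0 then 1 / real (Suc m)
    else if j < p \<and> \<beta>s j < 0 then - real (Suc m) else 0)"
  define u where "u = (\<lambda>(m::nat) j. if j < p \<and> \<beta>s j > 0 then real (Suc m)
    else if j < p \<and> \<beta>s j < 0 then - (1 / real (Suc m)) else 0)"
  define K where "K = (\<lambda>m. {b. \<forall>j. l m j \<le> b j \<and> b j \<le> u m j})"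
  have K_sgn: "(is_vec p b \<and> (\<forall>j<p. sgn (b j) = sgn (\<beta>s j))) \<longleftrightarrow> (\<exists>m. b \<in> K m)" for b
  proof
    assume b: "is_vec p b \<and> (\<forall>j<p. sgn (b j) = sgn (\<beta>s j))"
    obtain m1 where m1: "(\<Sum>j<p. \<bar>b j\<bar>) \<le> real m1" using real_arch_simple by blast
    \<comment> \<open>Bounds the reciprocals, hence keeps the nonzero coordinates away from 0; zero
      coordinates contribute \<open>1 / 0 = 0\<close>.\<close>
    obtain m2 where m2: "(\<Sum>j<p. 1 / \<bar>b j\<bar>) \<le> real m2" using real_arch_simple by blast
    define m where "m = max m1 m2"
    have "l m j \<le> b j \<and> b j \<le> u m j" for j
    proof (cases "j < p \<and> \<beta>s j \<noteq> 0")
      case True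
      then have s: "sgn (b j) = sgn (\<beta>s j)" "b j \<noteq> 0" using b by (auto, metis sgn_0_0)
      have "\<bar>b j\<bar> \<le> (\<Sum>j<p. \<bar>b j\<bar>)" using True by (intro member_le_sum) auto
      then have 1: "\<bar>b j\<bar> \<le> real (Suc m)" using m1 by (simp add: m_def)
      have "1 / \<bar>b j\<bar> \<le> (\<Sum>j<p. 1 / \<bar>b j\<bar>)" using True by (intro member_le_sum) auto
      then have "1 / \<bar>b j\<bar> \<le> real (Suc m)" using m2 by (simp add: m_def)
      then have 2: "1 / real (Suc m) \<le> \<bar>b j\<bar>" using s(2) by (simp add: field_simps)
      show ?thesis
      proof (cases "\<beta>s j > 0")
        case p: True
        then have "b j > 0" using s by (metis sgn_1_pos sgn_pos)
        then show ?thesis using 1 2 p True by (simp add: l_def u_def)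
      next
        case False
        then have neg: "\<beta>s j < 0" using True by simp
        then have "b j < 0" using s by (metis sgn_1_neg sgn_neg)
        then show ?thesis using 1 2 neg True by (simp add: l_def u_def)
      qed
    next
      case False
      then have "b j = 0" using b by (cases "j < p") (auto simp: is_vec_def sgn_0_0)
      then show ?thesis using False by (auto simp: l_def u_def)
    qed
    then show "\<exists>m. b \<in> K m" by (auto simp: K_def)
  next
    assume "\<exists>m. b \<in> K m"
    then obtain m where m: "\<And>j. l m j \<le> b j \<and> b j \<le> u m j" by (auto simp: K_def)
    have "b j = 0" if "j \<ge> p" for j using m[of j] that by (auto simp: l_def u_def)
    moreover have "sgn (b j) = sgn (\<beta>s j)" if j: "j < p" for j
    proof -
      have pos: "1 / real (Suc m) > 0" by simp
      consider "\<beta>s j > 0" | "\<beta>s j < 0" | "\<beta>s j = 0" by linarith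
      then show ?thesis
      proof cases
        case 1
        then have "1 / real (Suc m) \<le> b j" using m[of j] j by (simp add: l_def)
        then have "b j > 0" using pos by linarith
        then show ?thesis using 1 by simp
      next
        case 2
        then have "b j \<le> - (1 / real (Suc m))" using m[of j] j by (simp add: u_def)
        then have "b j < 0" using pos by linarith
        then show ?thesis using 2 by simp
      next
        case 3
        then have "b j = 0" using m[of j] by (simp add: l_def u_def)
        then show ?thesis using 3 by simp
      qed
    qed
    ultimately show "is_vec p b \<and> (\<forall>j<p. sgn (b j) = sgn (\<beta>s j))" by (auto simp: is_vec_def)
  qed
  have "{w \<in> space M. recovery n p (fst w) \<beta>s (\<lambda>i. c i * snd w i) lam}
      = (\<Union>m. {w \<in> space M. \<exists>b\<in>K m. F w b = 0})"
    unfolding recovery_iff_kkt[OF n lam] F_kkt[symmetric] conj_assoc[symmetric] K_sgn by blast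
  also have "\<dots> \<in> sets M"
  proof (intro sets.countable_UN image_subsetI)
    fix m
    show "{w \<in> space M. \<exists>b\<in>K m. F w b = 0} \<in> sets M"
    proof (rule sets_ex_zero_compact)
      show "compact (K m)" unfolding K_def by (rule compact_box_fun)
      show "0 \<le> F w b" for w b unfolding F_def using g0 by (intro sum_nonneg)
      fix w
      have [continuous_intros]: "continuous_on (K m) (\<lambda>b. b k)" for k
        by (rule continuous_on_subset[OF continuous_on_product_coordinates]) simp
      have [continuous_intros]: "continuous_on (K m) (\<lambda>b. cf w b j)" for j
        unfolding cf_def by (intro continuous_intros)
      have "continuous_on (K m) (\<lambda>b. g w b j)" for j
        unfolding g_def by (cases "\<beta>s j = 0") (auto intro!: continuous_intros)
      then show "continuous_on (K m) (F w)" unfolding F_def by (intro continuous_intros)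
    next
      fix b
      have X: "(\<lambda>w. fst w (i, j)) \<in> borel_measurable M" if "i < n" "j < p" for i j
      proof -
        have "(\<lambda>x. x (i, j)) \<in> borel_measurable (std_gauss_vec ({..<n} \<times> {..<p}))"
          using that unfolding std_gauss_vec_def by (intro measurable_component_singleton[THEN measurable_compose]) auto
        then show ?thesis unfolding M_def by (rule measurable_compose[OF measurable_fst])
      qed
      have W: "(\<lambda>w. snd w i) \<in> borel_measurable M" if "i < n" for i
      proof -
        have "(\<lambda>x. x i) \<in> borel_measurable (std_gauss_vec {..<n})"
          using that unfolding std_gauss_vec_def by (intro measurable_component_singleton[THEN measurable_compose]) auto
        then show ?thesis unfolding M_def by (rule measurable_compose[OF measurable_snd])
      qed
      have cfm: "(\<lambda>w. cf w b j) \<in> borel_measurable M" if "j < p" for j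
        unfolding cf_def using that
        by (intro borel_measurable_sum borel_measurable_times borel_measurable_add X W
            borel_measurable_const) auto
      have "(\<lambda>w. g w b j) \<in> borel_measurable M" if "j < p" for j
        unfolding g_def using cfm[OF that]
        by (cases "\<beta>s j = 0") (auto intro!: borel_measurable_max borel_measurable_abs borel_measurable_diff)
      then show "(\<lambda>w. F w b) \<in> borel_measurable M"
        unfolding F_def by (intro borel_measurable_sum) auto
    qed
  qed
  finally show ?thesis .
qed

section \<open>Normal equations and the residual\<close>

lemma sum_adjoint:
  fixes x :: "'a \<times> 'b \<Rightarrow> real"
  shows "(\<Sum>i\<in>R. (\<Sum>k\<in>S. x (i, k) * v k) * y i) = (\<Sum>k\<in>S. v k * (\<Sum>i\<in>R. x (i, k) * y i))"
  unfolding sum_distrib_left sum_distrib_right by (subst sum.swap) (simp add: mult_ac)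

text \<open>The lower bound on the quadratic form says that the Gram matrix \<open>Q\<close> is
  positive definite.\<close>

lemma normal_equations_solvable:
  fixes x :: "'a \<times> 'b \<Rightarrow> real"
  assumes S: "finite S" and \<mu>: "\<mu> > 0"
    and low: "\<And>v. \<mu> * (\<Sum>j\<in>S. (v j)\<^sup>2) \<le> (\<Sum>i\<in>R. (\<Sum>j\<in>S. x (i, j) * v j)\<^sup>2)"
  shows "\<exists>v. \<forall>k\<in>S. (\<Sum>i\<in>R. x (i, k) * (\<Sum>j\<in>S. x (i, j) * v j)) = h k"
proof -
  define Q where "Q = (\<lambda>k l. \<Sum>i\<in>R. x (i, k) * x (i, l))"
  have Q: "(\<Sum>l\<in>S. Q k l * v l) = (\<Sum>i\<in>R. x (i, k) * (\<Sum>j\<in>S. x (i, j) * v j))" for k v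
    unfolding Q_def sum_distrib_left sum_distrib_right by (subst sum.swap) (simp add: mult_ac)
  have "\<exists>v. \<forall>k\<in>S. (\<Sum>l\<in>S. Q k l * v l) = h k"
  proof (rule positive_definite_solvable[OF S])
    fix w :: "'b \<Rightarrow> real" assume "\<exists>j\<in>S. w j \<noteq> 0"
    then have "(\<Sum>j\<in>S. (w j)\<^sup>2) > 0" using S
      by (metis (mono_tags, lifting) sum_nonneg zero_le_power2 sum_nonneg_eq_0_iff zero_eq_power2 less_le)
    then have "0 < (\<Sum>i\<in>R. (\<Sum>j\<in>S. x (i, j) * w j)\<^sup>2)"
      using low[of w] \<mu> by (smt (verit) mult_pos_pos)
    also have "\<dots> = (\<Sum>k\<in>S. w k * (\<Sum>l\<in>S. Q k l * w l))"
      unfolding Q power2_eq_square by (rule sum_adjoint)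
    also have "\<dots> = (\<Sum>k\<in>S. \<Sum>l\<in>S. w k * Q k l * w l)" by (simp add: sum_distrib_left mult.assoc)
    finally show "0 < (\<Sum>k\<in>S. \<Sum>l\<in>S. w k * Q k l * w l)" .
  qed
  then show ?thesis unfolding Q .
qed

lemma member_square_le_sum:
  fixes f :: "'a \<Rightarrow> real"
  shows "finite S \<Longrightarrow> j \<in> S \<Longrightarrow> (f j)\<^sup>2 \<le> (\<Sum>k\<in>S. (f k)\<^sup>2)"
  by (intro member_le_sum) auto

text \<open>The vectors \<open>u j\<close> are the columns of the inverse Gram matrix \<open>(x\<^sup>T x)\<inverse>\<close>, so
  \<open>x (u j) \<bullet> Z\<close> is the \<open>j\<close>-th coordinate of the least squares fit of the noise.\<close>

lemma lasso_success:
  fixes x :: "nat \<times> nat \<Rightarrow> real" and \<beta>s :: "nat \<Rightarrow> real" and n p :: nat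
  assumes n: "n > 0" and lam: "lam > 0" and \<mu>: "\<mu> > 0"
  defines "S \<equiv> {j. j < p \<and> \<beta>s j \<noteq> 0}"
  assumes low: "\<And>v. \<mu> * (\<Sum>j\<in>S. (v j)\<^sup>2) \<le> (\<Sum>i<n. (\<Sum>j\<in>S. x (i, j) * v j)\<^sup>2)"
  obtains u where "\<And>j. j \<in> S \<Longrightarrow> (\<Sum>l\<in>S. (u j l)\<^sup>2) \<le> 1 / \<mu>\<^sup>2"
    and "\<And>Z \<rho>. \<lbrakk>\<And>j. j \<in> S \<Longrightarrow> \<rho> \<le> \<bar>\<beta>s j\<bar>;
          \<And>j. j \<in> S \<Longrightarrow> \<bar>\<Sum>i<n. (\<Sum>l\<in>S. x (i, l) * u j l) * Z i\<bar> < \<rho> / 2;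
          real n * lam * sqrt (real (card S)) / \<mu> \<le> \<rho> / 2\<rbrakk> \<Longrightarrow>
          \<exists>r. (\<Sum>i<n. (r i)\<^sup>2) \<le> (\<Sum>i<n. (Z i)\<^sup>2) + (real n * lam)\<^sup>2 * real (card S) / \<mu> \<and>
            (\<forall>X. (\<forall>i<n. \<forall>j\<in>S. X (i, j) = x (i, j)) \<longrightarrow>
              (\<forall>j<p. \<beta>s j = 0 \<longrightarrow> \<bar>\<Sum>i<n. X (i, j) * r i\<bar> \<le> real n * lam) \<longrightarrow>
              recovery n p X \<beta>s Z lam)"
proof -
  have S: "finite S" by (simp add: S_def)
  define T where "T = (\<lambda>v i. \<Sum>j\<in>S. x (i, j) * v j)"
  have adj: "(\<Sum>i<n. T v i * y i) = (\<Sum>k\<in>S. v k * (\<Sum>i<n. x (i, k) * y i))" for v y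
    unfolding T_def by (rule sum_adjoint)
  have sol: "\<exists>v. \<forall>k\<in>S. (\<Sum>i<n. x (i, k) * T v i) = h k" for h
    unfolding T_def using normal_equations_solvable[OF S \<mu> low] .
  have lowT: "\<mu> * (\<Sum>j\<in>S. (v j)\<^sup>2) \<le> (\<Sum>i<n. (T v i)\<^sup>2)" for v unfolding T_def by (rule low)
  \<comment> \<open>Chosen before the noise: for fixed \<open>x\<close> the fitted coordinates are
    linear forms in \<open>Z\<close> with fixed coefficients, so Gaussian tails apply to
    them.\<close>
  obtain u where u: "\<And>j k. k \<in> S \<Longrightarrow> (\<Sum>i<n. x (i, k) * T (u j) i) = (if k = j then 1 else 0)"
    using sol[of "\<lambda>k. if k = j then 1 else 0" for j] by metis
  have pick: "(\<Sum>k\<in>S. v k * (\<Sum>i<n. x (i, k) * T (u j) i)) = v j" if "j \<in> S" for v j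
  proof -
    have "(\<Sum>k\<in>S. v k * (\<Sum>i<n. x (i, k) * T (u j) i)) = (\<Sum>k\<in>S. if k = j then v k else 0)"
      using u by (intro sum.cong) auto
    then show ?thesis using that S by simp
  qed
  \<comment> \<open>Pairing the equation for \<open>u j\<close> with \<open>u j\<close> gives
    \<open>\<mu> * A \<le> u j j\<close>, and \<open>u j j\<close> is at most the square root of
    \<open>A\<close>; cancelling yields the bound.\<close>
  have u_bound: "(\<Sum>l\<in>S. (u j l)\<^sup>2) \<le> 1 / \<mu>\<^sup>2" if j: "j \<in> S" for j
  proof -
    define A where "A = (\<Sum>l\<in>S. (u j l)\<^sup>2)"
    have A0: "A \<ge> 0" by (simp add: A_def sum_nonneg)
    have "\<mu> * A \<le> u j j"
      using lowT[of "u j"] adj[of "u j" "T (u j)"] pick[OF j, of "u j"] by (simp add: A_def power2_eq_square)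
    then have "(\<mu> * A)\<^sup>2 \<le> (u j j)\<^sup>2" using A0 \<mu> by (intro power_mono) auto
    also have "\<dots> \<le> A" unfolding A_def by (rule member_square_le_sum[OF S j])
    finally have "A * (\<mu>\<^sup>2 * A) \<le> A * 1" by (simp add: power2_eq_square mult_ac)
    then have "\<mu>\<^sup>2 * A \<le> 1" using A0 by (cases "A = 0") auto
    then show ?thesis using \<mu> by (simp add: A_def field_simps)
  qed
  define nl where "nl = real n * lam"
  have nl: "nl > 0" using n lam by (simp add: nl_def)
  define s where "s = real (card S)"
  \<comment> \<open>The shrinkage vector: the Lasso estimate on the support will be the least
    squares fit minus \<open>g\<close>. Pairing its equation with \<open>g\<close> and
    Cauchy-Schwarz bound its norm, and thereby all of its coordinates.\<close>
  obtain g where g: "\<And>k. k \<in> S \<Longrightarrow> (\<Sum>i<n. x (i, k) * T g i) = nl * sgn (\<beta>s k)"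
    using sol[of "\<lambda>k. nl * sgn (\<beta>s k)"] by metis
  define B where "B = L2_set g S"
  have B0: "B \<ge> 0" by (simp add: B_def)
  have B2: "B\<^sup>2 = (\<Sum>j\<in>S. (g j)\<^sup>2)" by (simp add: B_def L2_set_def sum_nonneg)
  have Tg: "(\<Sum>i<n. (T g i)\<^sup>2) \<le> nl * sqrt s * B"
  proof -
    have "(\<Sum>i<n. (T g i)\<^sup>2) = (\<Sum>k\<in>S. g k * (nl * sgn (\<beta>s k)))"
      unfolding power2_eq_square adj using g by simp
    also have "\<dots> = nl * (\<Sum>k\<in>S. g k * sgn (\<beta>s k))" by (simp add: sum_distrib_left mult_ac)
    also have "(\<Sum>k\<in>S. g k * sgn (\<beta>s k)) \<le> (\<Sum>k\<in>S. \<bar>g k\<bar> * \<bar>sgn (\<beta>s k)\<bar>)"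
      by (intro sum_mono) (metis abs_ge_self abs_mult)
    also have "\<dots> \<le> B * L2_set (\<lambda>k. sgn (\<beta>s k)) S" unfolding B_def by (rule L2_set_mult_ineq)
    also have "L2_set (\<lambda>k. sgn (\<beta>s k)) S = sqrt s"
    proof -
      have "(\<Sum>k\<in>S. (sgn (\<beta>s k))\<^sup>2) = (\<Sum>k\<in>S. 1)"
        by (intro sum.cong) (auto simp: S_def sgn_if)
      then show ?thesis by (simp add: L2_set_def s_def)
    qed
    finally show ?thesis using nl by (simp add: mult_ac)
  qed
  have B: "B \<le> nl * sqrt s / \<mu>"
  proof (cases "B = 0")
    case False
    have "B * (\<mu> * B) \<le> B * (nl * sqrt s)"
      using lowT[of g] Tg unfolding B2[symmetric] by (simp add: power2_eq_square mult_ac)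
    then have "\<mu> * B \<le> nl * sqrt s" using False B0 by simp
    then show ?thesis using \<mu> by (simp add: field_simps)
  qed (use nl \<mu> in \<open>simp add: s_def\<close>)
  have g_norm: "(\<Sum>i<n. (T g i)\<^sup>2) \<le> nl\<^sup>2 * s / \<mu>"
  proof -
    have "nl * sqrt s * B \<le> nl * sqrt s * (nl * sqrt s / \<mu>)"
      using B nl by (intro mult_left_mono) (auto simp: s_def)
    also have "\<dots> = nl\<^sup>2 * (sqrt s * sqrt s) / \<mu>" by (simp add: power2_eq_square)
    finally show ?thesis using Tg by (simp add: s_def)
  qed
  have g_coord: "\<bar>g j\<bar> \<le> nl * sqrt s / \<mu>" if "j \<in> S" for j
  proof -
    have "\<bar>g j\<bar> \<le> B" using member_square_le_sum[OF S that, of g] unfolding B2[symmetric]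
      using B0 by (simp add: abs_le_square_iff[symmetric])
    then show ?thesis using B by linarith
  qed
  show thesis
  proof (rule that[of u])
    show "(\<Sum>l\<in>S. (u j l)\<^sup>2) \<le> 1 / \<mu>\<^sup>2" if "j \<in> S" for j by (rule u_bound[OF that])
  next
    fix Z \<rho>
    assume \<rho>: "\<And>j. j \<in> S \<Longrightarrow> \<rho> \<le> \<bar>\<beta>s j\<bar>"
      and noise: "\<And>j. j \<in> S \<Longrightarrow> \<bar>\<Sum>i<n. (\<Sum>l\<in>S. x (i, l) * u j l) * Z i\<bar> < \<rho> / 2"
      and bias: "real n * lam * sqrt (real (card S)) / \<mu> \<le> \<rho> / 2"
    obtain v where v: "\<And>k. k \<in> S \<Longrightarrow> (\<Sum>i<n. x (i, k) * T v i) = (\<Sum>i<n. x (i, k) * Z i)"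
      using sol[of "\<lambda>k. \<Sum>i<n. x (i, k) * Z i"] by metis
    have vj: "v j = (\<Sum>i<n. T (u j) i * Z i)" if "j \<in> S" for j
    proof -
      have "v j = (\<Sum>i<n. T v i * T (u j) i)" unfolding adj pick[OF that] ..
      also have "\<dots> = (\<Sum>i<n. T (u j) i * T v i)" by (simp add: mult.commute)
      also have "\<dots> = (\<Sum>i<n. T (u j) i * Z i)" unfolding adj using v by simp
      finally show ?thesis .
    qed
    \<comment> \<open>The noise minus its projection on the support columns, plus the bias
      \<open>T g\<close>. The two parts are orthogonal, so the squared norm is at most that of the
      noise plus that of the bias.\<close>
    define r where "r = (\<lambda>i. Z i - T v i + T g i)"
    have orth: "(\<Sum>i<n. T w i * (Z i - T v i)) = 0" for w
      unfolding adj using v by (simp add: right_diff_distrib sum_subtractf)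
    have r_norm: "(\<Sum>i<n. (r i)\<^sup>2) \<le> (\<Sum>i<n. (Z i)\<^sup>2) + (real n * lam)\<^sup>2 * real (card S) / \<mu>"
    proof -
      have "(r i)\<^sup>2 = (Z i)\<^sup>2 - (T v i)\<^sup>2 + (T g i)\<^sup>2 + 2 * (T g i * (Z i - T v i)) - 2 * (T v i * (Z i - T v i))" for i
        by (simp add: r_def power2_eq_square algebra_simps)
      then have "(\<Sum>i<n. (r i)\<^sup>2) = (\<Sum>i<n. (Z i)\<^sup>2) - (\<Sum>i<n. (T v i)\<^sup>2) + (\<Sum>i<n. (T g i)\<^sup>2)
          + 2 * (\<Sum>i<n. T g i * (Z i - T v i)) - 2 * (\<Sum>i<n. T v i * (Z i - T v i))"
        by (simp add: sum.distrib sum_subtractf sum_distrib_left)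
      also have "\<dots> \<le> (\<Sum>i<n. (Z i)\<^sup>2) + (\<Sum>i<n. (T g i)\<^sup>2)"
        unfolding orth by (simp add: sum_nonneg)
      finally show ?thesis using g_norm by (simp add: nl_def s_def)
    qed
    \<comment> \<open>Noise \<open>v\<close> moves each support coordinate by less than
      \<open>\<rho> / 2\<close> and shrinkage \<open>g\<close> by at most \<open>\<rho> / 2\<close>,
      so no sign can flip.\<close>
    define \<beta> where "\<beta> = (\<lambda>j. if j \<in> S then \<beta>s j + v j - g j else 0)"
    have "recovery n p X \<beta>s Z lam"
      if X: "\<forall>i<n. \<forall>j\<in>S. X (i, j) = x (i, j)"
        and off: "\<forall>j<p. \<beta>s j = 0 \<longrightarrow> \<bar>\<Sum>i<n. X (i, j) * r i\<bar> \<le> real n * lam" for X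
    proof -
      have vec: "is_vec p \<beta>" by (auto simp: is_vec_def \<beta>_def S_def)
      have sg: "sgn (\<beta> j) = sgn (\<beta>s j)" if j: "j < p" for j
      proof (cases "j \<in> S")
        case True
        have "\<bar>v j\<bar> < \<rho> / 2" using noise[OF True] unfolding vj[OF True] T_def .
        moreover have "\<bar>g j\<bar> \<le> \<rho> / 2" using g_coord[OF True] bias unfolding nl_def s_def by linarith
        ultimately have "\<bar>v j - g j\<bar> < \<bar>\<beta>s j\<bar>" using \<rho>[OF True] by linarith
        then show ?thesis using True by (auto simp: \<beta>_def sgn_if abs_if split: if_splits)
      next
        case False
        then show ?thesis using j by (auto simp: \<beta>_def S_def)
      qed
      have res: "(\<Sum>j<p. X (i, j) * (\<beta>s j - \<beta> j)) + Z i = r i" if "i < n" for i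
      proof -
        have "(\<Sum>j<p. X (i, j) * (\<beta>s j - \<beta> j)) = (\<Sum>j\<in>S. x (i, j) * (g j - v j))"
          using X that by (intro sum.mono_neutral_cong_right) (auto simp: S_def \<beta>_def)
        then show ?thesis by (simp add: r_def T_def right_diff_distrib sum_subtractf)
      qed
      have "(\<Sum>i<n. X (i, j) * r i) = real n * lam * sgn (\<beta>s j)" if "j \<in> S" for j
      proof -
        have "(\<Sum>i<n. X (i, j) * r i) = (\<Sum>i<n. x (i, j) * r i)" using X that by simp
        also have "\<dots> = (\<Sum>i<n. x (i, j) * Z i) - (\<Sum>i<n. x (i, j) * T v i) + (\<Sum>i<n. x (i, j) * T g i)"
          by (simp add: r_def sum.distrib sum_subtractf algebra_simps)
        finally show ?thesis using v[OF that] g[OF that] by (simp add: nl_def)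
      qed
      then have "kkt n p X \<beta>s (\<lambda>i. (\<Sum>j<p. X (i, j) * (\<beta>s j - \<beta> j)) + Z i) lam"
        unfolding kkt_def using off res by (auto simp: S_def)
      then show ?thesis unfolding recovery_iff_kkt[OF n lam] using vec sg by blast
    qed
    then show "\<exists>r. (\<Sum>i<n. (r i)\<^sup>2) \<le> (\<Sum>i<n. (Z i)\<^sup>2) + (real n * lam)\<^sup>2 * real (card S) / \<mu> \<and>
            (\<forall>X. (\<forall>i<n. \<forall>j\<in>S. X (i, j) = x (i, j)) \<longrightarrow>
              (\<forall>j<p. \<beta>s j = 0 \<longrightarrow> \<bar>\<Sum>i<n. X (i, j) * r i\<bar> \<le> real n * lam) \<longrightarrow>
              recovery n p X \<beta>s Z lam)"
      using r_norm by blast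
  qed
qed

text \<open>The residual of a recovering solution depends only on the noise and on the columns in the
  support, and testing it against the sign vector bounds its norm from below.\<close>

lemma lasso_failure:
  fixes x :: "nat \<times> nat \<Rightarrow> real" and \<beta>s :: "nat \<Rightarrow> real" and n p :: nat
  assumes n: "n > 0" and lam: "lam > 0" and D: "D > 0"
  defines "S \<equiv> {j. j < p \<and> \<beta>s j \<noteq> 0}"
  assumes up: "(\<Sum>i<n. (\<Sum>j\<in>S. x (i, j) * sgn (\<beta>s j))\<^sup>2) \<le> D"
  obtains r where "(real n * lam * real (card S))\<^sup>2 / D \<le> (\<Sum>i<n. (r i)\<^sup>2)"
    and "\<And>X j. \<lbrakk>\<forall>i<n. \<forall>j\<in>S. X (i, j) = x (i, j); recovery n p X \<beta>s Z lam; j < p; \<beta>s j = 0\<rbrakk>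
           \<Longrightarrow> \<bar>\<Sum>i<n. X (i, j) * r i\<bar> \<le> real n * lam"
proof -
  define T where "T = (\<lambda>v i. \<Sum>j\<in>S. x (i, j) * v j)"
  have adj: "(\<Sum>i<n. T v i * y i) = (\<Sum>k\<in>S. v k * (\<Sum>i<n. x (i, k) * y i))" for v y
    unfolding T_def by (rule sum_adjoint)
  \<comment> \<open>Only the last clause mentions \<open>X\<close>. The first two place
    \<open>r\<close> in \<open>Z\<close> plus the range of \<open>T\<close> and prescribe its
    correlations with the support columns, which already determines it.\<close>
  define P where "P = (\<lambda>X r. (\<exists>v. \<forall>i<n. r i = T v i + Z i) \<and>
      (\<forall>j\<in>S. (\<Sum>i<n. x (i, j) * r i) = real n * lam * sgn (\<beta>s j)) \<and>
      (\<forall>j<p. \<beta>s j = 0 \<longrightarrow> \<bar>\<Sum>i<n. X (i, j) * r i\<bar> \<le> real n * lam))"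
  have ex: "\<exists>r. P X r"
    if X: "\<forall>i<n. \<forall>j\<in>S. X (i, j) = x (i, j)" and rec: "recovery n p X \<beta>s Z lam" for X
  proof -
    from rec obtain \<beta> where \<beta>: "\<forall>j<p. sgn (\<beta> j) = sgn (\<beta>s j)"
      "kkt n p X \<beta>s (\<lambda>i. (\<Sum>j<p. X (i, j) * (\<beta>s j - \<beta> j)) + Z i) lam"
      unfolding recovery_iff_kkt[OF n lam] by blast
    define r where "r = (\<lambda>i. (\<Sum>j<p. X (i, j) * (\<beta>s j - \<beta> j)) + Z i)"
    have off: "\<beta> j = 0" if "j < p" "\<beta>s j = 0" for j using \<beta>(1) that by (metis sgn_0_0)
    have "r i = T (\<lambda>j. \<beta>s j - \<beta> j) i + Z i" if "i < n" for i
    proof -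
      have "(\<Sum>j<p. X (i, j) * (\<beta>s j - \<beta> j)) = (\<Sum>j\<in>S. x (i, j) * (\<beta>s j - \<beta> j))"
        using X that off by (intro sum.mono_neutral_cong_right) (auto simp: S_def)
      then show ?thesis by (simp add: r_def T_def)
    qed
    moreover have "(\<Sum>i<n. x (i, j) * r i) = real n * lam * sgn (\<beta>s j)" if "j \<in> S" for j
    proof -
      have "(\<Sum>i<n. x (i, j) * r i) = (\<Sum>i<n. X (i, j) * r i)" using X that by simp
      then show ?thesis using \<beta>(2) that by (auto simp: kkt_def r_def S_def)
    qed
    moreover have "\<bar>\<Sum>i<n. X (i, j) * r i\<bar> \<le> real n * lam" if "j < p" "\<beta>s j = 0" for j
      using \<beta>(2) that by (auto simp: kkt_def r_def)
    ultimately have "P X r" unfolding P_def by blast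
    then show ?thesis by (intro exI[of _ r])
  qed
  \<comment> \<open>The difference of two such vectors lies in the range of \<open>T\<close> and is
    orthogonal to that range.\<close>
  have unique: "\<forall>i<n. r i = r' i" if "P X r" "P X' r'" for X r X' r'
  proof -
    from that obtain v v' where v: "\<forall>i<n. r i = T v i + Z i" "\<forall>i<n. r' i = T v' i + Z i"
      unfolding P_def by blast
    have "(\<Sum>i<n. (r i - r' i)\<^sup>2) = (\<Sum>i<n. T (\<lambda>j. v j - v' j) i * (r i - r' i))"
      using v by (intro sum.cong) (auto simp: power2_eq_square T_def right_diff_distrib sum_subtractf)
    also have "\<dots> = 0" unfolding adj using that by (simp add: P_def right_diff_distrib sum_subtractf)
    finally show ?thesis by (simp add: sum_nonneg_eq_0_iff)
  qed
  have norm: "(real n * lam * real (card S))\<^sup>2 / D \<le> (\<Sum>i<n. (r i)\<^sup>2)" if "P X r" for X r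
  proof -
    let ?b = "\<lambda>j. sgn (\<beta>s j)"
    \<comment> \<open>The support equations make this inner product exactly
      \<open>n * lam * card S\<close>; Cauchy-Schwarz against the bound \<open>D\<close> then forces
      \<open>r\<close> to be long.\<close>
    have "(\<Sum>i<n. T ?b i * r i) = (\<Sum>k\<in>S. ?b k * (real n * lam * ?b k))"
      unfolding adj using that by (simp add: P_def)
    also have "\<dots> = (\<Sum>k\<in>S. real n * lam)"
      by (intro sum.cong) (auto simp: S_def sgn_if)
    finally have "real n * lam * real (card S) = (\<Sum>i<n. T ?b i * r i)" by simp
    also have "\<dots> \<le> (\<Sum>i<n. \<bar>T ?b i\<bar> * \<bar>r i\<bar>)" by (intro sum_mono) (metis abs_ge_self abs_mult)
    also have "\<dots> \<le> L2_set (T ?b) {..<n} * L2_set r {..<n}" by (rule L2_set_mult_ineq)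
    finally have "(real n * lam * real (card S))\<^sup>2 \<le> (L2_set (T ?b) {..<n} * L2_set r {..<n})\<^sup>2"
      using n lam by (intro power_mono) auto
    also have "\<dots> = (\<Sum>i<n. (T ?b i)\<^sup>2) * (\<Sum>i<n. (r i)\<^sup>2)"
      by (simp add: power_mult_distrib L2_set_def sum_nonneg)
    also have "\<dots> \<le> D * (\<Sum>i<n. (r i)\<^sup>2)"
      using up unfolding T_def by (intro mult_right_mono sum_nonneg) auto
    finally show ?thesis using D by (simp add: field_simps)
  qed
  show thesis
  proof (cases "\<exists>X r. P X r")
    case True
    then obtain X0 r0 where P0: "P X0 r0" by blast
    show thesis
    proof (rule that[of r0])
      show "(real n * lam * real (card S))\<^sup>2 / D \<le> (\<Sum>i<n. (r0 i)\<^sup>2)" by (rule norm[OF P0])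
      fix X j assume X: "\<forall>i<n. \<forall>j\<in>S. X (i, j) = x (i, j)" and rec: "recovery n p X \<beta>s Z lam"
        and j: "j < p" "\<beta>s j = 0"
      obtain r where r: "P X r" using ex[OF X rec] by blast
      then have "\<bar>\<Sum>i<n. X (i, j) * r i\<bar> \<le> real n * lam" using j by (simp add: P_def)
      then show "\<bar>\<Sum>i<n. X (i, j) * r0 i\<bar> \<le> real n * lam" using unique[OF r P0] by simp
    qed
  next
    case False
    \<comment> \<open>If no extension of \<open>x\<close> allows recovery, the second property is
      vacuous, and any vector of the required norm will do.\<close>
    define r where "r = (\<lambda>i::nat. if i = 0 then real n * lam * real (card S) / sqrt D else 0)"
    have "(\<Sum>i<n. (r i)\<^sup>2) = (\<Sum>i<n. if i = 0 then (real n * lam * real (card S))\<^sup>2 / D else 0)"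
      using D by (intro sum.cong) (auto simp: r_def power_divide)
    then show thesis using n False ex by (intro that[of r]) auto
  qed
qed

subsection \<open>Finite-sample bounds\<close>

text \<open>Rewrites the event on the triple product of support columns, other columns and noise,
  keeping the measurability that the monotonicity arguments on sections rely on.\<close>

lemma recovery_prob_split:
  fixes \<beta>s :: "nat \<Rightarrow> real" and n1 n2 p :: nat and \<sigma>1 \<sigma>2 :: real
  assumes n: "n1 + n2 > 0" and lam: "lam > 0"
  defines "n \<equiv> n1 + n2" and "I \<equiv> {..<n1 + n2} \<times> {j. j < p \<and> \<beta>s j \<noteq> 0}"
    and "J \<equiv> {..<n1 + n2} \<times> {j. j < p \<and> \<beta>s j = 0}"
  defines "c \<equiv> \<lambda>i. if i < n1 then \<sigma>1 else \<sigma>2"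
  obtains B where "B \<in> sets (std_gauss_vec I \<Otimes>\<^sub>M (std_gauss_vec J \<Otimes>\<^sub>M std_gauss_vec {..<n}))"
    and "recovery_prob n1 n2 p \<sigma>1 \<sigma>2 \<beta>s lam
      = measure (std_gauss_vec I \<Otimes>\<^sub>M (std_gauss_vec J \<Otimes>\<^sub>M std_gauss_vec {..<n})) B"
    and "\<And>x y W. (x, y, W) \<in> B \<longleftrightarrow> x \<in> space (std_gauss_vec I) \<and> y \<in> space (std_gauss_vec J) \<and>
      W \<in> space (std_gauss_vec {..<n}) \<and> recovery n p (merge I J (x, y)) \<beta>s (\<lambda>i. c i * W i) lam"
proof -
  let ?N = "std_gauss_vec {..<n}"
  let ?M = "std_gauss_vec (I \<union> J) \<Otimes>\<^sub>M ?N"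
  let ?P = "std_gauss_vec I \<Otimes>\<^sub>M (std_gauss_vec J \<Otimes>\<^sub>M ?N)"
  have IJ: "I \<union> J = {..<n} \<times> {..<p}" by (auto simp: I_def J_def n_def)
  have fin: "finite I" "finite J" "I \<inter> J = {}" by (auto simp: I_def J_def)
  define A where "A = {w \<in> space ?M. recovery n p (fst w) \<beta>s (\<lambda>i. c i * snd w i) lam}"
  have A: "A \<in> sets ?M"
    unfolding A_def IJ using n lam by (intro recovery_event_measurable) (auto simp: n_def)
  define f where "f = (\<lambda>(x :: nat \<times> nat \<Rightarrow> real, y, W :: nat \<Rightarrow> real). (merge I J (x, y), W))"
  note mp = measure_merge_pair[OF fin prob_space_std_gauss_vec A, folded f_def]
  have eq: "recovery_prob n1 n2 p \<sigma>1 \<sigma>2 \<beta>s lam = measure ?M A"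
  proof -
    have "{(X, W). recovery n p X \<beta>s (\<lambda>i. (if i < n1 then \<sigma>1 else \<sigma>2) * W i) lam} \<inter> space ?M = A"
      by (auto simp: A_def c_def)
    then show ?thesis
      unfolding recovery_prob_def Let_def n_def[symmetric] IJ by simp
  qed
  show thesis
  proof (rule that[of "f -` A \<inter> space ?P"])
    show "f -` A \<inter> space ?P \<in> sets ?P" by (rule measurable_sets[OF mp(2) A])
    show "recovery_prob n1 n2 p \<sigma>1 \<sigma>2 \<beta>s lam = measure ?P (f -` A \<inter> space ?P)"
      unfolding eq by (rule mp(1))
    fix x y W
    show "(x, y, W) \<in> f -` A \<inter> space ?P \<longleftrightarrow> x \<in> space (std_gauss_vec I) \<and> y \<in> space (std_gauss_vec J) \<and>
      W \<in> space ?N \<and> recovery n p (merge I J (x, y)) \<beta>s (\<lambda>i. c i * W i) lam"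
      using measurable_space[OF mp(2), of "(x, y, W)"]
      by (auto simp: A_def f_def space_pair_measure)
  qed
qed

text \<open>For good support columns and each noise vector, it suffices to cover the recovering
  off-support columns by a measurable set of small probability; bad support columns are paid for in
  full.\<close>

lemma recovery_prob_le:
  fixes \<beta>s :: "nat \<Rightarrow> real" and n1 n2 p :: nat and \<sigma>1 \<sigma>2 :: real
  assumes n: "n1 + n2 > 0" and lam: "lam > 0"
  defines "n \<equiv> n1 + n2" and "I \<equiv> {..<n1 + n2} \<times> {j. j < p \<and> \<beta>s j \<noteq> 0}"
    and "J \<equiv> {..<n1 + n2} \<times> {j. j < p \<and> \<beta>s j = 0}"
  defines "c \<equiv> \<lambda>i. if i < n1 then \<sigma>1 else \<sigma>2"
  assumes G: "G \<in> sets (std_gauss_vec I)" and e: "0 \<le> e"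
    and sec: "\<And>x W. x \<in> G \<Longrightarrow> \<exists>C\<in>sets (std_gauss_vec J). measure (std_gauss_vec J) C \<le> e \<and>
      (\<forall>y\<in>space (std_gauss_vec J). recovery n p (merge I J (x, y)) \<beta>s (\<lambda>i. c i * W i) lam \<longrightarrow> y \<in> C)"
  shows "recovery_prob n1 n2 p \<sigma>1 \<sigma>2 \<beta>s lam
    \<le> e + measure (std_gauss_vec I) (space (std_gauss_vec I) - G)"
proof -
  let ?N = "std_gauss_vec {..<n}"
  note ps = prob_space_std_gauss_vec
  have ps2: "prob_space (std_gauss_vec J \<Otimes>\<^sub>M ?N)" by (intro prob_space_pair ps)
  obtain B where B: "B \<in> sets (std_gauss_vec I \<Otimes>\<^sub>M (std_gauss_vec J \<Otimes>\<^sub>M ?N))"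
    "recovery_prob n1 n2 p \<sigma>1 \<sigma>2 \<beta>s lam
      = measure (std_gauss_vec I \<Otimes>\<^sub>M (std_gauss_vec J \<Otimes>\<^sub>M ?N)) B"
    "\<And>x y W. (x, y, W) \<in> B \<longleftrightarrow> x \<in> space (std_gauss_vec I) \<and> y \<in> space (std_gauss_vec J) \<and>
      W \<in> space ?N \<and> recovery n p (merge I J (x, y)) \<beta>s (\<lambda>i. c i * W i) lam"
    using recovery_prob_split[OF n lam, of p \<beta>s \<sigma>1 \<sigma>2] unfolding n_def I_def J_def c_def by blast
  show ?thesis unfolding B(2)
  proof (rule measure_pair_le[OF ps ps2 B(1) G e])
    fix x assume x: "x \<in> G"
    have E: "Pair x -` B \<in> sets (std_gauss_vec J \<Otimes>\<^sub>M ?N)" by (rule sets_Pair1[OF B(1)])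
    have "measure (std_gauss_vec J \<Otimes>\<^sub>M ?N) (Pair x -` B)
        = measure (?N \<Otimes>\<^sub>M std_gauss_vec J)
            ((\<lambda>(W, y). (y, W)) -` (Pair x -` B) \<inter> space (?N \<Otimes>\<^sub>M std_gauss_vec J))"
      by (rule measure_pair_swap[OF ps ps E])
    also have "\<dots> \<le> e + measure ?N (space ?N - space ?N)"
    proof (rule measure_pair_le[OF ps ps _ _ e])
      show "(\<lambda>(W, y). (y, W)) -` (Pair x -` B) \<inter> space (?N \<Otimes>\<^sub>M std_gauss_vec J) \<in> sets (?N \<Otimes>\<^sub>M std_gauss_vec J)"
        using measurable_pair_swap' E by (rule measurable_sets)
      fix W
      obtain C where C: "C \<in> sets (std_gauss_vec J)" "measure (std_gauss_vec J) C \<le> e"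
        "\<forall>y\<in>space (std_gauss_vec J). recovery n p (merge I J (x, y)) \<beta>s (\<lambda>i. c i * W i) lam \<longrightarrow> y \<in> C"
        using sec[OF x] by blast
      interpret J: prob_space "std_gauss_vec J" by (rule ps)
      have "measure (std_gauss_vec J) (Pair W -` ((\<lambda>(W, y). (y, W)) -` (Pair x -` B) \<inter> space (?N \<Otimes>\<^sub>M std_gauss_vec J)))
          \<le> measure (std_gauss_vec J) C"
        using C(1,3) B(3) by (intro J.finite_measure_mono) auto
      then show "measure (std_gauss_vec J) (Pair W -` ((\<lambda>(W, y). (y, W)) -` (Pair x -` B) \<inter> space (?N \<Otimes>\<^sub>M std_gauss_vec J))) \<le> e"
        using C(2) by linarith
    qed auto
    finally show "measure (std_gauss_vec J \<Otimes>\<^sub>M ?N) (Pair x -` B) \<le> e" by simp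
  qed
qed

text \<open>Nested conditioning: good support columns, then good noise depending on them, then good
  remaining columns depending on both; the three lower bounds multiply.\<close>

lemma recovery_prob_ge:
  fixes \<beta>s :: "nat \<Rightarrow> real" and n1 n2 p :: nat and \<sigma>1 \<sigma>2 :: real
  assumes n: "n1 + n2 > 0" and lam: "lam > 0"
  defines "n \<equiv> n1 + n2" and "I \<equiv> {..<n1 + n2} \<times> {j. j < p \<and> \<beta>s j \<noteq> 0}"
    and "J \<equiv> {..<n1 + n2} \<times> {j. j < p \<and> \<beta>s j = 0}"
  defines "c \<equiv> \<lambda>i. if i < n1 then \<sigma>1 else \<sigma>2"
  assumes G: "G \<in> sets (std_gauss_vec I)" and e: "0 \<le> e2" "0 \<le> e3"
    and sec: "\<And>x. x \<in> G \<Longrightarrow> \<exists>H\<in>sets (std_gauss_vec {..<n}). e2 \<le> measure (std_gauss_vec {..<n}) H \<and>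
      (\<forall>W\<in>H. \<exists>C\<in>sets (std_gauss_vec J). e3 \<le> measure (std_gauss_vec J) C \<and>
        (\<forall>y\<in>C. recovery n p (merge I J (x, y)) \<beta>s (\<lambda>i. c i * W i) lam))"
  shows "e3 * e2 * measure (std_gauss_vec I) G \<le> recovery_prob n1 n2 p \<sigma>1 \<sigma>2 \<beta>s lam"
proof -
  let ?N = "std_gauss_vec {..<n}"
  note ps = prob_space_std_gauss_vec
  have ps2: "prob_space (std_gauss_vec J \<Otimes>\<^sub>M ?N)" by (intro prob_space_pair ps)
  obtain B where B: "B \<in> sets (std_gauss_vec I \<Otimes>\<^sub>M (std_gauss_vec J \<Otimes>\<^sub>M ?N))"
    "recovery_prob n1 n2 p \<sigma>1 \<sigma>2 \<beta>s lam
      = measure (std_gauss_vec I \<Otimes>\<^sub>M (std_gauss_vec J \<Otimes>\<^sub>M ?N)) B"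
    "\<And>x y W. (x, y, W) \<in> B \<longleftrightarrow> x \<in> space (std_gauss_vec I) \<and> y \<in> space (std_gauss_vec J) \<and>
      W \<in> space ?N \<and> recovery n p (merge I J (x, y)) \<beta>s (\<lambda>i. c i * W i) lam"
    using recovery_prob_split[OF n lam, of p \<beta>s \<sigma>1 \<sigma>2] unfolding n_def I_def J_def c_def by blast
  have e0: "0 \<le> e3 * e2" using e by simp
  show ?thesis unfolding B(2)
  proof (rule measure_pair_ge[OF ps ps2 B(1) G e0])
    fix x assume x: "x \<in> G"
    then have xs: "x \<in> space (std_gauss_vec I)" using sets.sets_into_space[OF G] by auto
    obtain H where H: "H \<in> sets ?N" "e2 \<le> measure ?N H"
      "\<And>W. W \<in> H \<Longrightarrow> \<exists>C\<in>sets (std_gauss_vec J). e3 \<le> measure (std_gauss_vec J) C \<and>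
        (\<forall>y\<in>C. recovery n p (merge I J (x, y)) \<beta>s (\<lambda>i. c i * W i) lam)"
      using sec[OF x] by blast
    have E: "Pair x -` B \<in> sets (std_gauss_vec J \<Otimes>\<^sub>M ?N)" by (rule sets_Pair1[OF B(1)])
    let ?B' = "(\<lambda>(W, y). (y, W)) -` (Pair x -` B) \<inter> space (?N \<Otimes>\<^sub>M std_gauss_vec J)"
    have E': "?B' \<in> sets (?N \<Otimes>\<^sub>M std_gauss_vec J)"
      using measurable_pair_swap' E by (rule measurable_sets)
    have "e3 * e2 \<le> e3 * measure ?N H" using e H(2) by (intro mult_left_mono)
    also have "\<dots> \<le> measure (?N \<Otimes>\<^sub>M std_gauss_vec J) ?B'"
    proof (rule measure_pair_ge[OF ps ps E' H(1) e(2)])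
      fix W assume W: "W \<in> H"
      then have Ws: "W \<in> space ?N" using sets.sets_into_space[OF H(1)] by auto
      obtain C where C: "C \<in> sets (std_gauss_vec J)" "e3 \<le> measure (std_gauss_vec J) C"
        "\<And>y. y \<in> C \<Longrightarrow> recovery n p (merge I J (x, y)) \<beta>s (\<lambda>i. c i * W i) lam"
        using H(3)[OF W] by blast
      interpret J: prob_space "std_gauss_vec J" by (rule ps)
      have "measure (std_gauss_vec J) C \<le> measure (std_gauss_vec J) (Pair W -` ?B')"
        using C sets.sets_into_space[OF C(1)] B(3) xs Ws sets_Pair1[OF E', of W]
        by (intro J.finite_measure_mono) (auto simp: space_pair_measure)
      then show "e3 \<le> measure (std_gauss_vec J) (Pair W -` ?B')" using C(2) by linarith
    qed
    also have "\<dots> = measure (std_gauss_vec J \<Otimes>\<^sub>M ?N) (Pair x -` B)"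
      by (rule measure_pair_swap[OF ps ps E, symmetric])
    finally show "e3 * e2 \<le> measure (std_gauss_vec J \<Otimes>\<^sub>M ?N) (Pair x -` B)" .
  qed
qed

lemma sum_column:
  fixes h :: "'a \<times> 'b \<Rightarrow> real"
  shows "(\<Sum>z\<in>R \<times> {j}. h z) = (\<Sum>i\<in>R. h (i, j))"
  using sum.cartesian_product[of "\<lambda>i j. h (i, j)" "{j}" R] by simp

text \<open>For fixed \<open>r\<close> the correlations with different columns are independent, so
  the one-column bound is raised to the power \<open>card T\<close>.\<close>

lemma prob_columns_le:
  fixes r :: "'a \<Rightarrow> real" and T :: "'b set"
  assumes R: "finite R" and T: "finite T" and V: "V > 0" "V \<le> (\<Sum>i\<in>R. (r i)\<^sup>2)" and b: "b \<ge> 0"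
  defines "C \<equiv> {y \<in> space (std_gauss_vec (R \<times> T)). \<forall>j\<in>T. \<bar>\<Sum>i\<in>R. y (i, j) * r i\<bar> \<le> b}"
  shows "C \<in> sets (std_gauss_vec (R \<times> T))"
    and "measure (std_gauss_vec (R \<times> T)) C
      \<le> (1 - exp (- (b / sqrt V + 1)\<^sup>2 / 2) / sqrt (2 * pi)) ^ card T"
proof -
  let ?M = "std_gauss_vec (R \<times> T)"
  interpret prob_space ?M by (rule prob_space_std_gauss_vec)
  define l where "l = (\<lambda>(j :: 'b) y. \<Sum>z\<in>R \<times> {j}. r (fst z) * y z)"
  have l: "l j y = (\<Sum>i\<in>R. y (i, j) * r i)" for j y
    unfolding l_def sum_column by (simp add: mult.commute)
  have K: "\<And>j. j \<in> T \<Longrightarrow> R \<times> {j} \<subseteq> R \<times> T" by auto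
  have lm: "l j \<in> borel_measurable ?M" if "j \<in> T" for j
    unfolding l_def by (rule std_gauss_vec_linear_measurable[OF K[OF that]])
  have ev: "{y \<in> space ?M. \<bar>l j y\<bar> \<le> b} \<in> events" if "j \<in> T" for j
    using lm[OF that] by measurable
  have "C = space ?M \<inter> (\<Inter>j\<in>T. {y \<in> space ?M. \<bar>l j y\<bar> \<le> b})"
    by (auto simp: C_def l)
  also have "\<dots> \<in> events"
    using ev T by (cases "T = {}") (auto intro!: sets.Int sets.finite_INT)
  finally show "C \<in> events" .
  show "prob C \<le> (1 - exp (- (b / sqrt V + 1)\<^sup>2 / 2) / sqrt (2 * pi)) ^ card T"
  proof (cases "T = {}")
    case False
    have dis: "disjoint_family_on (\<lambda>j. R \<times> {j}) T" by (auto simp: disjoint_family_on_def)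
    have ind: "indep_vars (\<lambda>_. borel) l T"
      unfolding l_def by (rule indep_vars_linear_std_gauss_vec[OF K dis])
    have "C = (\<Inter>j\<in>T. l j -` {- b..b} \<inter> space ?M)"
      using False by (auto simp: C_def l abs_le_iff)
    then have "prob C = (\<Prod>j\<in>T. prob (l j -` {- b..b} \<inter> space ?M))"
      using indep_varsD_finite[OF ind False T, of "\<lambda>_. {- b..b}"] by simp
    also have "\<dots> \<le> (\<Prod>j\<in>T. 1 - exp (- (b / sqrt V + 1)\<^sup>2 / 2) / sqrt (2 * pi))"
    proof (rule prod_mono, intro conjI)
      fix j assume j: "j \<in> T"
      have "l j -` {- b..b} \<inter> space ?M = {y \<in> space ?M. \<bar>\<Sum>z\<in>R \<times> {j}. r (fst z) * y z\<bar> \<le> b}"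
        by (auto simp: l_def abs_le_iff)
      moreover have "(\<Sum>z\<in>R \<times> {j}. (r (fst z))\<^sup>2) = (\<Sum>i\<in>R. (r i)\<^sup>2)" unfolding sum_column by simp
      ultimately show "prob (l j -` {- b..b} \<inter> space ?M) \<le> 1 - exp (- (b / sqrt V + 1)\<^sup>2 / 2) / sqrt (2 * pi)"
        using prob_linear_le_le[OF K[OF j], of V "\<lambda>z. r (fst z)" b] V b R by simp
    qed simp
    finally show ?thesis by simp
  qed (use prob_le_1[of C] in simp)
qed

text \<open>With \<open>D = (1 + \<eta>) * s * n\<close>, the ratio of the constraint level
  \<open>n * lam\<close> to the norm of the residual is at most
  \<open>sqrt ((1 + \<eta>) * n / s)\<close>: both \<open>lam\<close> and the noise level have
  cancelled. The last summand is the chance that the sign combination of the support columns is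
  longer than \<open>D\<close> permits.\<close>

lemma recovery_prob_upper_bound:
  fixes \<beta>s :: "nat \<Rightarrow> real" and n1 n2 p :: nat and \<sigma>1 \<sigma>2 :: real
  assumes n: "n1 + n2 > 0" and lam: "lam > 0" and \<eta>: "0 < \<eta>" "\<eta> \<le> 1"
  defines "n \<equiv> n1 + n2"
  assumes s: "card {j. j < p \<and> \<beta>s j \<noteq> 0} = s" "s > 0"
  shows "recovery_prob n1 n2 p \<sigma>1 \<sigma>2 \<beta>s lam
    \<le> (1 - exp (- (sqrt ((1 + \<eta>) * real n / real s) + 1)\<^sup>2 / 2) / sqrt (2 * pi)) ^ (p - s)
      + exp (- \<eta>\<^sup>2 * real n / 16)"
proof -
  define S where "S = {j. j < p \<and> \<beta>s j \<noteq> 0}"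
  define T where "T = {j. j < p \<and> \<beta>s j = 0}"
  let ?I = "{..<n} \<times> S"
  let ?J = "{..<n} \<times> T"
  define c where "c = (\<lambda>i. if i < n1 then \<sigma>1 else \<sigma>2)"
  have S: "finite S" "card S = s" using s by (auto simp: S_def)
  have T: "finite T" "card T = p - s"
  proof -
    show "finite T" by (simp add: T_def)
    have "T = {..<p} - S" by (auto simp: T_def S_def)
    moreover have "S \<subseteq> {..<p}" by (auto simp: S_def)
    ultimately show "card T = p - s" using S by (simp add: card_Diff_subset)
  qed
  interpret I: prob_space "std_gauss_vec ?I" by (rule prob_space_std_gauss_vec)
  define D where "D = (1 + \<eta>) * real s * real n"
  have n0: "n > 0" using n by (simp add: n_def)
  have D: "D > 0" using \<eta> s n0 by (simp add: D_def)
  have sgn1: "(\<Sum>j\<in>S. (sgn (\<beta>s j))\<^sup>2) = real s"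
  proof -
    have "(\<Sum>j\<in>S. (sgn (\<beta>s j))\<^sup>2) = (\<Sum>j\<in>S. 1)" by (intro sum.cong) (auto simp: S_def sgn_if)
    then show ?thesis using S by simp
  qed
  define q where "q = (\<lambda>x :: nat \<times> nat \<Rightarrow> real. \<Sum>i<n. (\<Sum>j\<in>S. x (i, j) * sgn (\<beta>s j))\<^sup>2)"
  have q: "q \<in> borel_measurable (std_gauss_vec ?I)"
    "I.prob {x \<in> space (std_gauss_vec ?I). D \<le> q x} \<le> exp (- \<eta>\<^sup>2 * real n / 16)"
    using matrix_chi_square_tails(1,2)[of "{..<n}" S ?I "\<lambda>j. sgn (\<beta>s j)" \<eta>] S(1) \<eta> s
    unfolding q_def sgn1 D_def by auto
  define G where "G = {x \<in> space (std_gauss_vec ?I). q x < D}"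
  have G: "G \<in> sets (std_gauss_vec ?I)" unfolding G_def using q(1) by measurable
  define b where "b = real n * lam"
  have b: "b > 0" using n0 lam by (simp add: b_def)
  define V where "V = (b * real s)\<^sup>2 / D"
  have V: "V > 0" using b D s by (simp add: V_def)
  have bV: "b / sqrt V = sqrt ((1 + \<eta>) * real n / real s)"
  proof -
    have "b / sqrt V = sqrt (b\<^sup>2 / V)" using b by (simp add: real_sqrt_divide)
    also have "b\<^sup>2 / V = (1 + \<eta>) * real n / real s"
      using b D s by (simp add: V_def D_def field_simps power2_eq_square)
    finally show ?thesis .
  qed
  let ?e = "(1 - exp (- (sqrt ((1 + \<eta>) * real n / real s) + 1)\<^sup>2 / 2) / sqrt (2 * pi)) ^ (p - s)"
  have e0: "0 \<le> ?e"
  proof (rule zero_le_power)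
    have "exp (- (sqrt ((1 + \<eta>) * real n / real s) + 1)\<^sup>2 / 2) \<le> 1" by simp
    also have "1 \<le> sqrt (2 * pi)" using pi_ge_two by simp
    finally show "0 \<le> 1 - exp (- (sqrt ((1 + \<eta>) * real n / real s) + 1)\<^sup>2 / 2) / sqrt (2 * pi)"
      by (simp add: divide_le_eq)
  qed
  have sec: "\<exists>C\<in>sets (std_gauss_vec ?J). measure (std_gauss_vec ?J) C \<le> ?e \<and>
      (\<forall>y\<in>space (std_gauss_vec ?J). recovery n p (merge ?I ?J (x, y)) \<beta>s (\<lambda>i. c i * W i) lam \<longrightarrow> y \<in> C)"
    if x: "x \<in> G" for x W
  proof -
    have "q x \<le> D" using x by (simp add: G_def)
    then have up: "(\<Sum>i<n. (\<Sum>j\<in>{j. j < p \<and> \<beta>s j \<noteq> 0}. x (i, j) * sgn (\<beta>s j))\<^sup>2) \<le> D"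
      by (simp add: q_def S_def)
    obtain r where r: "(real n * lam * real (card S))\<^sup>2 / D \<le> (\<Sum>i<n. (r i)\<^sup>2)"
      "\<And>X j. \<lbrakk>\<forall>i<n. \<forall>j\<in>S. X (i, j) = x (i, j); recovery n p X \<beta>s (\<lambda>i. c i * W i) lam; j < p; \<beta>s j = 0\<rbrakk>
           \<Longrightarrow> \<bar>\<Sum>i<n. X (i, j) * r i\<bar> \<le> real n * lam"
      using lasso_failure[OF n0 lam D up, of "\<lambda>i. c i * W i"] unfolding S_def by blast
    let ?C = "{y \<in> space (std_gauss_vec ?J). \<forall>j\<in>T. \<bar>\<Sum>i<n. y (i, j) * r i\<bar> \<le> b}"
    have Vr: "V \<le> (\<Sum>i<n. (r i)\<^sup>2)" using r(1) S by (simp add: V_def b_def)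
    note cols = prob_columns_le[OF finite_lessThan T(1) V Vr, of b]
    have "y \<in> ?C" if y: "y \<in> space (std_gauss_vec ?J)"
      and rec: "recovery n p (merge ?I ?J (x, y)) \<beta>s (\<lambda>i. c i * W i) lam" for y
    proof -
      have "\<bar>\<Sum>i<n. y (i, j) * r i\<bar> \<le> b" if j: "j \<in> T" for j
      proof -
        have "\<bar>\<Sum>i<n. merge ?I ?J (x, y) (i, j) * r i\<bar> \<le> real n * lam"
          using j by (intro r(2)[OF _ rec]) (auto simp: merge_def T_def)
        moreover have "merge ?I ?J (x, y) (i, j) = y (i, j)" if "i < n" for i
          using that j by (auto simp: merge_def T_def S_def)
        ultimately show ?thesis by (simp add: b_def)
      qed
      then show ?thesis using y by simp
    qed
    then show ?thesis using cols b unfolding bV T(2) by (intro bexI[of _ ?C]) auto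
  qed
  have "recovery_prob n1 n2 p \<sigma>1 \<sigma>2 \<beta>s lam \<le> ?e + I.prob (space (std_gauss_vec ?I) - G)"
    using recovery_prob_le[OF n lam, of G p \<beta>s ?e \<sigma>1 \<sigma>2] G e0 sec
    unfolding S_def T_def n_def c_def by blast
  also have "space (std_gauss_vec ?I) - G = {x \<in> space (std_gauss_vec ?I). D \<le> q x}"
    by (auto simp: G_def)
  finally show ?thesis using q(2) by linarith
qed

lemma (in prob_space) prob_avoid_ge:
  assumes "finite L" and "\<And>k. k \<in> L \<Longrightarrow> E k \<in> events" and "\<And>k. k \<in> L \<Longrightarrow> prob (E k) \<le> e"
  shows "1 - real (card L) * e \<le> prob (space M - (\<Union>k\<in>L. E k))"
proof -
  have "prob (\<Union>k\<in>L. E k) \<le> (\<Sum>k\<in>L. prob (E k))"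
    using assms by (intro finite_measure_subadditive_finite) auto
  also have "\<dots> \<le> (\<Sum>k\<in>L. e)" using assms by (intro sum_mono) auto
  finally have "prob (\<Union>k\<in>L. E k) \<le> real (card L) * e" by simp
  moreover have "prob (space M - (\<Union>k\<in>L. E k)) = 1 - prob (\<Union>k\<in>L. E k)"
    using assms by (intro prob_compl sets.finite_UN) auto
  ultimately show ?thesis by linarith
qed

text \<open>The three losses follow the order of conditioning: \<open>b1\<close> is failure of the
  singular value bounds in one of the row blocks, \<open>b2\<close> an atypically large noise block
  or fitted noise coordinate, \<open>b3\<close> a violated off-support constraint.\<close>

lemma recovery_prob_lower_bound:
  fixes \<beta>s :: "nat \<Rightarrow> real" and n1 n2 p s :: nat and \<sigma>1 \<sigma>2 \<rho> \<eta> \<theta> :: real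
  assumes n1: "n1 > 0" and n2: "n2 > 0" and lam: "lam > 0"
    and \<sigma>: "\<sigma>1 \<noteq> 0" and \<eta>: "0 < \<eta>" "\<eta> \<le> 1 / 16" and \<theta>: "0 < \<theta>" "\<theta> < 1" and \<rho>0: "\<rho> > 0"
  assumes s: "card {j. j < p \<and> \<beta>s j \<noteq> 0} = s" "s > 0"
    and \<rho>: "\<And>j. j < p \<Longrightarrow> \<beta>s j \<noteq> 0 \<Longrightarrow> \<rho> \<le> \<bar>\<beta>s j\<bar>"
  defines "n \<equiv> n1 + n2" and "\<mu> \<equiv> (1 - 8 * \<eta>) * real (n1 + n2)"
    and "\<Sigma> \<equiv> real n1 * \<sigma>1\<^sup>2 + real n2 * \<sigma>2\<^sup>2"
  assumes bias: "real n * lam * sqrt (real s) / \<mu> \<le> \<rho> / 2"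
  defines "b1 \<equiv> 2 * (3 * exp (1 / \<eta>\<^sup>2)) ^ s * exp (- \<eta>\<^sup>2 * real n1 / 16)
        + 2 * (3 * exp (1 / \<eta>\<^sup>2)) ^ s * exp (- \<eta>\<^sup>2 * real n2 / 16)"
    and "b2 \<equiv> exp (- real n1 / 16) + exp (- real n2 / 16)
        + real s * (exp (- (1 / 2) * (\<rho> / 2)\<^sup>2 / (2 * (4 * \<Sigma> / \<mu>\<^sup>2))) / sqrt (1 / 2))"
    and "b3 \<equiv> real (p - s) * (exp (- \<theta> * (real n * lam)\<^sup>2 / (2 * (2 * \<Sigma> + (real n * lam)\<^sup>2 * real s / \<mu>)))
        / sqrt (1 - \<theta>))"
  assumes b: "b2 \<le> 1" "b3 \<le> 1"
  shows "(1 - b3) * (1 - b2) * (1 - b1) \<le> recovery_prob n1 n2 p \<sigma>1 \<sigma>2 \<beta>s lam"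
proof -
  define S where "S = {j. j < p \<and> \<beta>s j \<noteq> 0}"
  define T where "T = {j. j < p \<and> \<beta>s j = 0}"
  let ?I = "{..<n} \<times> S"
  let ?J = "{..<n} \<times> T"
  let ?N = "std_gauss_vec {..<n}"
  define c where "c = (\<lambda>i. if i < n1 then \<sigma>1 else \<sigma>2)"
  have S: "finite S" "card S = s" "S \<noteq> {}" using s unfolding S_def by (simp, simp, force)
  have T: "finite T" "card T = p - s"
  proof -
    show "finite T" by (simp add: T_def)
    have "T = {..<p} - S" by (auto simp: T_def S_def)
    moreover have "S \<subseteq> {..<p}" by (auto simp: S_def)
    ultimately show "card T = p - s" using S by (simp add: card_Diff_subset)
  qed
  have n0: "n > 0" using n1 by (simp add: n_def)
  have \<mu>: "\<mu> > 0" using \<eta> n1 by (simp add: \<mu>_def)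
  have \<Sigma>: "\<Sigma> > 0" unfolding \<Sigma>_def using n1 \<sigma> by (intro add_pos_nonneg) auto
  define nl where "nl = real n * lam"
  have nl: "nl > 0" using n0 lam by (simp add: nl_def)
  interpret I: prob_space "std_gauss_vec ?I" by (rule prob_space_std_gauss_vec)
  interpret N: prob_space ?N by (rule prob_space_std_gauss_vec)
  interpret J: prob_space "std_gauss_vec ?J" by (rule prob_space_std_gauss_vec)
  have split_sum: "(\<Sum>i<n. h i) = (\<Sum>i<n1. h i) + (\<Sum>i\<in>{n1..<n}. h i)" for h :: "nat \<Rightarrow> real"
  proof -
    have "{..<n} = {..<n1} \<union> {n1..<n}" by (auto simp: n_def)
    then show ?thesis by (simp add: sum.union_disjoint ivl_disj_int)
  qed
  have \<eta>4: "\<eta> \<le> 1 / 4" using \<eta> by simp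
  have R1: "{..<n1} \<times> S \<subseteq> ?I" and R2: "{n1..<n} \<times> S \<subseteq> ?I" by (auto simp: n_def)
  obtain G1 where G1: "G1 \<in> sets (std_gauss_vec ?I)"
    "I.prob (space (std_gauss_vec ?I) - G1) \<le> 2 * (3 * exp (1 / \<eta>\<^sup>2)) ^ card S * exp (- \<eta>\<^sup>2 * real (card {..<n1}) / 16)"
    "\<And>x v. x \<in> G1 \<Longrightarrow> (1 - 8 * \<eta>) * real (card {..<n1}) * (\<Sum>j\<in>S. (v j)\<^sup>2) \<le> (\<Sum>i<n1. (\<Sum>j\<in>S. x (i, j) * v j)\<^sup>2)"
    "\<And>x v. x \<in> G1 \<Longrightarrow> (\<Sum>i<n1. (\<Sum>j\<in>S. x (i, j) * v j)\<^sup>2) \<le> 4 * real (card {..<n1}) * (\<Sum>j\<in>S. (v j)\<^sup>2)"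
    using gauss_matrix_singular_values[OF finite_lessThan S(1,3) R1 \<eta>(1) \<eta>4] by blast
  obtain G2 where G2: "G2 \<in> sets (std_gauss_vec ?I)"
    "I.prob (space (std_gauss_vec ?I) - G2) \<le> 2 * (3 * exp (1 / \<eta>\<^sup>2)) ^ card S * exp (- \<eta>\<^sup>2 * real (card {n1..<n}) / 16)"
    "\<And>x v. x \<in> G2 \<Longrightarrow> (1 - 8 * \<eta>) * real (card {n1..<n}) * (\<Sum>j\<in>S. (v j)\<^sup>2) \<le> (\<Sum>i\<in>{n1..<n}. (\<Sum>j\<in>S. x (i, j) * v j)\<^sup>2)"
    "\<And>x v. x \<in> G2 \<Longrightarrow> (\<Sum>i\<in>{n1..<n}. (\<Sum>j\<in>S. x (i, j) * v j)\<^sup>2) \<le> 4 * real (card {n1..<n}) * (\<Sum>j\<in>S. (v j)\<^sup>2)"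
    using gauss_matrix_singular_values[OF finite_atLeastLessThan S(1,3) R2 \<eta>(1) \<eta>4] by blast
  have cards: "card {..<n1} = n1" "card {n1..<n} = n2" by (auto simp: n_def)
  define G where "G = G1 \<inter> G2"
  have G: "G \<in> sets (std_gauss_vec ?I)" using G1 G2 by (auto simp: G_def)
  have PG: "1 - b1 \<le> I.prob G"
  proof -
    have "I.prob (space (std_gauss_vec ?I) - G)
        \<le> I.prob (space (std_gauss_vec ?I) - G1) + I.prob (space (std_gauss_vec ?I) - G2)"
      unfolding G_def Diff_Int using G1 G2 by (intro measure_Un_le) auto
    then have "I.prob (space (std_gauss_vec ?I) - G) \<le> b1"
      using G1(2) G2(2) unfolding cards S(2) b1_def by linarith
    then show ?thesis using I.prob_compl[OF G] by linarith
  qed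
  have sec: "\<exists>H\<in>sets ?N. 1 - b2 \<le> N.prob H \<and>
      (\<forall>W\<in>H. \<exists>C\<in>sets (std_gauss_vec ?J). 1 - b3 \<le> J.prob C \<and>
        (\<forall>y\<in>C. recovery n p (merge ?I ?J (x, y)) \<beta>s (\<lambda>i. c i * W i) lam))"
    if x: "x \<in> G" for x
  proof -
    have low: "\<mu> * (\<Sum>j\<in>S. (v j)\<^sup>2) \<le> (\<Sum>i<n. (\<Sum>j\<in>S. x (i, j) * v j)\<^sup>2)" for v
      using G1(3)[of x v] G2(3)[of x v] x unfolding cards split_sum \<mu>_def G_def
      by (auto simp: algebra_simps)
    obtain u where u: "\<And>j. j \<in> S \<Longrightarrow> (\<Sum>l\<in>S. (u j l)\<^sup>2) \<le> 1 / \<mu>\<^sup>2"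
      "\<And>Z \<rho>. \<lbrakk>\<And>j. j \<in> S \<Longrightarrow> \<rho> \<le> \<bar>\<beta>s j\<bar>;
          \<And>j. j \<in> S \<Longrightarrow> \<bar>\<Sum>i<n. (\<Sum>l\<in>S. x (i, l) * u j l) * Z i\<bar> < \<rho> / 2;
          real n * lam * sqrt (real (card S)) / \<mu> \<le> \<rho> / 2\<rbrakk> \<Longrightarrow>
          \<exists>r. (\<Sum>i<n. (r i)\<^sup>2) \<le> (\<Sum>i<n. (Z i)\<^sup>2) + (real n * lam)\<^sup>2 * real (card S) / \<mu> \<and>
            (\<forall>X. (\<forall>i<n. \<forall>j\<in>S. X (i, j) = x (i, j)) \<longrightarrow>
              (\<forall>j<p. \<beta>s j = 0 \<longrightarrow> \<bar>\<Sum>i<n. X (i, j) * r i\<bar> \<le> real n * lam) \<longrightarrow>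
              recovery n p X \<beta>s Z lam)"
      using lasso_success[OF n0 lam \<mu>, of p \<beta>s x, folded S_def, OF low] by blast
    define a where "a = (\<lambda>j i. (\<Sum>l\<in>S. x (i, l) * u j l) * c i)"
    \<comment> \<open>Bounding each block by its own row count weights \<open>\<sigma>1^2\<close> by
      \<open>n1\<close> and \<open>\<sigma>2^2\<close> by \<open>n2\<close>, which yields
      \<open>\<Sigma>\<close>; a bound on the full matrix would only give
      \<open>n * \<sigma>2^2\<close>.\<close>
    have var: "(\<Sum>i<n. (a j i)\<^sup>2) \<le> 4 * \<Sigma> / \<mu>\<^sup>2" if j: "j \<in> S" for j
    proof -
      let ?U = "\<Sum>l\<in>S. (u j l)\<^sup>2"
      let ?t = "\<lambda>i. (\<Sum>l\<in>S. x (i, l) * u j l)\<^sup>2"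
      have "(\<Sum>i<n. (a j i)\<^sup>2) = (\<Sum>i<n1. \<sigma>1\<^sup>2 * ?t i) + (\<Sum>i\<in>{n1..<n}. \<sigma>2\<^sup>2 * ?t i)"
        unfolding split_sum by (intro arg_cong2[where f = "(+)"] sum.cong) (auto simp: a_def c_def power_mult_distrib)
      also have "\<dots> = \<sigma>1\<^sup>2 * (\<Sum>i<n1. ?t i) + \<sigma>2\<^sup>2 * (\<Sum>i\<in>{n1..<n}. ?t i)"
        by (simp add: sum_distrib_left)
      also have "\<dots> \<le> \<sigma>1\<^sup>2 * (4 * real n1 * ?U) + \<sigma>2\<^sup>2 * (4 * real n2 * ?U)"
        using G1(4)[of x "u j"] G2(4)[of x "u j"] x unfolding cards G_def
        by (intro add_mono mult_left_mono) auto
      also have "\<dots> = 4 * \<Sigma> * ?U" by (simp add: \<Sigma>_def algebra_simps)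
      also have "\<dots> \<le> 4 * \<Sigma> * (1 / \<mu>\<^sup>2)" using u(1)[OF j] \<Sigma> by (intro mult_left_mono) auto
      finally show ?thesis by simp
    qed
    define Q where "Q = (\<lambda>R (W :: nat \<Rightarrow> real). \<Sum>i\<in>R. (W i)\<^sup>2)"
    have chi: "Q R \<in> borel_measurable ?N" "N.prob {W \<in> space ?N. 2 * real (card R) \<le> Q R W} \<le> exp (- real (card R) / 16)"
      if R: "R \<subseteq> {..<n}" for R
    proof -
      have fin: "finite R" using R finite_subset by blast
      have K: "\<And>i. i \<in> R \<Longrightarrow> {i} \<subseteq> {..<n}" "\<And>i. i \<in> R \<Longrightarrow> finite {i}" "disjoint_family_on (\<lambda>i. {i}) R"
        using R by (auto simp: disjoint_family_on_def)
      show "Q R \<in> borel_measurable ?N" "N.prob {W \<in> space ?N. 2 * real (card R) \<le> Q R W} \<le> exp (- real (card R) / 16)"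
        \<comment> \<open>Unit coefficients and \<open>\<eta> = 1\<close>: each noise block has
          squared norm below twice its size, which accounts for the factor 2 in
          \<open>2 * \<Sigma>\<close>.\<close>
        using chi_square_tails(1,2)[OF fin K, where a = "\<lambda>_ _. 1" and A = 1 and \<eta> = 1] by (auto simp: Q_def)
    qed
    define l where "l = (\<lambda>j (W :: nat \<Rightarrow> real). \<Sum>i<n. a j i * W i)"
    have lm: "l j \<in> borel_measurable ?N" for j unfolding l_def by (rule std_gauss_vec_linear_measurable) simp
    define E1 where "E1 = {W \<in> space ?N. 2 * real n1 \<le> Q {..<n1} W}"
    define E2 where "E2 = {W \<in> space ?N. 2 * real n2 \<le> Q {n1..<n} W}"
    define E3 where "E3 = (\<lambda>j. {W \<in> space ?N. \<rho> / 2 \<le> \<bar>l j W\<bar>})"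
    define H where "H = (space ?N - (\<Union>j\<in>S. E3 j)) - (E1 \<union> E2)"
    have sub: "{..<n1} \<subseteq> {..<n}" "{n1..<n} \<subseteq> {..<n}" by (auto simp: n_def)
    have E: "E1 \<in> N.events" "E2 \<in> N.events" "\<And>j. E3 j \<in> N.events"
    proof -
      note [measurable] = chi(1)[OF sub(1)] chi(1)[OF sub(2)] lm
      show "E1 \<in> N.events" "E2 \<in> N.events" "\<And>j. E3 j \<in> N.events"
        unfolding E1_def E2_def E3_def by measurable
    qed
    have PE1: "N.prob E1 \<le> exp (- real n1 / 16)" using chi(2)[OF sub(1)] by (simp add: E1_def)
    have PE2: "N.prob E2 \<le> exp (- real n2 / 16)" using chi(2)[OF sub(2)] unfolding E2_def cards .
    have PE3: "N.prob (E3 j) \<le> exp (- (1 / 2) * (\<rho> / 2)\<^sup>2 / (2 * (4 * \<Sigma> / \<mu>\<^sup>2))) / sqrt (1 / 2)" if "j \<in> S" for j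
      using prob_linear_ge_le[of "{..<n}" "{..<n}" "4 * \<Sigma> / \<mu>\<^sup>2" "a j" "1 / 2" "\<rho> / 2"] var[OF that] \<Sigma> \<mu> \<rho>0
      by (simp add: E3_def l_def)
    have HN: "H \<in> N.events" unfolding H_def using E S(1) by (intro sets.Diff sets.Un sets.finite_UN) auto
    have "1 - real (card S) * (exp (- (1 / 2) * (\<rho> / 2)\<^sup>2 / (2 * (4 * \<Sigma> / \<mu>\<^sup>2))) / sqrt (1 / 2))
        \<le> N.prob (space ?N - (\<Union>j\<in>S. E3 j))"
      using S(1) E(3) PE3 by (intro N.prob_avoid_ge) auto
    moreover have "N.prob (space ?N - (\<Union>j\<in>S. E3 j)) \<le> N.prob (H \<union> (E1 \<union> E2))"
      using HN E by (intro N.finite_measure_mono) (auto simp: H_def)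
    moreover have "N.prob (H \<union> (E1 \<union> E2)) \<le> N.prob H + N.prob (E1 \<union> E2)"
      using HN E by (intro measure_Un_le) auto
    moreover have "N.prob (E1 \<union> E2) \<le> N.prob E1 + N.prob E2"
      using E by (intro measure_Un_le) auto
    ultimately have PH: "1 - b2 \<le> N.prob H"
      using PE1 PE2 unfolding S(2) b2_def by linarith
    have "\<exists>C\<in>sets (std_gauss_vec ?J). 1 - b3 \<le> J.prob C \<and>
        (\<forall>y\<in>C. recovery n p (merge ?I ?J (x, y)) \<beta>s (\<lambda>i. c i * W i) lam)" if W: "W \<in> H" for W
    proof -
      let ?Z = "\<lambda>i. c i * W i"
      have Z2: "(\<Sum>i<n. (?Z i)\<^sup>2) \<le> 2 * \<Sigma>"
      proof -
        have "(\<Sum>i<n. (?Z i)\<^sup>2) = (\<Sum>i<n1. \<sigma>1\<^sup>2 * (W i)\<^sup>2) + (\<Sum>i\<in>{n1..<n}. \<sigma>2\<^sup>2 * (W i)\<^sup>2)"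
          unfolding split_sum by (intro arg_cong2[where f = "(+)"] sum.cong) (auto simp: c_def power_mult_distrib)
        also have "\<dots> = \<sigma>1\<^sup>2 * Q {..<n1} W + \<sigma>2\<^sup>2 * Q {n1..<n} W"
          by (simp add: sum_distrib_left Q_def)
        also have "\<dots> \<le> \<sigma>1\<^sup>2 * (2 * real n1) + \<sigma>2\<^sup>2 * (2 * real n2)"
          using W by (intro add_mono mult_left_mono) (auto simp: H_def E1_def E2_def)
        finally show ?thesis by (simp add: \<Sigma>_def algebra_simps)
      qed
      have small: "\<bar>\<Sum>i<n. (\<Sum>l\<in>S. x (i, l) * u j l) * ?Z i\<bar> < \<rho> / 2" if "j \<in> S" for j
      proof -
        have "\<bar>l j W\<bar> < \<rho> / 2" using W that by (auto simp: H_def E3_def)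
        then show ?thesis by (simp add: l_def a_def mult.assoc)
      qed
      obtain r where r: "(\<Sum>i<n. (r i)\<^sup>2) \<le> (\<Sum>i<n. (?Z i)\<^sup>2) + nl\<^sup>2 * real s / \<mu>"
        "\<And>X. \<lbrakk>\<forall>i<n. \<forall>j\<in>S. X (i, j) = x (i, j); \<forall>j<p. \<beta>s j = 0 \<longrightarrow> \<bar>\<Sum>i<n. X (i, j) * r i\<bar> \<le> nl\<rbrakk>
          \<Longrightarrow> recovery n p X \<beta>s ?Z lam"
        using u(2)[of \<rho> ?Z] small bias \<rho> unfolding S(2) nl_def by (auto simp: S_def)
      define V where "V = 2 * \<Sigma> + nl\<^sup>2 * real s / \<mu>"
      have V: "V > 0" "(\<Sum>i<n. (r i)\<^sup>2) \<le> V"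
        using r(1) Z2 \<Sigma> nl \<mu> by (auto simp: V_def intro!: add_pos_nonneg)
      define k where "k = (\<lambda>j (y :: nat \<times> nat \<Rightarrow> real). \<Sum>z\<in>{..<n} \<times> {j}. r (fst z) * y z)"
      have k: "k j y = (\<Sum>i<n. y (i, j) * r i)" for j y
        unfolding k_def sum_column by (simp add: mult.commute)
      define D where "D = (\<lambda>j. {y \<in> space (std_gauss_vec ?J). nl \<le> \<bar>k j y\<bar>})"
      have sub: "{..<n} \<times> {j} \<subseteq> ?J" if "j \<in> T" for j using that by auto
      have DJ: "D j \<in> J.events" if "j \<in> T" for j
      proof -
        have [measurable]: "k j \<in> borel_measurable (std_gauss_vec ?J)"
          unfolding k_def by (rule std_gauss_vec_linear_measurable[OF sub[OF that]])
        show ?thesis unfolding D_def by measurable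
      qed
      have PD: "J.prob (D j) \<le> exp (- \<theta> * nl\<^sup>2 / (2 * V)) / sqrt (1 - \<theta>)" if "j \<in> T" for j
      proof -
        have "(\<Sum>z\<in>{..<n} \<times> {j}. (r (fst z))\<^sup>2) \<le> V" unfolding sum_column using V(2) by simp
        then show ?thesis
          using prob_linear_ge_le[OF sub[OF that], of V "\<lambda>z. r (fst z)" \<theta> nl] V(1) \<theta> nl
          by (simp add: D_def k_def)
      qed
      let ?C = "space (std_gauss_vec ?J) - (\<Union>j\<in>T. D j)"
      have "1 - b3 \<le> J.prob ?C"
        using J.prob_avoid_ge[OF T(1) DJ PD] unfolding T(2) b3_def nl_def V_def by simp
      moreover have "recovery n p (merge ?I ?J (x, y)) \<beta>s ?Z lam" if y: "y \<in> ?C" for y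
      proof (rule r(2))
        show "\<forall>i<n. \<forall>j\<in>S. merge ?I ?J (x, y) (i, j) = x (i, j)" by (auto simp: merge_def)
        show "\<forall>j<p. \<beta>s j = 0 \<longrightarrow> \<bar>\<Sum>i<n. merge ?I ?J (x, y) (i, j) * r i\<bar> \<le> nl"
        proof (intro allI impI)
          fix j assume "j < p" "\<beta>s j = 0"
          then have j: "j \<in> T" "j \<notin> S" by (auto simp: T_def S_def)
          have "\<bar>k j y\<bar> \<le> nl" using y j(1) by (auto simp: D_def)
          moreover have "merge ?I ?J (x, y) (i, j) = y (i, j)" if "i < n" for i
            using that j by (auto simp: merge_def)
          ultimately show "\<bar>\<Sum>i<n. merge ?I ?J (x, y) (i, j) * r i\<bar> \<le> nl" by (simp add: k)
        qed
      qed
      moreover have "?C \<in> J.events" using DJ T(1) by (intro sets.Diff sets.finite_UN) auto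
      ultimately show ?thesis by blast
    qed
    then show ?thesis using HN PH by blast
  qed
  have "(1 - b3) * (1 - b2) * (1 - b1) \<le> (1 - b3) * (1 - b2) * I.prob G"
    using PG b by (intro mult_left_mono) auto
  also have "\<dots> \<le> recovery_prob n1 n2 p \<sigma>1 \<sigma>2 \<beta>s lam"
    using recovery_prob_ge[of n1 n2 lam G p \<beta>s "1 - b2" "1 - b3" \<sigma>1 \<sigma>2] n1 lam G b sec
    unfolding S_def T_def n_def c_def by simp
  finally show ?thesis .
qed

subsection \<open>Asymptotics\<close>

lemma recovery_prob_range: "0 \<le> recovery_prob n1 n2 p \<sigma>1 \<sigma>2 \<beta>s lam" "recovery_prob n1 n2 p \<sigma>1 \<sigma>2 \<beta>s lam \<le> 1"
proof -
  interpret prob_space "std_gauss_vec ({..<n1 + n2} \<times> {..<p}) \<Otimes>\<^sub>M std_gauss_vec {..<n1 + n2}"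
    by (intro prob_space_pair prob_space_std_gauss_vec)
  show "0 \<le> recovery_prob n1 n2 p \<sigma>1 \<sigma>2 \<beta>s lam" "recovery_prob n1 n2 p \<sigma>1 \<sigma>2 \<beta>s lam \<le> 1"
    by (auto simp: recovery_prob_def Let_def)
qed

text \<open>The net cardinality is exponential in \<open>s\<close>, the concentration exponential in
  \<open>m\<close>; since \<open>m\<close> eventually exceeds every multiple of \<open>s\<close>,
  the concentration wins.\<close>

lemma power_times_exp_tendsto_0:
  fixes s m :: "nat \<Rightarrow> nat" and D \<kappa> :: real
  assumes s: "filterlim (\<lambda>p. real (s p)) at_top sequentially"
    and m: "(\<lambda>p. real (m p)) \<in> \<omega>(\<lambda>p. real (s p))" and D: "D > 1" and \<kappa>: "\<kappa> > 0"
  shows "(\<lambda>p. D ^ s p * exp (- \<kappa> * real (m p))) \<longlonglongrightarrow> 0"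
proof (rule tendsto_sandwich[OF _ _ tendsto_const])
  \<comment> \<open>Once \<open>m \<ge> c * s\<close>, the total exponent is at most
    \<open>- s\<close>.\<close>
  define c where "c = (ln D + 1) / \<kappa>"
  have c: "c > 0" using D \<kappa> by (simp add: c_def add_pos_pos)
  have "eventually (\<lambda>p. c * norm (real (s p)) \<le> norm (real (m p))) sequentially"
    using landau_omega.smallD[OF m c] .
  then show "eventually (\<lambda>p. D ^ s p * exp (- \<kappa> * real (m p)) \<le> exp (- real (s p))) sequentially"
  proof eventually_elim
    case (elim p)
    have "\<kappa> * (c * real (s p)) \<le> \<kappa> * real (m p)" using elim \<kappa> by (intro mult_left_mono) auto
    moreover have "\<kappa> * (c * real (s p)) = (ln D + 1) * real (s p)" using \<kappa> by (simp add: c_def)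
    ultimately have "real (s p) * ln D - \<kappa> * real (m p) \<le> - real (s p)"
      by (simp add: algebra_simps)
    then have "exp (real (s p) * ln D + (- \<kappa> * real (m p))) \<le> exp (- real (s p))" by simp
    moreover have "exp (real (s p) * ln D) = D ^ s p" using D by (simp add: exp_of_nat_mult)
    ultimately show ?case by (simp only: exp_add)
  qed
  show "eventually (\<lambda>p. 0 \<le> D ^ s p * exp (- \<kappa> * real (m p))) sequentially"
    using D by (intro always_eventually) auto
  have "((\<lambda>x::real. exp (- x)) \<longlongrightarrow> 0) at_top" by real_asymp
  then show "(\<lambda>p. exp (- real (s p))) \<longlonglongrightarrow> 0" by (rule filterlim_compose[OF _ s])
qed

lemma ln_diff_at_top:
  fixes s :: "nat \<Rightarrow> nat"
  assumes "(\<lambda>p. real (s p)) \<in> o(\<lambda>p. real p)"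
  shows "filterlim (\<lambda>p. ln (real p - real (s p))) at_top sequentially"
proof -
  have "eventually (\<lambda>p. norm (real (s p)) \<le> 1 / 2 * norm (real p)) sequentially"
    using landau_o.smallD[OF assms, of "1 / 2"] by simp
  then have "eventually (\<lambda>p. real p / 2 \<le> real p - real (s p)) sequentially"
    by eventually_elim simp
  moreover have "filterlim (\<lambda>p::nat. real p / 2) at_top sequentially" by real_asymp
  ultimately have "filterlim (\<lambda>p. real p - real (s p)) at_top sequentially"
    by (rule filterlim_at_top_mono[rotated])
  then show ?thesis by (rule filterlim_compose[OF ln_at_top])
qed

lemma omega_at_top:
  fixes s m :: "nat \<Rightarrow> nat"
  assumes s: "filterlim (\<lambda>p. real (s p)) at_top sequentially"
    and m: "(\<lambda>p. real (m p)) \<in> \<omega>(\<lambda>p. real (s p))"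
  shows "filterlim (\<lambda>p. real (m p)) at_top sequentially"
proof (rule filterlim_at_top_mono[OF s])
  show "eventually (\<lambda>p. real (s p) \<le> real (m p)) sequentially"
    using landau_omega.smallD[OF m, of 1] by simp
qed

text \<open>Below the threshold the lower bound \<open>exp L * q L\<close> on the expected number of
  violated constraints grows like \<open>exp (\<delta> * L)\<close> up to a factor of order
  \<open>exp (- C * sqrt L)\<close>, and \<open>1 - x \<le> exp (- x)\<close> turns this into
  vanishing recovery probability.\<close>

lemma recovery_prob_tendsto_0:
  fixes s n1 n2 :: "nat \<Rightarrow> nat" and \<sigma>1 \<sigma>2 lam :: "nat \<Rightarrow> real" and \<beta>s :: "nat \<Rightarrow> nat \<Rightarrow> real" and \<epsilon> :: real
  assumes supp: "\<And>p. card {j. j < p \<and> \<beta>s p j \<noteq> 0} = s p"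
    and s_inf: "filterlim (\<lambda>p. real (s p)) at_top sequentially"
    and s_small: "(\<lambda>p. real (s p)) \<in> o(\<lambda>p. real p)"
    and n1_big: "(\<lambda>p. real (n1 p)) \<in> \<omega>(\<lambda>p. real (s p))"
    and \<epsilon>: "\<epsilon> > 0"
    and n: "\<forall>\<^sub>F p in sequentially. real (n1 p + n2 p)
      < (1 - \<epsilon>) * (2 * real (s p) * ln (real p - real (s p)) + real (s p) + 1)"
    and lam: "\<And>p. lam p > 0"
  shows "(\<lambda>p. recovery_prob (n1 p) (n2 p) p (\<sigma>1 p) (\<sigma>2 p) (\<beta>s p) (lam p)) \<longlonglongrightarrow> 0"
proof -
  define L where "L = (\<lambda>p. ln (real p - real (s p)))"
  have L: "filterlim L at_top sequentially" unfolding L_def by (rule ln_diff_at_top[OF s_small])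
  \<comment> \<open>Half of the gap \<open>2 * \<delta> \<le> \<epsilon>\<close> pays for the factor
    \<open>1 + \<delta>\<close> of the chi-square bound, because
    \<open>(1 + \<delta>) * (1 - 2 * \<delta>) \<le> 1 - \<delta>\<close>. The minimum keeps these
    factors positive when \<open>\<epsilon>\<close> is large.\<close>
  define \<delta> where "\<delta> = min \<epsilon> (1 / 2) / 2"
  have \<delta>: "0 < \<delta>" "\<delta> < 1 / 2" "2 * \<delta> \<le> \<epsilon>" using \<epsilon> by (auto simp: \<delta>_def min_def)
  define q where "q = (\<lambda>l::real. exp (- (sqrt ((1 - \<delta>) * (2 * l + 2)) + 1)\<^sup>2 / 2) / sqrt (2 * pi))"
  have le: "\<forall>\<^sub>F p in sequentially. recovery_prob (n1 p) (n2 p) p (\<sigma>1 p) (\<sigma>2 p) (\<beta>s p) (lam p)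
      \<le> exp (- (exp (L p) * q (L p))) + exp (- \<delta>\<^sup>2 * real (n1 p) / 16)"
  proof -
    have "\<forall>\<^sub>F p in sequentially. real (s p) \<ge> 1" using s_inf unfolding filterlim_at_top by blast
    moreover have "\<forall>\<^sub>F p in sequentially. L p \<ge> 1" using L unfolding filterlim_at_top by blast
    moreover have "\<forall>\<^sub>F p in sequentially. real (n1 p) \<ge> 1"
      using omega_at_top[OF s_inf n1_big] unfolding filterlim_at_top by blast
    moreover have "\<forall>\<^sub>F p in sequentially. norm (real (s p)) \<le> 1 / 2 * norm (real p)"
      using landau_o.smallD[OF s_small, of "1 / 2"] by simp
    moreover have "\<forall>\<^sub>F p::nat in sequentially. p > 0" by (rule eventually_gt_at_top)
    ultimately show ?thesis using n
    proof eventually_elim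
      case (elim p)
      define m where "m = n1 p + n2 p"
      define t where "t = sqrt ((1 + \<delta>) * real m / real (s p))"
      have s1: "real (s p) \<ge> 1" and L1: "L p \<ge> 1" and sp: "real (s p) < real p" using elim by auto
      \<comment> \<open>The summands \<open>s + 1\<close> of the threshold are at most
        \<open>2 * s\<close>, a correction of lower order than \<open>2 * s * L p\<close>.\<close>
      have nALG: "2 * real (s p) * L p + real (s p) + 1 \<le> real (s p) * (2 * L p + 2)"
        using s1 by (simp add: algebra_simps)
      have pos: "0 \<le> 2 * real (s p) * L p + real (s p) + 1" using s1 L1 by simp
      have "real m \<le> (1 - \<epsilon>) * (2 * real (s p) * L p + real (s p) + 1)"
        using elim by (simp add: m_def L_def)
      also have "\<dots> \<le> (1 - 2 * \<delta>) * (2 * real (s p) * L p + real (s p) + 1)"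
        using \<delta> pos by (intro mult_right_mono) auto
      also have "\<dots> \<le> (1 - 2 * \<delta>) * (real (s p) * (2 * L p + 2))"
        using \<delta> nALG by (intro mult_left_mono) auto
      finally have "(1 + \<delta>) * real m \<le> (1 + \<delta>) * ((1 - 2 * \<delta>) * (real (s p) * (2 * L p + 2)))"
        using \<delta> by (intro mult_left_mono) auto
      also have "\<dots> = ((1 + \<delta>) * (1 - 2 * \<delta>)) * (real (s p) * (2 * L p + 2))" by simp
      also have "\<dots> \<le> (1 - \<delta>) * (real (s p) * (2 * L p + 2))"
        using \<delta> s1 L1 by (intro mult_right_mono) (auto simp: algebra_simps)
      finally have "(1 + \<delta>) * real m / real (s p) \<le> (1 - \<delta>) * (2 * L p + 2)"
        using s1 by (simp add: divide_le_eq mult_ac)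
      then have "t \<le> sqrt ((1 - \<delta>) * (2 * L p + 2))" unfolding t_def by simp
      moreover have "0 \<le> t" using \<delta> by (simp add: t_def)
      ultimately have "(t + 1)\<^sup>2 \<le> (sqrt ((1 - \<delta>) * (2 * L p + 2)) + 1)\<^sup>2" by (intro power_mono) auto
      then have qt: "q (L p) \<le> exp (- (t + 1)\<^sup>2 / 2) / sqrt (2 * pi)" (is "_ \<le> ?q")
        unfolding q_def by (intro divide_right_mono) auto
      have "?q \<le> 1"
      proof -
        have "exp (- (t + 1)\<^sup>2 / 2) \<le> 1" by simp
        also have "1 \<le> sqrt (2 * pi)" using pi_ge_two by simp
        finally show ?thesis by (simp add: divide_le_eq)
      qed
      then have "(1 - ?q) ^ (p - s p) \<le> exp (- ?q) ^ (p - s p)"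
        using exp_ge_add_one_self[of "- ?q"] by (intro power_mono) auto
      also have "\<dots> = exp (- (real (p - s p) * ?q))" by (simp add: exp_of_nat_mult[symmetric])
      also have "real (p - s p) = exp (L p)" using sp by (simp add: L_def of_nat_diff)
      also have "exp (- (exp (L p) * ?q)) \<le> exp (- (exp (L p) * q (L p)))"
        unfolding exp_le_cancel_iff neg_le_iff_le using qt by (intro mult_left_mono) auto
      finally have 1: "(1 - ?q) ^ (p - s p) \<le> exp (- (exp (L p) * q (L p)))" .
      have 2: "exp (- \<delta>\<^sup>2 * real m / 16) \<le> exp (- \<delta>\<^sup>2 * real (n1 p) / 16)"
        by (simp add: m_def mult_left_mono)
      have "recovery_prob (n1 p) (n2 p) p (\<sigma>1 p) (\<sigma>2 p) (\<beta>s p) (lam p)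
          \<le> (1 - ?q) ^ (p - s p) + exp (- \<delta>\<^sup>2 * real m / 16)"
        unfolding t_def m_def using elim lam \<delta> supp by (intro recovery_prob_upper_bound) auto
      then show ?case using 1 2 by linarith
    qed
  qed
  have "filterlim (\<lambda>l. exp l * q l) at_top at_top"
  proof -
    define a where "a = 1 - \<delta>"
    have a: "a > 0" "\<delta> = 1 - a" using \<delta> by (auto simp: a_def)
    \<comment> \<open>The logarithm of \<open>exp l * q l\<close> with the square multiplied out:
      the linear term \<open>\<delta> * l\<close> beats the square root.\<close>
    have "filterlim (\<lambda>l. exp (\<delta> * l - (a + 1 / 2) - sqrt (a * (2 * l + 2))) / sqrt (2 * pi)) at_top at_top"
      using \<delta>(1) a(1) by real_asymp
    moreover have "\<forall>\<^sub>F l in at_top. exp (\<delta> * l - (a + 1 / 2) - sqrt (a * (2 * l + 2))) / sqrt (2 * pi) = exp l * q l"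
      using eventually_ge_at_top[of 0]
    proof eventually_elim
      case (elim l)
      have "(sqrt (a * (2 * l + 2)) + 1)\<^sup>2 = a * (2 * l + 2) + 2 * sqrt (a * (2 * l + 2)) + 1"
        using a elim by (simp add: power2_sum)
      then have "\<delta> * l - (a + 1 / 2) - sqrt (a * (2 * l + 2)) = l + - (sqrt (a * (2 * l + 2)) + 1)\<^sup>2 / 2"
        unfolding a(2) by (simp only:) (simp add: field_simps)
      then show ?case unfolding q_def a_def[symmetric] by (simp only: exp_add times_divide_eq_right)
    qed
    ultimately show ?thesis by (rule filterlim_mono_eventually[OF _ order_refl order_refl])
  qed
  then have "((\<lambda>l. exp (- (exp l * q l))) \<longlongrightarrow> 0) at_top"
    by (intro filterlim_compose[OF exp_at_bot] filterlim_compose[OF filterlim_uminus_at_bot_at_top])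
  then have l1: "(\<lambda>p. exp (- (exp (L p) * q (L p)))) \<longlonglongrightarrow> 0" by (rule filterlim_compose[OF _ L])
  have "((\<lambda>x::real. exp (- \<delta>\<^sup>2 * x / 16)) \<longlongrightarrow> 0) at_top" using \<delta> by real_asymp
  then have l2: "(\<lambda>p. exp (- \<delta>\<^sup>2 * real (n1 p) / 16)) \<longlonglongrightarrow> 0"
    by (rule filterlim_compose[OF _ omega_at_top[OF s_inf n1_big]])
  show ?thesis
  proof (rule tendsto_sandwich[OF _ le tendsto_const])
    show "(\<lambda>p. exp (- (exp (L p) * q (L p))) + exp (- \<delta>\<^sup>2 * real (n1 p) / 16)) \<longlonglongrightarrow> 0"
      using tendsto_add[OF l1 l2] by simp
  qed (simp add: recovery_prob_range)
qed

text \<open>The constants form a chain \<open>1 + \<delta> > 1 + \<delta> / 2 > 1 + \<delta> / 4 > 1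
  + \<delta> / 8 > 1\<close>. The gaps pay in turn for the singular value loss, the noise part of
  the residual, the factor \<open>\<theta>\<close> of the tail bound, and the decay
  \<open>exp (- (\<delta> / 8) * L)\<close> that remains.\<close>

lemma recovery_prob_tendsto_1:
  fixes s n1 n2 :: "nat \<Rightarrow> nat" and \<sigma>1 \<sigma>2 \<rho> lam :: "nat \<Rightarrow> real" and \<beta>s :: "nat \<Rightarrow> nat \<Rightarrow> real" and \<epsilon> :: real
  assumes sigma: "\<And>p. \<sigma>1 p \<noteq> 0" and rho_pos: "\<And>p. \<rho> p > 0"
    and supp: "\<And>p. card {j. j < p \<and> \<beta>s p j \<noteq> 0} = s p"
    and rho_bd: "\<And>p j. j < p \<Longrightarrow> \<beta>s p j \<noteq> 0 \<Longrightarrow> \<bar>\<beta>s p j\<bar> \<ge> \<rho> p"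
    and s_inf: "filterlim (\<lambda>p. real (s p)) at_top sequentially"
    and s_small: "(\<lambda>p. real (s p)) \<in> o(\<lambda>p. real p)"
    and n1_big: "(\<lambda>p. real (n1 p)) \<in> \<omega>(\<lambda>p. real (s p))"
    and n2_big: "(\<lambda>p. real (n2 p)) \<in> \<omega>(\<lambda>p. real (s p))"
    and \<epsilon>: "\<epsilon> > 0"
    and n: "\<forall>\<^sub>F p in sequentially. real (n1 p + n2 p)
      > (1 + \<epsilon>) * (2 * real (s p) * ln (real p - real (s p)) + real (s p) + 1)"
    and lam: "\<And>p. lam p > 0"
  defines "\<tau> \<equiv> \<lambda>p. (real (n1 p) * (\<sigma>1 p)\<^sup>2 + real (n2 p) * (\<sigma>2 p)\<^sup>2) / real (n1 p + n2 p)"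
  assumes big: "filterlim (\<lambda>p. real (n1 p + n2 p) * (lam p)\<^sup>2 / (\<tau> p * ln (real p - real (s p)))) at_top sequentially"
    and small: "(\<lambda>p. (1 / \<rho> p) * (lam p * sqrt (real (s p))
      + sqrt (\<tau> p * ln (real (s p)) / real (n1 p + n2 p)))) \<longlonglongrightarrow> 0"
  shows "(\<lambda>p. recovery_prob (n1 p) (n2 p) p (\<sigma>1 p) (\<sigma>2 p) (\<beta>s p) (lam p)) \<longlonglongrightarrow> 1"
proof -
  define L where "L = (\<lambda>p. ln (real p - real (s p)))"
  have L: "filterlim L at_top sequentially" unfolding L_def by (rule ln_diff_at_top[OF s_small])
  define \<delta> where "\<delta> = min \<epsilon> 1"
  have \<delta>: "0 < \<delta>" "\<delta> \<le> 1" "\<delta> \<le> \<epsilon>" using \<epsilon> by (auto simp: \<delta>_def)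
  \<comment> \<open>Then \<open>8 * \<eta> = \<delta> / 4\<close>, and
    \<open>(1 - \<delta> / 4) * (1 + \<delta>) \<ge> 1 + \<delta> / 2\<close> because
    \<open>\<delta> \<le> 1\<close>.\<close>
  define \<eta> where "\<eta> = \<delta> / 32"
  have \<eta>: "0 < \<eta>" "\<eta> \<le> 1 / 16" using \<delta> by (auto simp: \<eta>_def)
  define \<theta> where "\<theta> = (1 + \<delta> / 8) / (1 + \<delta> / 4)"
  have \<theta>: "0 < \<theta>" "\<theta> < 1" using \<delta> by (auto simp: \<theta>_def)
  define m where "m = (\<lambda>p. n1 p + n2 p)"
  define \<mu> where "\<mu> = (\<lambda>p. (1 - 8 * \<eta>) * real (n1 p + n2 p))"
  define \<Sigma> where "\<Sigma> = (\<lambda>p. real (n1 p) * (\<sigma>1 p)\<^sup>2 + real (n2 p) * (\<sigma>2 p)\<^sup>2)"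
  define nl where "nl = (\<lambda>p. real (m p) * lam p)"
  define b1 where "b1 = (\<lambda>p. 2 * (3 * exp (1 / \<eta>\<^sup>2)) ^ s p * exp (- \<eta>\<^sup>2 * real (n1 p) / 16)
        + 2 * (3 * exp (1 / \<eta>\<^sup>2)) ^ s p * exp (- \<eta>\<^sup>2 * real (n2 p) / 16))"
  define b2 where "b2 = (\<lambda>p. exp (- real (n1 p) / 16) + exp (- real (n2 p) / 16)
        + real (s p) * (exp (- (1 / 2) * (\<rho> p / 2)\<^sup>2 / (2 * (4 * \<Sigma> p / (\<mu> p)\<^sup>2))) / sqrt (1 / 2)))"
  define b3 where "b3 = (\<lambda>p. real (p - s p) * (exp (- \<theta> * (nl p)\<^sup>2 / (2 * (2 * \<Sigma> p + (nl p)\<^sup>2 * real (s p) / \<mu> p)))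
        / sqrt (1 - \<theta>)))"
  have s1: "\<forall>\<^sub>F p in sequentially. real (s p) \<ge> 1" using s_inf unfolding filterlim_at_top by blast
  have L1: "\<forall>\<^sub>F p in sequentially. L p \<ge> 1" using L unfolding filterlim_at_top by blast
  have n11: "\<forall>\<^sub>F p in sequentially. real (n1 p) \<ge> 1"
    using omega_at_top[OF s_inf n1_big] unfolding filterlim_at_top by blast
  have n21: "\<forall>\<^sub>F p in sequentially. real (n2 p) \<ge> 1"
    using omega_at_top[OF s_inf n2_big] unfolding filterlim_at_top by blast
  have sp: "\<forall>\<^sub>F p in sequentially. real (s p) < real p"
  proof -
    have "\<forall>\<^sub>F p in sequentially. norm (real (s p)) \<le> 1 / 2 * norm (real p)"
      using landau_o.smallD[OF s_small, of "1 / 2"] by simp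
    moreover have "\<forall>\<^sub>F p::nat in sequentially. p > 0" by (rule eventually_gt_at_top)
    ultimately show ?thesis by eventually_elim auto
  qed
  have mu: "real (m p) \<le> 2 * \<mu> p" for p
    unfolding \<mu>_def m_def using \<eta> mult_right_mono[of "1 / 2" "1 - 8 * \<eta>" "real (n1 p + n2 p)"] by simp
  have \<tau>: "\<tau> p = \<Sigma> p / real (m p)" for p by (simp add: \<tau>_def \<Sigma>_def m_def)
  have \<Sigma>pos: "\<Sigma> p > 0" if "real (n1 p) \<ge> 1" for p
    unfolding \<Sigma>_def using that sigma by (intro add_pos_nonneg) auto

  have D: "3 * exp (1 / \<eta>\<^sup>2) > 1"
  proof -
    have "exp (1 / \<eta>\<^sup>2) \<ge> 1" by simp
    then show ?thesis by linarith
  qed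
  have B1: "b1 \<longlonglongrightarrow> 0"
  proof -
    have "(\<lambda>p. 2 * ((3 * exp (1 / \<eta>\<^sup>2)) ^ s p * exp (- (\<eta>\<^sup>2 / 16) * real (n1 p)))
        + 2 * ((3 * exp (1 / \<eta>\<^sup>2)) ^ s p * exp (- (\<eta>\<^sup>2 / 16) * real (n2 p)))) \<longlonglongrightarrow> 2 * 0 + 2 * 0"
      using \<eta> by (intro tendsto_intros power_times_exp_tendsto_0[OF s_inf] n1_big n2_big D) auto
    then show ?thesis by (simp add: b1_def mult.assoc)
  qed

  let ?f = "\<lambda>p. (1 / \<rho> p) * (lam p * sqrt (real (s p)) + sqrt (\<tau> p * ln (real (s p)) / real (n1 p + n2 p)))"
  \<comment> \<open>A convenient small constant: its square, together with
    \<open>m \<le> 2 * \<mu>\<close>, makes the exponent in \<open>b2\<close> at least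
    \<open>2 * ln s\<close>, so the union bound over \<open>s\<close> coordinates leaves order
    \<open>1 / s\<close>.\<close>
  have small': "\<forall>\<^sub>F p in sequentially. ?f p < 1 / 32"
    using order_tendstoD(2)[OF small, of "1 / 32"] by simp
  have parts: "\<forall>\<^sub>F p in sequentially. lam p * sqrt (real (s p)) \<le> \<rho> p / 32 \<and>
      \<Sigma> p * ln (real (s p)) / (real (m p))\<^sup>2 \<le> (\<rho> p)\<^sup>2 / 1024"
    using small' s1 n11
  proof eventually_elim
    case (elim p)
    let ?a = "lam p * sqrt (real (s p))" and ?b = "sqrt (\<tau> p * ln (real (s p)) / real (n1 p + n2 p))"
    have x0: "0 \<le> \<tau> p * ln (real (s p)) / real (n1 p + n2 p)"
      using elim \<Sigma>pos[of p] by (simp add: \<tau>)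
    have "?a + ?b \<le> \<rho> p / 32" using elim(1) rho_pos[of p] by (simp add: field_simps)
    moreover have "?a \<ge> 0" using lam[of p] by simp
    moreover have "?b \<ge> 0" using x0 by simp
    ultimately have a: "?a \<le> \<rho> p / 32" and b: "?b \<le> \<rho> p / 32" by linarith+
    have "?b\<^sup>2 \<le> (\<rho> p / 32)\<^sup>2" using b x0 by (intro power_mono) auto
    then have "\<tau> p * ln (real (s p)) / real (n1 p + n2 p) \<le> (\<rho> p)\<^sup>2 / 1024"
      using x0 by (simp add: power_divide)
    then show ?case using a by (simp add: \<tau> m_def power2_eq_square)
  qed

  have B2: "b2 \<longlonglongrightarrow> 0"
  proof -
    have e: "((\<lambda>x::real. exp (- x / 16)) \<longlongrightarrow> 0) at_top" by real_asymp
    have "(\<lambda>p. real (s p) * (exp (- (1 / 2) * (\<rho> p / 2)\<^sup>2 / (2 * (4 * \<Sigma> p / (\<mu> p)\<^sup>2))) / sqrt (1 / 2))) \<longlonglongrightarrow> 0"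
    proof (rule tendsto_sandwich[OF _ _ tendsto_const])
      show "\<forall>\<^sub>F p in sequentially. 0 \<le> real (s p) * (exp (- (1 / 2) * (\<rho> p / 2)\<^sup>2 / (2 * (4 * \<Sigma> p / (\<mu> p)\<^sup>2))) / sqrt (1 / 2))"
        by (intro always_eventually) auto
      show "\<forall>\<^sub>F p in sequentially. real (s p) * (exp (- (1 / 2) * (\<rho> p / 2)\<^sup>2 / (2 * (4 * \<Sigma> p / (\<mu> p)\<^sup>2))) / sqrt (1 / 2))
          \<le> 1 / real (s p) / sqrt (1 / 2)"
        using parts s1 n11
      proof eventually_elim
        case (elim p)
        have S0: "\<Sigma> p > 0" using \<Sigma>pos elim by auto
        have m0: "real (m p) > 0" using elim by (simp add: m_def)
        have l0: "0 \<le> ln (real (s p))" using elim by simp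
        have msq: "(real (m p))\<^sup>2 \<le> 4 * (\<mu> p)\<^sup>2"
          using power_mono[OF mu[of p], of 2] m0 by (simp add: power_mult_distrib)
        have "\<Sigma> p * ln (real (s p)) \<le> (\<rho> p)\<^sup>2 / 1024 * (real (m p))\<^sup>2"
          using elim m0 by (simp add: pos_divide_le_eq)
        also have "\<dots> \<le> (\<rho> p)\<^sup>2 / 1024 * (4 * (\<mu> p)\<^sup>2)" using msq by (intro mult_left_mono) auto
        finally have "2 * ln (real (s p)) \<le> (\<rho> p)\<^sup>2 * (\<mu> p)\<^sup>2 / (128 * \<Sigma> p)"
          using S0 by (simp add: field_simps)
        moreover have "(\<rho> p)\<^sup>2 * (\<mu> p)\<^sup>2 / (128 * \<Sigma> p) \<le> (\<rho> p)\<^sup>2 * (\<mu> p)\<^sup>2 / (64 * \<Sigma> p)"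
          using S0 by (intro divide_left_mono) auto
        moreover have "- (1 / 2) * (\<rho> p / 2)\<^sup>2 / (2 * (4 * \<Sigma> p / (\<mu> p)\<^sup>2))
            = - ((\<rho> p)\<^sup>2 * (\<mu> p)\<^sup>2 / (64 * \<Sigma> p))"
          by (simp add: power_divide)
        ultimately have "- (1 / 2) * (\<rho> p / 2)\<^sup>2 / (2 * (4 * \<Sigma> p / (\<mu> p)\<^sup>2)) \<le> - (2 * ln (real (s p)))"
          by linarith
        then have "exp (- (1 / 2) * (\<rho> p / 2)\<^sup>2 / (2 * (4 * \<Sigma> p / (\<mu> p)\<^sup>2))) \<le> exp (- (2 * ln (real (s p))))"
          unfolding exp_le_cancel_iff .
        also have "\<dots> = 1 / (real (s p))\<^sup>2"
        proof -
          have "exp (2 * ln (real (s p))) = (real (s p))\<^sup>2"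
            using elim by (simp add: exp_double)
          then show ?thesis by (simp add: exp_minus inverse_eq_divide)
        qed
        finally have "real (s p) * exp (- (1 / 2) * (\<rho> p / 2)\<^sup>2 / (2 * (4 * \<Sigma> p / (\<mu> p)\<^sup>2)))
            \<le> real (s p) * (1 / (real (s p))\<^sup>2)"
          by (intro mult_left_mono) auto
        also have "\<dots> = 1 / real (s p)" by (simp add: power2_eq_square)
        finally show ?case by (simp only: times_divide_eq_right) (intro divide_right_mono, auto)
      qed
      have "((\<lambda>x::real. 1 / x / sqrt (1 / 2)) \<longlongrightarrow> 0) at_top" by real_asymp
      then show "(\<lambda>p. 1 / real (s p) / sqrt (1 / 2)) \<longlonglongrightarrow> 0" by (rule filterlim_compose[OF _ s_inf])
    qed
    from tendsto_add[OF tendsto_add[OF filterlim_compose[OF e omega_at_top[OF s_inf n1_big]]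
          filterlim_compose[OF e omega_at_top[OF s_inf n2_big]]] this]
    show ?thesis by (simp add: b2_def)
  qed

  have B3: "b3 \<longlonglongrightarrow> 0"
  proof (rule tendsto_sandwich[OF _ _ tendsto_const])
    \<comment> \<open>The share of the residual budget left to the noise: the bias uses
      \<open>1 / (1 + \<delta> / 2)\<close>, and the total may reach
      \<open>1 / (1 + \<delta> / 4)\<close>, both in units of
      \<open>(nl p)^2 / (2 * L p)\<close>.\<close>
    define d where "d = 1 / (1 + \<delta> / 4) - 1 / (1 + \<delta> / 2)"
    have d: "d > 0" using \<delta> by (simp add: d_def divide_strict_left_mono)
    show "\<forall>\<^sub>F p in sequentially. 0 \<le> b3 p" using \<theta> by (intro always_eventually) (auto simp: b3_def)
    \<comment> \<open>The value \<open>4 / d\<close> is what keeps \<open>2 * \<Sigma> p\<close>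
      within the share \<open>d\<close>.\<close>
    have big': "\<forall>\<^sub>F p in sequentially. 4 / d \<le> real (n1 p + n2 p) * (lam p)\<^sup>2 / (\<tau> p * ln (real p - real (s p)))"
      using big unfolding filterlim_at_top by blast
    show "\<forall>\<^sub>F p in sequentially. b3 p \<le> exp (- (\<delta> / 8) * L p) / sqrt (1 - \<theta>)"
      using big' n L1 s1 n11 sp
    proof eventually_elim
      case (elim p)
      have S0: "\<Sigma> p > 0" using \<Sigma>pos elim by auto
      have m0: "real (m p) > 0" using elim by (simp add: m_def)
      have Lp: "L p > 0" using elim by simp
      have nl0: "nl p > 0" using m0 lam[of p] by (simp add: nl_def)
      have \<mu>0: "\<mu> p > 0" using mu[of p] m0 by linarith
      have "4 / d \<le> (nl p)\<^sup>2 / (\<Sigma> p * L p)"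
        using elim(1) m0 unfolding \<tau> by (simp add: nl_def L_def m_def power2_eq_square mult_ac)
      then have "4 * (\<Sigma> p * L p) \<le> d * (nl p)\<^sup>2" using S0 Lp d by (simp add: field_simps)
      then have 1: "2 * \<Sigma> p \<le> (nl p)\<^sup>2 * (d / (2 * L p))" using Lp by (simp add: field_simps)
      have "(1 + \<delta> / 2) * (2 * real (s p) * L p) \<le> \<mu> p"
      proof -
        have "(1 + \<delta>) * (2 * real (s p) * L p) \<le> (1 + \<epsilon>) * (2 * real (s p) * L p + real (s p) + 1)"
          using \<delta> Lp by (intro mult_mono) auto
        then have *: "(1 + \<delta>) * (2 * real (s p) * L p) \<le> real (m p)"
          using elim(2) by (simp add: m_def L_def)
        have "1 + \<delta> / 2 \<le> (1 - 8 * \<eta>) * (1 + \<delta>)"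
        proof -
          have "\<delta> * \<delta> \<le> 1 * \<delta>" using \<delta> by (intro mult_right_mono) auto
          then show ?thesis by (simp add: \<eta>_def field_simps)
        qed
        then have "(1 + \<delta> / 2) * (2 * real (s p) * L p) \<le> (1 - 8 * \<eta>) * (1 + \<delta>) * (2 * real (s p) * L p)"
          using Lp by (intro mult_right_mono) auto
        also have "\<dots> = (1 - 8 * \<eta>) * ((1 + \<delta>) * (2 * real (s p) * L p))" by simp
        also have "\<dots> \<le> (1 - 8 * \<eta>) * real (m p)" using * \<eta> by (intro mult_left_mono) auto
        finally show ?thesis by (simp add: \<mu>_def m_def)
      qed
      moreover define k where "k = (1 + \<delta> / 2) * (2 * L p)"
      ultimately have "real (s p) * k \<le> \<mu> p" by (simp add: mult_ac)
      moreover have "k > 0" using \<delta> Lp by (simp add: k_def)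
      ultimately have "real (s p) / \<mu> p \<le> 1 / k" using \<mu>0 by (simp add: field_simps)
      then have "real (s p) / \<mu> p \<le> 1 / (1 + \<delta> / 2) / (2 * L p)" by (simp add: k_def)
      then have 2: "(nl p)\<^sup>2 * real (s p) / \<mu> p \<le> (nl p)\<^sup>2 * (1 / (1 + \<delta> / 2) / (2 * L p))"
        unfolding times_divide_eq_right[symmetric, of "(nl p)\<^sup>2" "real (s p)"]
        by (intro mult_left_mono) auto
      define V where "V = 2 * \<Sigma> p + (nl p)\<^sup>2 * real (s p) / \<mu> p"
      have V0: "V > 0" unfolding V_def using S0 \<mu>0 by (intro add_pos_nonneg) auto
      have "V \<le> (nl p)\<^sup>2 * (d / (2 * L p) + 1 / (1 + \<delta> / 2) / (2 * L p))"
        unfolding V_def distrib_left using 1 2 by linarith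
      also have "d / (2 * L p) + 1 / (1 + \<delta> / 2) / (2 * L p) = 1 / (1 + \<delta> / 4) / (2 * L p)"
        unfolding add_divide_distrib[symmetric] d_def by simp
      also have "(nl p)\<^sup>2 * (1 / (1 + \<delta> / 4) / (2 * L p)) = (nl p)\<^sup>2 / (2 * ((1 + \<delta> / 4) * L p))"
        by simp
      finally have "2 * V * ((1 + \<delta> / 4) * L p) \<le> (nl p)\<^sup>2"
        using Lp \<delta> by (simp add: pos_le_divide_eq mult_ac)
      then have "(1 + \<delta> / 4) * L p \<le> (nl p)\<^sup>2 / (2 * V)"
        using V0 by (simp add: le_divide_eq mult_ac)
      then have "\<theta> * ((1 + \<delta> / 4) * L p) \<le> \<theta> * ((nl p)\<^sup>2 / (2 * V))" using \<theta> by (intro mult_left_mono) auto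
      moreover have "\<theta> * ((1 + \<delta> / 4) * L p) = (1 + \<delta> / 8) * L p" using \<delta> by (simp add: \<theta>_def)
      ultimately have "exp (- \<theta> * (nl p)\<^sup>2 / (2 * V)) \<le> exp (- ((1 + \<delta> / 8) * L p))"
        by (simp only: exp_le_cancel_iff mult_minus_left minus_divide_left[symmetric] neg_le_iff_le
            times_divide_eq_right)
      then have "real (p - s p) * exp (- \<theta> * (nl p)\<^sup>2 / (2 * V)) \<le> real (p - s p) * exp (- ((1 + \<delta> / 8) * L p))"
        by (intro mult_left_mono) auto
      \<comment> \<open>The number of columns is \<open>exp (L p)\<close>, which the union bound
        spends exactly on the leading 1 of \<open>1 + \<delta> / 8\<close>.\<close>
      also have "\<dots> = exp (- (\<delta> / 8) * L p)"
      proof -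
        have "real (p - s p) = exp (L p)" using elim by (simp add: L_def of_nat_diff)
        then show ?thesis by (simp only: exp_add[symmetric]) (simp add: algebra_simps)
      qed
      finally show ?case unfolding b3_def V_def[symmetric]
        using \<theta> by (simp only: times_divide_eq_right) (intro divide_right_mono, auto)
    qed
    have "((\<lambda>x::real. exp (- (\<delta> / 8) * x) / sqrt (1 - \<theta>)) \<longlongrightarrow> 0) at_top"
    proof -
      have "((\<lambda>x::real. exp (- (\<delta> / 8) * x)) \<longlongrightarrow> 0) at_top" using \<delta> by real_asymp
      from tendsto_divide[OF this tendsto_const, of "sqrt (1 - \<theta>)"] \<theta> show ?thesis by simp
    qed
    then show "(\<lambda>p. exp (- (\<delta> / 8) * L p) / sqrt (1 - \<theta>)) \<longlonglongrightarrow> 0" by (rule filterlim_compose[OF _ L])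
  qed

  have lower: "\<forall>\<^sub>F p in sequentially. (1 - b3 p) * (1 - b2 p) * (1 - b1 p)
      \<le> recovery_prob (n1 p) (n2 p) p (\<sigma>1 p) (\<sigma>2 p) (\<beta>s p) (lam p)"
    using parts s1 n11 n21 order_tendstoD(2)[OF B2 zero_less_one] order_tendstoD(2)[OF B3 zero_less_one]
  proof eventually_elim
    case (elim p)
    have m0: "real (m p) > 0" using elim by (simp add: m_def)
    have \<mu>0: "\<mu> p > 0" using mu[of p] m0 by linarith
    have bias: "real (n1 p + n2 p) * lam p * sqrt (real (s p)) / ((1 - 8 * \<eta>) * real (n1 p + n2 p)) \<le> \<rho> p / 2"
    proof -
      have "real (m p) * (lam p * sqrt (real (s p))) \<le> (2 * \<mu> p) * (\<rho> p / 32)"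
        using elim mu[of p] m0 lam[of p] \<mu>0 by (intro mult_mono) auto
      also have "\<dots> \<le> \<rho> p / 2 * \<mu> p" using \<mu>0 rho_pos[of p] by simp
      finally have "real (m p) * lam p * sqrt (real (s p)) / \<mu> p \<le> \<rho> p / 2"
        using \<mu>0 by (simp add: pos_divide_le_eq mult.assoc)
      then show ?thesis by (simp add: \<mu>_def m_def)
    qed
    show ?case
      unfolding b1_def b2_def b3_def nl_def \<Sigma>_def \<mu>_def m_def
      using elim lam sigma \<eta> \<theta> rho_pos supp rho_bd bias
      by (intro recovery_prob_lower_bound[where \<rho> = "\<rho> p"])
        (auto simp: b2_def b3_def nl_def \<Sigma>_def \<mu>_def m_def)
  qed
  have "(\<lambda>p. (1 - b3 p) * (1 - b2 p) * (1 - b1 p)) \<longlonglongrightarrow> (1 - 0) * (1 - 0) * (1 - 0)"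
    by (intro tendsto_intros B1 B2 B3)
  then have lim: "(\<lambda>p. (1 - b3 p) * (1 - b2 p) * (1 - b1 p)) \<longlonglongrightarrow> 1" by simp
  show ?thesis
    by (rule tendsto_sandwich[OF lower _ lim tendsto_const]) (simp add: recovery_prob_range)
qed

theorem theorem3:
  fixes s n1 n2 :: "nat \<Rightarrow> nat"
    and \<sigma>1 \<sigma>2 \<rho> :: "nat \<Rightarrow> real"
    and \<beta>s :: "nat \<Rightarrow> nat \<Rightarrow> real"
  assumes sigma: "\<And>p. 0 < (\<sigma>1 p)\<^sup>2 \<and> (\<sigma>1 p)\<^sup>2 < (\<sigma>2 p)\<^sup>2"
    and rho_pos: "\<And>p. \<rho> p > 0"
    and supp: "\<And>p. card {j. j < p \<and> \<beta>s p j \<noteq> 0} = s p"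
    and rho_bd: "\<And>p j. j < p \<Longrightarrow> \<beta>s p j \<noteq> 0 \<Longrightarrow> \<bar>\<beta>s p j\<bar> \<ge> \<rho> p"
    and s_inf: "filterlim (\<lambda>p. real (s p)) at_top sequentially"
    and s_small: "(\<lambda>p. real (s p)) \<in> o(\<lambda>p. real p)"
    and n1_big: "(\<lambda>p. real (n1 p)) \<in> \<omega>(\<lambda>p. real (s p))"
    and n2_big: "(\<lambda>p. real (n2 p)) \<in> \<omega>(\<lambda>p. real (s p))"
  defines "nALG \<equiv> (\<lambda>p. 2 * real (s p) * ln (real p - real (s p)) + real (s p) + 1)"
    and "n \<equiv> (\<lambda>p. n1 p + n2 p)"
    and "\<sigma>avg2 \<equiv> (\<lambda>p. (real (n1 p) * (\<sigma>1 p)\<^sup>2 + real (n2 p) * (\<sigma>2 p)\<^sup>2) / real (n1 p + n2 p))"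
  shows
    "((\<exists>\<epsilon>>0. \<forall>\<^sub>F p in sequentially. real (n p) < (1 - \<epsilon>) * nALG p) \<longrightarrow>
        (\<forall>lam :: nat \<Rightarrow> real. (\<forall>p. lam p > 0) \<longrightarrow>
           ((\<exists>L. (\<lambda>p. (real (n1 p) * (\<sigma>1 p)\<^sup>2 + real (n2 p) * (\<sigma>2 p)\<^sup>2)
                        / ((lam p)\<^sup>2 * (real (n p))\<^sup>2)) \<longlonglongrightarrow> L)
            \<or> filterlim (\<lambda>p. (real (n1 p) * (\<sigma>1 p)\<^sup>2 + real (n2 p) * (\<sigma>2 p)\<^sup>2)
                        / ((lam p)\<^sup>2 * (real (n p))\<^sup>2)) at_top sequentially) \<longrightarrow>
           (\<lambda>p. recovery_prob (n1 p) (n2 p) p (\<sigma>1 p) (\<sigma>2 p) (\<beta>s p) (lam p)) \<longlonglongrightarrow> 0))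
     \<and>
     ((\<exists>\<epsilon>>0. \<forall>\<^sub>F p in sequentially. real (n p) > (1 + \<epsilon>) * nALG p) \<longrightarrow>
        (\<forall>lam :: nat \<Rightarrow> real. (\<forall>p. lam p > 0) \<longrightarrow> lam \<longlonglongrightarrow> 0 \<longrightarrow>
           filterlim (\<lambda>p. real (n p) * (lam p)\<^sup>2 / (\<sigma>avg2 p * ln (real p - real (s p))))
             at_top sequentially \<longrightarrow>
           (\<lambda>p. (1 / \<rho> p) * (lam p * sqrt (real (s p))
                 + sqrt (\<sigma>avg2 p * ln (real (s p)) / real (n p)))) \<longlonglongrightarrow> 0 \<longrightarrow>
           (\<lambda>p. recovery_prob (n1 p) (n2 p) p (\<sigma>1 p) (\<sigma>2 p) (\<beta>s p) (lam p)) \<longlonglongrightarrow> 1))"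
proof (intro conjI impI allI)
  fix lam :: "nat \<Rightarrow> real"
  assume "\<exists>\<epsilon>>0. \<forall>\<^sub>F p in sequentially. real (n p) < (1 - \<epsilon>) * nALG p" and lam: "\<forall>p. lam p > 0"
  then obtain \<epsilon> where "\<epsilon> > 0" "\<forall>\<^sub>F p in sequentially. real (n p) < (1 - \<epsilon>) * nALG p" by blast
  then show "(\<lambda>p. recovery_prob (n1 p) (n2 p) p (\<sigma>1 p) (\<sigma>2 p) (\<beta>s p) (lam p)) \<longlonglongrightarrow> 0"
    unfolding n_def nALG_def
    using lam by (intro recovery_prob_tendsto_0[OF supp s_inf s_small n1_big]) auto
next
  fix lam :: "nat \<Rightarrow> real"
  assume "\<exists>\<epsilon>>0. \<forall>\<^sub>F p in sequentially. real (n p) > (1 + \<epsilon>) * nALG p" and lam: "\<forall>p. lam p > 0"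
    and big: "filterlim (\<lambda>p. real (n p) * (lam p)\<^sup>2 / (\<sigma>avg2 p * ln (real p - real (s p)))) at_top sequentially"
    and small: "(\<lambda>p. (1 / \<rho> p) * (lam p * sqrt (real (s p))
                 + sqrt (\<sigma>avg2 p * ln (real (s p)) / real (n p)))) \<longlonglongrightarrow> 0"
  then obtain \<epsilon> where \<epsilon>: "\<epsilon> > 0" "\<forall>\<^sub>F p in sequentially. real (n p) > (1 + \<epsilon>) * nALG p" by blast
  have \<sigma>1: "\<sigma>1 p \<noteq> 0" for p using sigma[of p] by auto
  show "(\<lambda>p. recovery_prob (n1 p) (n2 p) p (\<sigma>1 p) (\<sigma>2 p) (\<beta>s p) (lam p)) \<longlonglongrightarrow> 1"
    using \<epsilon> lam big small unfolding n_def nALG_def \<sigma>avg2_def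
    by (intro recovery_prob_tendsto_1[OF \<sigma>1 rho_pos supp rho_bd s_inf s_small n1_big n2_big, where \<epsilon> = \<epsilon>]) auto
qed

end
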